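(* For every program $P$ and every ConSpec contract $\mathcal{C}$, the inlined program $\mathcal{I}(P,\mathcal{C})$ produced by the example inliner adheres to $\mathcal{C}$.
   Context: Program model: Java bytecode programs (classes mapping method names to instruction arrays and exception handler tables) executed by the standard JVM small-step semantics on type-safe configurations $(h,R)$ (heap, stack of activation records $(M,pc,s,l)$ or exceptional records $(\ell)$), except that methods of a fixed API are executed atomically and nondeterministically (on a call, the arguments are popped and either an arbitrary value of the return type is pushed with an arbitrary new heap, or an arbitrary exception is raised); reflection is not used. An execution starts in the initial configuration of the main method. Contracts. A ConSpec contract declares security state variables with initial values and, for security-relevant API methods $c.m$, BEFORE, AFTER and EXCEPTIONAL clauses, each a list of guarded commands $g\to\{stmts\}$ whose guards are side-effect-free terminating boolean expressions over the security state, call arguments (and return value for AFTER) and whose statements update the security state; guards are tried top to bottom, the first true one fires, and if none holds the policy is violated. It determines a security automaton $(Q,\Sigma,\delta,q_0)$: $Q$ a countable set of states containing an error state $\bot$ (all other states accepting), $\delta(\bot,\alpha)=\bot$, and $\Sigma$ consisting of pre-actions $(c.m,\mathbf v)^\uparrow$, normal post-actions $(c.m,\mathbf v,r)^\downarrow$ and exceptional post-actions $(c.m,\mathbf v)^\Downarrow$ ($\mathbf v$ the call arguments, $r$ the return value). The security relevant trace $SRT(E)$ of an execution $E$ is the sequence of actions emitted as follows: a configuration calling API method $c'.m'$ with arguments $\mathbf v$ emits $(c'.m',\mathbf v)^\uparrow$ (and pushes $\mathbf v$ on an auxiliary stack); a configuration returning normally from $c.m$ with value $r$ emits $(c.m,\mathbf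 v,r)^\downarrow$ where $\mathbf v$ is popped from the auxiliary stack; an exceptionally returning configuration emits $(c.m,\mathbf v)^\Downarrow$ with $\mathbf v$ popped. The contract is identified with the set of traces accepted by its automaton. A program adheres to $\mathcal{C}$ if $SRT(E)\in\mathcal{C}$ for every execution $E$. Example inliner. $\mathcal{I}(P,\mathcal{C})$ stores the embedded monitor state $\mathbf{ms}$ in static field(s) of a fresh final security state class (initialised to the contract's initial state). Each invoke instruction of $c.m$ is replaced by a block that stores the target and arguments in fresh local variables, then tests the dynamic class of the target against the API classes $c^1<:\dots<:c^k$ defining or overriding $m$ from the most specific upward; for the first match it evaluates the guards of the corresponding BEFORE clause in order, performs the updates of the first true guard, or calls System.exit if none holds; then it performs the original invoke; on normal return it evaluates the AFTER clause in the same way; an exception handler catching any Throwable thrown by the invoke (and nothing else) evaluates the EXCEPTIONAL clause in the same way and rethrows the exception.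
   Formalization: Adherence is claimed if post-actions never violate the contract; for any contract, a rejected trace is an accepted one plus a final post-action. The class tests also cover program classes overriding API methods; API calls leave the security state fields unchanged. *)

theory Defs
  imports Main "HOL-Library.Word"
begin

section \<open>Types, values, classes and instructions\<close>

type_synonym cname = string
type_synonym mname = string
type_synonym vname = string
type_synonym addr = nat
type_synonym int32 = "32 word"

datatype ty = Boolean | Integer | NT | Class cname | Array ty

text \<open>
  \<^const>\<open>NT\<close> is the type of the null reference.  \<open>const\<close> collects the values that may occur as
  literals in code and in contracts; addresses cannot.
\<close>

datatype const = Null | Bool bool | Intg int32
datatype val = Const const | Addr addr

datatype unop = Not | Neg
datatype binop = Add | Sub | Mul | Lt | Eq | And | Or

datatype imode = Virtual | Special | Static

text \<open>
  Jump offsets are relative to the address of the jump.  \<open>Exit\<close> stands for a call of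
  \<open>System.exit\<close>: it stops the virtual machine.  As it neither returns nor throws it does not fit the
  nondeterministic semantics of API methods given below, so it is not one of them.
\<close>

datatype instr =
    Push const | Load nat | Store nat | Pop | Dup | Swap
  | Unop unop | Binop binop
  | New cname | Getfield vname cname | Putfield vname cname
  | Getstatic cname vname | Putstatic cname vname
  | Checkcast cname | Instanceof cname
  | NewArray ty | ALoad | AStore | ALength
  | Goto int | IfFalse int
  | Invoke imode cname mname | Return | Throw | Exit

text \<open>
  A handler \<open>(b, e, t, c)\<close> guards the instructions in \<open>[b, e)\<close> against exceptions of class \<open>c\<close> and its
  subclasses; control is transferred to \<open>t\<close>.  The number \<open>mxl\<close> counts the locals that do not hold
  arguments.
\<close>

type_synonym handler = "nat \<times> nat \<times> nat \<times> cname"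

datatype code = Code (mxl: nat) (instrs: "instr list") (handlers: "handler list")

text \<open>
  The parameter \<open>'b\<close> is the type of method bodies: \<open>unit\<close> for the API, of which only the signature is
  known, \<open>code\<close> for programs, and \<open>code option\<close> for a program linked with the API.  The return type
  \<open>None\<close> is \<open>void\<close>.  Static fields come with their initial value.  There is no overloading, so a
  method is identified by its name.
\<close>

datatype 'b mdecl = MDecl (static: bool) (params: "ty list") (ret: "ty option") (body: 'b)

datatype 'b cls = Cls
  (super: "cname option")
  (ifields: "(vname \<times> ty) list")
  (sfields: "(vname \<times> ty \<times> const) list")
  (methods: "(mname \<times> 'b mdecl) list")

type_synonym api = "(cname \<times> unit cls) list"
type_synonym world = "(cname \<times> code option cls) list"

record program =
  classes :: "(cname \<times> code cls) list"
  main :: "cname \<times> mname"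

definition link :: "api \<Rightarrow> program \<Rightarrow> world" where
  "link api P =
     map (\<lambda>(c, k). (c, map_cls (\<lambda>_. None) k)) api @ map (\<lambda>(c, k). (c, map_cls Some k)) (classes P)"


section \<open>Class hierarchy\<close>

definition subcls1 :: "(cname \<times> 'b cls) list \<Rightarrow> (cname \<times> cname) set" where
  "subcls1 W = {(c, d). \<exists>k. map_of W c = Some k \<and> super k = Some d}"

definition subcls :: "(cname \<times> 'b cls) list \<Rightarrow> cname \<Rightarrow> cname \<Rightarrow> bool" where
  "subcls W c d \<longleftrightarrow> (c, d) \<in> (subcls1 W)\<^sup>*"

partial_function (option) lookup_method ::
  "(cname \<times> 'b cls) list \<Rightarrow> cname \<Rightarrow> mname \<Rightarrow> (cname \<times> 'b mdecl) option" where
  "lookup_method W c m =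
     Option.bind (map_of W c) (\<lambda>k.
       case map_of (methods k) m of
         Some M \<Rightarrow> Some (c, M)
       | None \<Rightarrow> Option.bind (super k) (\<lambda>d. lookup_method W d m))"

definition declares :: "(cname \<times> 'b cls) list \<Rightarrow> cname \<Rightarrow> mname \<Rightarrow> 'b mdecl \<Rightarrow> bool" where
  "declares W c m M \<longleftrightarrow> (\<exists>k. map_of W c = Some k \<and> map_of (methods k) m = Some M)"

definition has_field :: "(cname \<times> 'b cls) list \<Rightarrow> cname \<Rightarrow> cname \<Rightarrow> vname \<Rightarrow> ty \<Rightarrow> bool" where
  "has_field W c d f T \<longleftrightarrow>
     subcls W c d \<and> (\<exists>k. map_of W d = Some k \<and> map_of (ifields k) f = Some T)"

definition has_sfield :: "(cname \<times> 'b cls) list \<Rightarrow> cname \<Rightarrow> vname \<Rightarrow> ty \<Rightarrow> const \<Rightarrow> bool" where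
  "has_sfield W c f T v \<longleftrightarrow> (\<exists>k. map_of W c = Some k \<and> map_of (sfields k) f = Some (T, v))"

inductive widen :: "(cname \<times> 'b cls) list \<Rightarrow> ty \<Rightarrow> ty \<Rightarrow> bool" for W where
  "widen W T T"
| "widen W NT (Class c)"
| "widen W NT (Array T)"
| "subcls W c d \<Longrightarrow> widen W (Class c) (Class d)"
| "widen W (Array T) (Class ''Object'')"
| "widen W S T \<Longrightarrow> widen W (Array S) (Array T)"


section \<open>Heaps and configurations\<close>

datatype obj =
    Obj cname "vname \<times> cname \<Rightarrow> val option"
  | Arr ty "val list"

fun class_of :: "obj \<Rightarrow> cname" where
  "class_of (Obj c fs) = c"
| "class_of (Arr T vs) = ''Object''"

record heap =
  objs :: "addr \<Rightarrow> obj option"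
  statics :: "cname \<times> vname \<Rightarrow> val option"

fun const_ty :: "const \<Rightarrow> ty" where
  "const_ty Null = NT"
| "const_ty (Bool b) = Boolean"
| "const_ty (Intg i) = Integer"

fun obj_ty :: "obj \<Rightarrow> ty" where
  "obj_ty (Obj c fs) = Class c"
| "obj_ty (Arr T vs) = Array T"

fun typeof :: "heap \<Rightarrow> val \<Rightarrow> ty option" where
  "typeof h (Const c) = Some (const_ty c)"
| "typeof h (Addr a) = map_option obj_ty (objs h a)"

definition conf :: "world \<Rightarrow> heap \<Rightarrow> val \<Rightarrow> ty \<Rightarrow> bool" where
  "conf W h v T \<longleftrightarrow> (\<exists>S. typeof h v = Some S \<and> widen W S T)"

text \<open>Conformance of the (optional) result of a method to its return type.\<close>

definition conf_ret :: "world \<Rightarrow> heap \<Rightarrow> val option \<Rightarrow> ty option \<Rightarrow> bool" where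
  "conf_ret W h r T \<longleftrightarrow> rel_option (conf W h) r T"

fun conf_obj :: "world \<Rightarrow> heap \<Rightarrow> obj \<Rightarrow> bool" where
  "conf_obj W h (Obj c fs) \<longleftrightarrow>
     c \<in> fst ` set W \<and> (\<forall>d f T. has_field W c d f T \<longrightarrow> (\<exists>v. fs (f, d) = Some v \<and> conf W h v T))"
| "conf_obj W h (Arr T vs) \<longleftrightarrow> (\<forall>v \<in> set vs. conf W h v T)"

definition conf_heap :: "world \<Rightarrow> heap \<Rightarrow> bool" where
  "conf_heap W h \<longleftrightarrow>
     finite (dom (objs h)) \<and>
     (\<forall>ob \<in> ran (objs h). conf_obj W h ob) \<and>
     (\<forall>c f T i. has_sfield W c f T i \<longrightarrow> (\<exists>v. statics h (c, f) = Some v \<and> conf W h v T))"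

text \<open>Locations keep their type: objects never change their class, arrays neither type nor length.\<close>

definition hext :: "heap \<Rightarrow> heap \<Rightarrow> bool" where
  "hext h h' \<longleftrightarrow>
     (\<forall>a c fs. objs h a = Some (Obj c fs) \<longrightarrow> (\<exists>fs'. objs h' a = Some (Obj c fs'))) \<and>
     (\<forall>a T vs. objs h a = Some (Arr T vs) \<longrightarrow>
        (\<exists>vs'. objs h' a = Some (Arr T vs') \<and> length vs' = length vs))"

fun default_val :: "ty \<Rightarrow> val" where
  "default_val Boolean = Const (Bool False)"
| "default_val Integer = Const (Intg 0)"
| "default_val T = Const Null"

definition blank :: "world \<Rightarrow> cname \<Rightarrow> obj" where
  "blank W c = Obj c (\<lambda>(f, d).
     case map_of W d of
       Some k \<Rightarrow> if subcls W c d then map_option default_val (map_of (ifields k) f) else None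
     | None \<Rightarrow> None)"

text \<open>
  \<open>Frame c m pc s l\<close> is a normal activation record of the method \<open>m\<close> declared in class \<open>c\<close>, and \<open>Exc a\<close>
  the exceptional one for the exception object at address \<open>a\<close>.  The top of a stack is its head.
\<close>

datatype frame = Frame cname mname nat "val list" "val list" | Exc addr

type_synonym jconf = "heap \<times> frame list"


section \<open>Semantics of the virtual machine\<close>

fun eval_unop :: "unop \<Rightarrow> val \<Rightarrow> val option" where
  "eval_unop Not (Const (Bool b)) = Some (Const (Bool (\<not> b)))"
| "eval_unop Neg (Const (Intg i)) = Some (Const (Intg (- i)))"
| "eval_unop _ _ = None"

fun eval_binop :: "binop \<Rightarrow> val \<Rightarrow> val \<Rightarrow> val option" where
  "eval_binop Add (Const (Intg i)) (Const (Intg j)) = Some (Const (Intg (i + j)))"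
| "eval_binop Sub (Const (Intg i)) (Const (Intg j)) = Some (Const (Intg (i - j)))"
| "eval_binop Mul (Const (Intg i)) (Const (Intg j)) = Some (Const (Intg (i * j)))"
| "eval_binop Lt (Const (Intg i)) (Const (Intg j)) = Some (Const (Bool (sint i < sint j)))"
| "eval_binop And (Const (Bool a)) (Const (Bool b)) = Some (Const (Bool (a \<and> b)))"
| "eval_binop Or (Const (Bool a)) (Const (Bool b)) = Some (Const (Bool (a \<or> b)))"
| "eval_binop Eq v w = Some (Const (Bool (v = w)))"
| "eval_binop _ _ _ = None"

definition jump :: "nat \<Rightarrow> int \<Rightarrow> nat" where
  "jump pc off = nat (int pc + off)"

definition cast_ok :: "heap \<Rightarrow> world \<Rightarrow> val \<Rightarrow> cname \<Rightarrow> bool" where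
  "cast_ok h W v c \<longleftrightarrow>
     v = Const Null \<or> (\<exists>a ob. v = Addr a \<and> objs h a = Some ob \<and> subcls W (class_of ob) c)"

text \<open>
  Normal execution of an instruction other than calls, returns and throws.  As in a defensive
  machine, a rule applies only to operands of the prescribed types, so that execution never leaves
  the type-safe configurations; for verified code this excludes nothing.
\<close>

inductive exec :: "world \<Rightarrow> instr \<Rightarrow> heap \<times> nat \<times> val list \<times> val list
    \<Rightarrow> heap \<times> nat \<times> val list \<times> val list \<Rightarrow> bool" for W where
  "exec W (Push c) (h, pc, s, l) (h, pc + 1, Const c # s, l)"
| "i < length l \<Longrightarrow> exec W (Load i) (h, pc, s, l) (h, pc + 1, l ! i # s, l)"
| "i < length l \<Longrightarrow> exec W (Store i) (h, pc, v # s, l) (h, pc + 1, s, l[i := v])"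
| "exec W Pop (h, pc, v # s, l) (h, pc + 1, s, l)"
| "exec W Dup (h, pc, v # s, l) (h, pc + 1, v # v # s, l)"
| "exec W Swap (h, pc, v # w # s, l) (h, pc + 1, w # v # s, l)"
| "eval_unop u v = Some w \<Longrightarrow> exec W (Unop u) (h, pc, v # s, l) (h, pc + 1, w # s, l)"
| "eval_binop b v w = Some x \<Longrightarrow> exec W (Binop b) (h, pc, w # v # s, l) (h, pc + 1, x # s, l)"
| "c \<in> fst ` set W \<Longrightarrow> objs h a = None \<Longrightarrow>
   exec W (New c) (h, pc, s, l) (h\<lparr>objs := (objs h)(a \<mapsto> blank W c)\<rparr>, pc + 1, Addr a # s, l)"
| "objs h a = Some (Obj d fs) \<Longrightarrow> has_field W d c f T \<Longrightarrow> fs (f, c) = Some v \<Longrightarrow>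
   exec W (Getfield f c) (h, pc, Addr a # s, l) (h, pc + 1, v # s, l)"
| "objs h a = Some (Obj d fs) \<Longrightarrow> has_field W d c f T \<Longrightarrow> conf W h v T \<Longrightarrow>
   exec W (Putfield f c) (h, pc, v # Addr a # s, l)
     (h\<lparr>objs := (objs h)(a \<mapsto> Obj d (fs((f, c) \<mapsto> v)))\<rparr>, pc + 1, s, l)"
| "has_sfield W c f T i \<Longrightarrow> statics h (c, f) = Some v \<Longrightarrow>
   exec W (Getstatic c f) (h, pc, s, l) (h, pc + 1, v # s, l)"
| "has_sfield W c f T i \<Longrightarrow> conf W h v T \<Longrightarrow>
   exec W (Putstatic c f) (h, pc, v # s, l)
     (h\<lparr>statics := (statics h)((c, f) \<mapsto> v)\<rparr>, pc + 1, s, l)"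
| "cast_ok h W v c \<Longrightarrow> exec W (Checkcast c) (h, pc, v # s, l) (h, pc + 1, v # s, l)"
| "v = Const Null \<or> (\<exists>a. v = Addr a \<and> objs h a \<noteq> None) \<Longrightarrow>
   exec W (Instanceof c) (h, pc, v # s, l)
     (h, pc + 1, Const (Bool (v \<noteq> Const Null \<and> cast_ok h W v c)) # s, l)"
| "objs h a = None \<Longrightarrow> sint n \<ge> 0 \<Longrightarrow>
   exec W (NewArray T) (h, pc, Const (Intg n) # s, l)
     (h\<lparr>objs := (objs h)(a \<mapsto> Arr T (replicate (unat n) (default_val T)))\<rparr>, pc + 1, Addr a # s, l)"
| "objs h a = Some (Arr T vs) \<Longrightarrow> 0 \<le> sint i \<Longrightarrow> unat i < length vs \<Longrightarrow>
   exec W ALoad (h, pc, Const (Intg i) # Addr a # s, l) (h, pc + 1, vs ! unat i # s, l)"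
| "objs h a = Some (Arr T vs) \<Longrightarrow> 0 \<le> sint i \<Longrightarrow> unat i < length vs \<Longrightarrow> conf W h v T \<Longrightarrow>
   exec W AStore (h, pc, v # Const (Intg i) # Addr a # s, l)
     (h\<lparr>objs := (objs h)(a \<mapsto> Arr T (vs[unat i := v]))\<rparr>, pc + 1, s, l)"
| "objs h a = Some (Arr T vs) \<Longrightarrow>
   exec W ALength (h, pc, Addr a # s, l) (h, pc + 1, Const (Intg (of_nat (length vs))) # s, l)"
| "exec W (Goto off) (h, pc, s, l) (h, jump pc off, s, l)"
| "exec W (IfFalse off) (h, pc, Const (Bool b) # s, l) (h, if b then pc + 1 else jump pc off, s, l)"

text \<open>
  The outcome of the lookup for an \<open>Invoke\<close> on the given operand stack: either the target is null, or
  the call goes to the method declared in the given class, with the implicit argument (none or one),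
  the proper arguments and the remaining operand stack.  It is undefined if the operands do not have
  the prescribed types.
\<close>

datatype callee = NullTarget | Callee cname "code option mdecl" "val list" "val list" "val list"

definition invoke :: "world \<Rightarrow> heap \<Rightarrow> imode \<Rightarrow> cname \<Rightarrow> mname \<Rightarrow> val list \<Rightarrow> callee option" where
  "invoke W h md c m s =
     (case lookup_method W c m of
        None \<Rightarrow> None
      | Some (d, M) \<Rightarrow>
          let n = length (params M); vs = rev (take n s); s' = drop n s in
          if \<not> list_all2 (conf W h) vs (params M) \<or> static M \<noteq> (md = Static) then None
          else if md = Static then Some (Callee d M [] vs s')
          else case s' of
              Const Null # s'' \<Rightarrow> Some NullTarget
            | Addr a # s'' \<Rightarrow>
                (case objs h a of
                   None \<Rightarrow> None
                 | Some ob \<Rightarrow>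
                     if \<not> subcls W (class_of ob) c then None
                     else map_option (\<lambda>(d', M'). Callee d' M' [Addr a] vs s'')
                       (if md = Special then Some (d, M) else lookup_method W (class_of ob) m))
            | _ \<Rightarrow> None)"

inductive throws :: "world \<Rightarrow> instr \<Rightarrow> heap \<Rightarrow> val list \<Rightarrow> cname \<Rightarrow> bool" for W where
  "throws W (Getfield f c) h (Const Null # s) ''NullPointerException''"
| "throws W (Putfield f c) h (v # Const Null # s) ''NullPointerException''"
| "objs h a \<noteq> None \<Longrightarrow> \<not> cast_ok h W (Addr a) c \<Longrightarrow>
   throws W (Checkcast c) h (Addr a # s) ''ClassCastException''"
| "sint n < 0 \<Longrightarrow>
   throws W (NewArray T) h (Const (Intg n) # s) ''NegativeArraySizeException''"
| "throws W ALoad h (Const (Intg i) # Const Null # s) ''NullPointerException''"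
| "objs h a = Some (Arr T vs) \<Longrightarrow> \<not> (0 \<le> sint i \<and> unat i < length vs) \<Longrightarrow>
   throws W ALoad h (Const (Intg i) # Addr a # s) ''ArrayIndexOutOfBoundsException''"
| "throws W AStore h (v # Const (Intg i) # Const Null # s) ''NullPointerException''"
| "objs h a = Some (Arr T vs) \<Longrightarrow> \<not> (0 \<le> sint i \<and> unat i < length vs) \<Longrightarrow>
   throws W AStore h (v # Const (Intg i) # Addr a # s) ''ArrayIndexOutOfBoundsException''"
| "objs h a = Some (Arr T vs) \<Longrightarrow> 0 \<le> sint i \<Longrightarrow> unat i < length vs \<Longrightarrow> \<not> conf W h v T \<Longrightarrow>
   throws W AStore h (v # Const (Intg i) # Addr a # s) ''ArrayStoreException''"
| "throws W ALength h (Const Null # s) ''NullPointerException''"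
| "invoke W h md c m s = Some NullTarget \<Longrightarrow>
   throws W (Invoke md c m) h s ''NullPointerException''"
| "throws W Throw h (Const Null # s) ''NullPointerException''"

definition sys_xcpts :: "cname set" where
  "sys_xcpts = {''NullPointerException'', ''ClassCastException'', ''NegativeArraySizeException'',
     ''ArrayIndexOutOfBoundsException'', ''ArrayStoreException''}"

definition method_body :: "world \<Rightarrow> cname \<Rightarrow> mname \<Rightarrow> code option" where
  "method_body W c m =
     Option.bind (map_of W c) (\<lambda>k. Option.bind (map_of (methods k) m) body)"

definition instr_at :: "world \<Rightarrow> cname \<Rightarrow> mname \<Rightarrow> nat \<Rightarrow> instr option" where
  "instr_at W c m pc =
     (case method_body W c m of
        Some b \<Rightarrow> if pc < length (instrs b) then Some (instrs b ! pc) else None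
      | None \<Rightarrow> None)"

definition find_handler :: "world \<Rightarrow> cname \<Rightarrow> nat \<Rightarrow> handler list \<Rightarrow> nat option" where
  "find_handler W x pc H =
     map_option (\<lambda>(b, e, t, c). t) (find (\<lambda>(b, e, t, c). b \<le> pc \<and> pc < e \<and> subcls W x c) H)"

definition handler_at :: "world \<Rightarrow> heap \<Rightarrow> addr \<Rightarrow> cname \<Rightarrow> mname \<Rightarrow> nat \<Rightarrow> nat option" where
  "handler_at W h a c m pc =
     (case (objs h a, method_body W c m) of
        (Some ob, Some b) \<Rightarrow> find_handler W (class_of ob) pc (handlers b)
      | _ \<Rightarrow> None)"

definition is_throwable :: "world \<Rightarrow> heap \<Rightarrow> addr \<Rightarrow> bool" where
  "is_throwable W h a \<longleftrightarrow> conf W h (Addr a) (Class ''Throwable'')"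

text \<open>
  The effect of an API call on the heap: the new heap is arbitrary among the type-safe ones, except
  that the static fields of the class \<open>sc\<close> keep their values.  Here \<open>sc\<close> is a class unknown to the
  API; without reflection API code has no means of accessing its static fields.
\<close>

definition api_heap :: "world \<Rightarrow> cname \<Rightarrow> heap \<Rightarrow> heap \<Rightarrow> bool" where
  "api_heap W sc h h' \<longleftrightarrow>
     hext h h' \<and> conf_heap W h' \<and> (\<forall>f. statics h' (sc, f) = statics h (sc, f))"

definition push_ret :: "val option \<Rightarrow> val list \<Rightarrow> val list" where
  "push_ret r s = (case r of None \<Rightarrow> s | Some v \<Rightarrow> v # s)"

definition ret_ty :: "world \<Rightarrow> cname \<Rightarrow> mname \<Rightarrow> ty option \<Rightarrow> bool" where
  "ret_ty W c m T \<longleftrightarrow> (\<exists>M. declares W c m M \<and> ret M = T)"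

text \<open>
  The program counter of a caller stays at its call instruction until the callee returns.
  Uninitialised locals hold null (verified code does not read them).
\<close>

inductive step :: "world \<Rightarrow> cname \<Rightarrow> jconf \<Rightarrow> jconf \<Rightarrow> bool" for W sc where
  Normal:
  "instr_at W c m pc = Some i \<Longrightarrow> exec W i (h, pc, s, l) (h', pc', s', l') \<Longrightarrow>
   step W sc (h, Frame c m pc s l # R) (h', Frame c m pc' s' l' # R)"
| Raise:
  "instr_at W c m pc = Some i \<Longrightarrow> throws W i h s x \<Longrightarrow> objs h a = None \<Longrightarrow>
   step W sc (h, Frame c m pc s l # R)
     (h\<lparr>objs := (objs h)(a \<mapsto> blank W x)\<rparr>, Exc a # Frame c m pc s l # R)"
| Throw:
  "instr_at W c m pc = Some Throw \<Longrightarrow> is_throwable W h a \<Longrightarrow>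
   step W sc (h, Frame c m pc (Addr a # s) l # R) (h, Exc a # Frame c m pc s l # R)"
| Call:
  "instr_at W c m pc = Some (Invoke md c' m') \<Longrightarrow>
   invoke W h md c' m' s = Some (Callee d M this vs s') \<Longrightarrow> body M = Some b \<Longrightarrow>
   step W sc (h, Frame c m pc s l # R)
     (h, Frame d m' 0 [] (this @ vs @ replicate (mxl b) (Const Null)) # Frame c m pc s' l # R)"
| Return:
  "instr_at W c m pc = Some Return \<Longrightarrow> ret_ty W c m T \<Longrightarrow> conf_ret W h r T \<Longrightarrow>
   step W sc (h, Frame c m pc (push_ret r s) l # Frame c' m' pc' s' l' # R)
     (h, Frame c' m' (pc' + 1) (push_ret r s') l' # R)"
| Return_main:
  "instr_at W c m pc = Some Return \<Longrightarrow> ret_ty W c m T \<Longrightarrow> conf_ret W h r T \<Longrightarrow>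
   step W sc (h, [Frame c m pc (push_ret r s) l]) (h, [])"
| Api_return:
  "instr_at W c m pc = Some (Invoke md c' m') \<Longrightarrow>
   invoke W h md c' m' s = Some (Callee d M this vs s') \<Longrightarrow> body M = None \<Longrightarrow>
   api_heap W sc h h' \<Longrightarrow> conf_ret W h' r (ret M) \<Longrightarrow>
   step W sc (h, Frame c m pc s l # R) (h', Frame c m (pc + 1) (push_ret r s') l # R)"
| Api_throw:
  "instr_at W c m pc = Some (Invoke md c' m') \<Longrightarrow>
   invoke W h md c' m' s = Some (Callee d M this vs s') \<Longrightarrow> body M = None \<Longrightarrow>
   api_heap W sc h h' \<Longrightarrow> is_throwable W h' a \<Longrightarrow>
   step W sc (h, Frame c m pc s l # R) (h', Exc a # Frame c m pc s' l # R)"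
| Catch:
  "handler_at W h a c m pc = Some t \<Longrightarrow>
   step W sc (h, Exc a # Frame c m pc s l # R) (h, Frame c m t [Addr a] l # R)"
| Unwind:
  "handler_at W h a c m pc = None \<Longrightarrow>
   step W sc (h, Exc a # Frame c m pc s l # R) (h, Exc a # R)"


section \<open>Executions\<close>

datatype 'a seq = FinSeq "'a list" | InfSeq "nat \<Rightarrow> 'a"

definition init_heap :: "world \<Rightarrow> heap" where
  "init_heap W = \<lparr>objs = Map.empty, statics = (\<lambda>(c, f).
     case map_of W c of
       Some k \<Rightarrow> map_option (\<lambda>(T, v). Const v) (map_of (sfields k) f)
     | None \<Rightarrow> None)\<rparr>"

definition initial :: "api \<Rightarrow> program \<Rightarrow> jconf \<Rightarrow> bool" where
  "initial api P C \<longleftrightarrow>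
     (\<exists>c m b. main P = (c, m) \<and> method_body (link api P) c m = Some b \<and>
        C = (init_heap (link api P), [Frame c m 0 [] (replicate (mxl b) (Const Null))]))"

fun execution :: "api \<Rightarrow> cname \<Rightarrow> program \<Rightarrow> jconf seq \<Rightarrow> bool" where
  "execution api sc P (FinSeq E) \<longleftrightarrow>
     E \<noteq> [] \<and> initial api P (hd E) \<and>
     (\<forall>i. Suc i < length E \<longrightarrow> step (link api P) sc (E ! i) (E ! Suc i))"
| "execution api sc P (InfSeq E) \<longleftrightarrow>
     initial api P (E 0) \<and> (\<forall>i. step (link api P) sc (E i) (E (Suc i)))"


section \<open>Contracts\<close>

datatype expr =
    Lit const | SVar vname | Arg nat | Ret | UnE unop expr | BinE binop expr expr

datatype stmt = Assign vname expr

type_synonym gcmd = "expr \<times> stmt list"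

datatype event = Before | After | Exceptional

record contract =
  svars :: "(vname \<times> ty \<times> const) list"
  clauses :: "event \<Rightarrow> cname \<Rightarrow> mname \<Rightarrow> gcmd list option"

text \<open>
  Typing relative to the types of the state variables, of the arguments and of the return value (if
  there is one).
\<close>

inductive wt_expr :: "(vname \<Rightarrow> ty option) \<Rightarrow> ty list \<Rightarrow> ty option \<Rightarrow> expr \<Rightarrow> ty \<Rightarrow> bool" for S As R where
  "wt_expr S As R (Lit c) (const_ty c)"
| "S x = Some T \<Longrightarrow> wt_expr S As R (SVar x) T"
| "i < length As \<Longrightarrow> wt_expr S As R (Arg i) (As ! i)"
| "R = Some T \<Longrightarrow> wt_expr S As R Ret T"
| "wt_expr S As R e Boolean \<Longrightarrow> wt_expr S As R (UnE Not e) Boolean"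
| "wt_expr S As R e Integer \<Longrightarrow> wt_expr S As R (UnE Neg e) Integer"
| "wt_expr S As R e Integer \<Longrightarrow> wt_expr S As R e' Integer \<Longrightarrow> b \<in> {Add, Sub, Mul} \<Longrightarrow>
   wt_expr S As R (BinE b e e') Integer"
| "wt_expr S As R e Integer \<Longrightarrow> wt_expr S As R e' Integer \<Longrightarrow> wt_expr S As R (BinE Lt e e') Boolean"
| "wt_expr S As R e Boolean \<Longrightarrow> wt_expr S As R e' Boolean \<Longrightarrow> b \<in> {And, Or} \<Longrightarrow>
   wt_expr S As R (BinE b e e') Boolean"
| "wt_expr S As R e T \<Longrightarrow> wt_expr S As R e' T' \<Longrightarrow>
   T = T' \<or> (T \<notin> {Boolean, Integer} \<and> T' \<notin> {Boolean, Integer}) \<Longrightarrow>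
   wt_expr S As R (BinE Eq e e') Boolean"

definition wf_contract :: "api \<Rightarrow> contract \<Rightarrow> bool" where
  "wf_contract api C \<longleftrightarrow>
     distinct (map fst (svars C)) \<and>
     (\<forall>(x, T, v) \<in> set (svars C). widen api (const_ty v) T) \<and>
     (\<forall>ev c m cmds. clauses C ev c m = Some cmds \<longrightarrow>
        (\<exists>M. declares api c m M \<and>
           (let wt = wt_expr (map_option fst \<circ> map_of (svars C)) (params M)
                       (if ev = After then ret M else None)
            in \<forall>(g, ss) \<in> set cmds. wt g Boolean \<and>
                 (\<forall>x e. Assign x e \<in> set ss \<longrightarrow>
                    (\<exists>T i U. map_of (svars C) x = Some (T, i) \<and> wt e U \<and> widen api U T)))))"

type_synonym sstate = "vname \<Rightarrow> val option"

fun eval_expr :: "sstate \<Rightarrow> val list \<Rightarrow> val option \<Rightarrow> expr \<Rightarrow> val option" where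
  "eval_expr \<sigma> vs r (Lit c) = Some (Const c)"
| "eval_expr \<sigma> vs r (SVar x) = \<sigma> x"
| "eval_expr \<sigma> vs r (Arg i) = (if i < length vs then Some (vs ! i) else None)"
| "eval_expr \<sigma> vs r Ret = r"
| "eval_expr \<sigma> vs r (UnE u e) = Option.bind (eval_expr \<sigma> vs r e) (eval_unop u)"
| "eval_expr \<sigma> vs r (BinE b e e') =
     Option.bind (eval_expr \<sigma> vs r e) (\<lambda>v. Option.bind (eval_expr \<sigma> vs r e') (eval_binop b v))"

fun exec_stmts :: "sstate \<Rightarrow> val list \<Rightarrow> val option \<Rightarrow> stmt list \<Rightarrow> sstate option" where
  "exec_stmts \<sigma> vs r [] = Some \<sigma>"
| "exec_stmts \<sigma> vs r (Assign x e # ss) =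
     Option.bind (eval_expr \<sigma> vs r e) (\<lambda>v. exec_stmts (\<sigma>(x \<mapsto> v)) vs r ss)"

text \<open>
  The result \<open>None\<close> signals a violation.  (Evaluation of a guard or an update of a well-formed contract
  on arguments of the right types is always defined.)
\<close>

fun fire :: "sstate \<Rightarrow> val list \<Rightarrow> val option \<Rightarrow> gcmd list \<Rightarrow> sstate option" where
  "fire \<sigma> vs r [] = None"
| "fire \<sigma> vs r ((g, ss) # cmds) =
     Option.bind (eval_expr \<sigma> vs r g) (\<lambda>v.
       if v = Const (Bool True) then exec_stmts \<sigma> vs r ss else fire \<sigma> vs r cmds)"

text \<open>Pre-actions, normal post-actions and exceptional post-actions; a \<open>void\<close> result is \<open>None\<close>.\<close>

datatype action =
    Pre cname mname "val list"
  | Post cname mname "val list" "val option"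
  | XPost cname mname "val list"

fun val_shape :: "val \<Rightarrow> ty \<Rightarrow> bool" where
  "val_shape v Boolean \<longleftrightarrow> (\<exists>b. v = Const (Bool b))"
| "val_shape v Integer \<longleftrightarrow> (\<exists>i. v = Const (Intg i))"
| "val_shape v NT \<longleftrightarrow> v = Const Null"
| "val_shape v _ \<longleftrightarrow> v = Const Null \<or> (\<exists>a. v = Addr a)"

fun alphabet :: "api \<Rightarrow> action \<Rightarrow> bool" where
  "alphabet api (Pre c m vs) \<longleftrightarrow> (\<exists>M. declares api c m M \<and> list_all2 val_shape vs (params M))"
| "alphabet api (Post c m vs r) \<longleftrightarrow>
     (\<exists>M. declares api c m M \<and> list_all2 val_shape vs (params M) \<and> rel_option val_shape r (ret M))"
| "alphabet api (XPost c m vs) \<longleftrightarrow> (\<exists>M. declares api c m M \<and> list_all2 val_shape vs (params M))"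

text \<open>
  The transition function of the security automaton.  Automaton states are of type
  \<^typ>\<open>sstate option\<close>, with \<^const>\<open>None\<close> for the error state.  An event without a clause does not
  change the state.
\<close>

definition react :: "contract \<Rightarrow> event \<Rightarrow> cname \<Rightarrow> mname \<Rightarrow> val list \<Rightarrow> val option \<Rightarrow> sstate \<Rightarrow> sstate option"
where
  "react C ev c m vs r \<sigma> =
     (case clauses C ev c m of None \<Rightarrow> Some \<sigma> | Some cmds \<Rightarrow> fire \<sigma> vs r cmds)"

fun delta :: "contract \<Rightarrow> sstate option \<Rightarrow> action \<Rightarrow> sstate option" where
  "delta C None a = None"
| "delta C (Some \<sigma>) (Pre c m vs) = react C Before c m vs None \<sigma>"
| "delta C (Some \<sigma>) (Post c m vs r) = react C After c m vs r \<sigma>"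
| "delta C (Some \<sigma>) (XPost c m vs) = react C Exceptional c m vs None \<sigma>"

definition q_init :: "contract \<Rightarrow> sstate option" where
  "q_init C = Some (map_option (\<lambda>(T, v). Const v) \<circ> map_of (svars C))"

definition accepts :: "contract \<Rightarrow> action list \<Rightarrow> bool" where
  "accepts C w \<longleftrightarrow> foldl (delta C) (q_init C) w \<noteq> None"

text \<open>The traces accepted by the automaton; an infinite run may never visit the error state.\<close>

fun contract_traces :: "contract \<Rightarrow> action seq set" where
  "contract_traces C = {FinSeq w | w. accepts C w} \<union> {InfSeq t | t. \<forall>n. accepts C (map t [0..<n])}"


section \<open>Security relevant traces and adherence\<close>

text \<open>The API method called by a configuration, with its return type and the arguments.\<close>

definition api_call :: "world \<Rightarrow> jconf \<Rightarrow> (cname \<times> mname \<times> ty option \<times> val list) option" where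
  "api_call W C =
     (case C of
        (h, Frame c m pc s l # R) \<Rightarrow>
          (case instr_at W c m pc of
             Some (Invoke md c' m') \<Rightarrow>
               (case invoke W h md c' m' s of
                  Some (Callee d M this vs s') \<Rightarrow>
                    if body M = None then Some (d, m', ret M, vs) else None
                | _ \<Rightarrow> None)
           | _ \<Rightarrow> None)
      | _ \<Rightarrow> None)"

text \<open>
  As API methods are executed atomically, a configuration returns from an API method iff its
  predecessor calls that method.
\<close>

fun post_action :: "cname \<Rightarrow> mname \<Rightarrow> ty option \<Rightarrow> val list \<Rightarrow> jconf \<Rightarrow> action" where
  "post_action d m T vs (h, Frame c m' pc s l # R) =
     Post d m vs (case T of None \<Rightarrow> None | Some _ \<Rightarrow> Some (hd s))"
| "post_action d m T vs (h, R) = XPost d m vs"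

text \<open>
  The second argument is the method called by the preceding configuration, if any; the third one is
  the auxiliary stack of arguments.
\<close>

function srt_from :: "world \<Rightarrow> (cname \<times> mname \<times> ty option) option \<Rightarrow> val list list \<Rightarrow> jconf list
    \<Rightarrow> action list" where
  "srt_from W p V [] = []"
| "srt_from W None V (C # E) =
     (case api_call W C of
        None \<Rightarrow> srt_from W None V E
      | Some (c, m, T, vs) \<Rightarrow> Pre c m vs # srt_from W (Some (c, m, T)) (vs # V) E)"
| "srt_from W (Some (c, m, T)) V (C # E) =
     post_action c m T (hd V) C # srt_from W None (tl V) (C # E)"
  by pat_completeness auto
termination
  by (relation "measures [\<lambda>(W, p, V, E). length E, \<lambda>(W, p, V, E). if p = None then 0 else 1]") auto

definition seq_limit :: "(nat \<Rightarrow> 'a list) \<Rightarrow> 'a seq" where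
  "seq_limit t =
     (if \<exists>n. \<forall>k \<ge> n. t k = t n then FinSeq (t (LEAST n. \<forall>k \<ge> n. t k = t n))
      else InfSeq (\<lambda>i. t (LEAST n. i < length (t n)) ! i))"

text \<open>The trace of an infinite execution is the limit of the traces of its finite prefixes.\<close>

fun SRT :: "world \<Rightarrow> jconf seq \<Rightarrow> action seq" where
  "SRT W (FinSeq E) = FinSeq (srt_from W None [] E)"
| "SRT W (InfSeq E) = seq_limit (\<lambda>n. srt_from W None [] (map E [0..<n]))"

definition adheres :: "api \<Rightarrow> cname \<Rightarrow> program \<Rightarrow> contract \<Rightarrow> bool" where
  "adheres api sc P C \<longleftrightarrow>
     (\<forall>E. execution api sc P E \<longrightarrow> SRT (link api P) E \<in> contract_traces C)"

text \<open>
  A post-action is emitted by the return of an API method, before any code of the program gets a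
  chance to react.  Hence no inliner can prevent post-actions from violating a contract.
  \<open>post_total\<close> singles out the contracts in which they do not: only pre-actions lead to the error
  state.
\<close>

fun is_post :: "action \<Rightarrow> bool" where
  "is_post (Pre c m vs) = False"
| "is_post (Post c m vs r) = True"
| "is_post (XPost c m vs) = True"

definition post_total :: "api \<Rightarrow> contract \<Rightarrow> bool" where
  "post_total api C \<longleftrightarrow>
     (\<forall>w a. (\<forall>x \<in> set (w @ [a]). alphabet api x) \<longrightarrow> accepts C w \<longrightarrow> is_post a \<longrightarrow>
        accepts C (w @ [a]))"


section \<open>The inliner\<close>

text \<open>
  In the code for a call, \<open>n\<close> is the first fresh local.  The locals \<open>n\<close>, \<open>n + 1\<close> and \<open>n + 2\<close> store the
  target, the return value and the exception, and the arguments are stored from \<open>n + 3\<close> on.  The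
  embedded state consists of the static fields of the class \<open>sc\<close>.
\<close>

fun expr_code :: "cname \<Rightarrow> nat \<Rightarrow> expr \<Rightarrow> instr list" where
  "expr_code sc n (Lit c) = [Push c]"
| "expr_code sc n (SVar x) = [Getstatic sc x]"
| "expr_code sc n (Arg i) = [Load (n + 3 + i)]"
| "expr_code sc n Ret = [Load (n + 1)]"
| "expr_code sc n (UnE u e) = expr_code sc n e @ [Unop u]"
| "expr_code sc n (BinE b e e') = expr_code sc n e @ expr_code sc n e' @ [Binop b]"

fun stmt_code :: "cname \<Rightarrow> nat \<Rightarrow> stmt \<Rightarrow> instr list" where
  "stmt_code sc n (Assign x e) = expr_code sc n e @ [Putstatic sc x]"

fun gcmds_code :: "cname \<Rightarrow> nat \<Rightarrow> gcmd list \<Rightarrow> instr list" where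
  "gcmds_code sc n [] = [Exit]"
| "gcmds_code sc n ((g, ss) # cmds) =
     (let upd = concat (map (stmt_code sc n) ss); rest = gcmds_code sc n cmds in
      expr_code sc n g @ [IfFalse (int (length upd) + 2)] @ upd @ [Goto (int (length rest) + 1)] @ rest)"

text \<open>
  The classes declaring the method to which a call of \<open>c.m\<close> may go, sorted such that every class
  precedes its superclasses.  Besides API classes there may be program classes overriding an API
  method.  They have to be tested for as well, since a call dispatched to such a class is not an API
  call.
\<close>

definition candidates :: "world \<Rightarrow> imode \<Rightarrow> cname \<Rightarrow> mname \<Rightarrow> cname list" where
  "candidates W md c m =
     (case lookup_method W c m of
        None \<Rightarrow> []
      | Some (d, M) \<Rightarrow>
          if md = Virtual
          then rev (sort_key (\<lambda>k. card {k'. subcls W k k'})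
                 (filter (\<lambda>k. subcls W k d \<and> (\<exists>M. declares W k m M)) (map fst W)))
          else [d])"

definition clause_code :: "api \<Rightarrow> contract \<Rightarrow> cname \<Rightarrow> nat \<Rightarrow> event \<Rightarrow> mname \<Rightarrow> cname \<Rightarrow> instr list" where
  "clause_code api C sc n ev m k =
     (if k \<in> fst ` set api
      then (case clauses C ev k m of None \<Rightarrow> [] | Some cmds \<Rightarrow> gcmds_code sc n cmds)
      else [])"

fun select_code :: "(cname \<Rightarrow> instr list) \<Rightarrow> nat \<Rightarrow> cname list \<Rightarrow> instr list" where
  "select_code f n [] = []"
| "select_code f n (k # ks) =
     (let rest = select_code f n ks in
      [Load n, Instanceof k, IfFalse (int (length (f k)) + 2)] @ f k @ [Goto (int (length rest) + 1)] @ rest)"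

text \<open>A static call has no target, and its callee is known statically.\<close>

definition event_code :: "api \<Rightarrow> contract \<Rightarrow> cname \<Rightarrow> nat \<Rightarrow> world \<Rightarrow> imode \<Rightarrow> cname \<Rightarrow> mname \<Rightarrow> event
    \<Rightarrow> instr list" where
  "event_code api C sc n W md c m ev =
     (if md = Static
      then concat (map (clause_code api C sc n ev m) (candidates W md c m))
      else select_code (clause_code api C sc n ev m) n (candidates W md c m))"

definition call_prefix :: "api \<Rightarrow> contract \<Rightarrow> cname \<Rightarrow> nat \<Rightarrow> world \<Rightarrow> imode \<Rightarrow> cname \<Rightarrow> mname \<Rightarrow> 'b mdecl
    \<Rightarrow> instr list" where
  "call_prefix api C sc n W md c m M =
     (let k = length (params M) in
      map (\<lambda>i. Store (n + 3 + i)) (rev [0..<k]) @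
      (if md = Static then [] else [Store n]) @
      event_code api C sc n W md c m Before @
      (if md = Static then [] else [Load n]) @
      map (\<lambda>i. Load (n + 3 + i)) [0..<k])"

definition call_suffix :: "api \<Rightarrow> contract \<Rightarrow> cname \<Rightarrow> nat \<Rightarrow> world \<Rightarrow> imode \<Rightarrow> cname \<Rightarrow> mname \<Rightarrow> 'b mdecl
    \<Rightarrow> instr list" where
  "call_suffix api C sc n W md c m M =
     (if ret M = None then event_code api C sc n W md c m After
      else [Store (n + 1)] @ event_code api C sc n W md c m After @ [Load (n + 1)])"

definition call_handler :: "api \<Rightarrow> contract \<Rightarrow> cname \<Rightarrow> nat \<Rightarrow> world \<Rightarrow> imode \<Rightarrow> cname \<Rightarrow> mname
    \<Rightarrow> instr list" where
  "call_handler api C sc n W md c m =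
     [Store (n + 2)] @ event_code api C sc n W md c m Exceptional @ [Load (n + 2), Throw]"

definition call_block :: "api \<Rightarrow> contract \<Rightarrow> cname \<Rightarrow> nat \<Rightarrow> world \<Rightarrow> imode \<Rightarrow> cname \<Rightarrow> mname \<Rightarrow> instr list" where
  "call_block api C sc n W md c m =
     (case lookup_method W c m of
        None \<Rightarrow> [Invoke md c m]
      | Some (d, M) \<Rightarrow>
          let handler = call_handler api C sc n W md c m in
          call_prefix api C sc n W md c m M @ [Invoke md c m] @
          call_suffix api C sc n W md c m M @ [Goto (int (length handler) + 1)] @ handler)"

text \<open>The exception handler of a block placed at address \<open>b\<close>.\<close>

definition call_table :: "api \<Rightarrow> contract \<Rightarrow> cname \<Rightarrow> nat \<Rightarrow> world \<Rightarrow> imode \<Rightarrow> cname \<Rightarrow> mname \<Rightarrow> nat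
    \<Rightarrow> handler list" where
  "call_table api C sc n W md c m b =
     (case lookup_method W c m of
        None \<Rightarrow> []
      | Some (d, M) \<Rightarrow>
          let i = b + length (call_prefix api C sc n W md c m M);
              t = i + 1 + length (call_suffix api C sc n W md c m M) + 1
          in [(i, i + 1, t, ''Throwable'')])"

text \<open>
  \<open>new_pc is pc\<close> is the address at which the code for the instruction at \<open>pc\<close> starts; \<open>blk\<close> maps a
  call to its block.
\<close>

fun instr_length :: "(imode \<Rightarrow> cname \<Rightarrow> mname \<Rightarrow> instr list) \<Rightarrow> instr \<Rightarrow> nat" where
  "instr_length blk (Invoke md c m) = length (blk md c m)"
| "instr_length blk i = 1"

definition new_pc :: "(imode \<Rightarrow> cname \<Rightarrow> mname \<Rightarrow> instr list) \<Rightarrow> instr list \<Rightarrow> nat \<Rightarrow> nat" where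
  "new_pc blk is pc = sum_list (map (instr_length blk) (take pc is))"

definition new_offset :: "(imode \<Rightarrow> cname \<Rightarrow> mname \<Rightarrow> instr list) \<Rightarrow> instr list \<Rightarrow> nat \<Rightarrow> int \<Rightarrow> int" where
  "new_offset blk is pc off = int (new_pc blk is (jump pc off)) - int (new_pc blk is pc)"

fun inline_instr :: "(imode \<Rightarrow> cname \<Rightarrow> mname \<Rightarrow> instr list) \<Rightarrow> instr list \<Rightarrow> nat \<Rightarrow> instr \<Rightarrow> instr list" where
  "inline_instr blk is pc (Invoke md c m) = blk md c m"
| "inline_instr blk is pc (Goto off) = [Goto (new_offset blk is pc off)]"
| "inline_instr blk is pc (IfFalse off) = [IfFalse (new_offset blk is pc off)]"
| "inline_instr blk is pc i = [i]"

fun arity :: "world \<Rightarrow> instr \<Rightarrow> nat" where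
  "arity W (Invoke md c m) =
     (case lookup_method W c m of None \<Rightarrow> 0 | Some (d, M) \<Rightarrow> length (params M))"
| "arity W i = 0"

text \<open>
  The handlers of the blocks precede the original ones, which are extended to the blocks of the
  instructions they guard.
\<close>

definition inline_code :: "api \<Rightarrow> contract \<Rightarrow> cname \<Rightarrow> world \<Rightarrow> nat \<Rightarrow> code \<Rightarrow> code" where
  "inline_code api C sc W n b =
     (let is = instrs b; blk = call_block api C sc n W; pos = new_pc blk is in
      Code
        (mxl b + 3 + Max (insert 0 (arity W ` set is)))
        (concat (map (\<lambda>pc. inline_instr blk is pc (is ! pc)) [0..<length is]))
        (concat (map (\<lambda>pc. case is ! pc of
             Invoke md c m \<Rightarrow> call_table api C sc n W md c m (pos pc)
           | _ \<Rightarrow> []) [0..<length is]) @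
         map (\<lambda>(b, e, t, c). (pos b, pos e, pos t, c)) (handlers b)))"

definition inline_method :: "api \<Rightarrow> contract \<Rightarrow> cname \<Rightarrow> world \<Rightarrow> code mdecl \<Rightarrow> code mdecl" where
  "inline_method api C sc W M =
     (let n = (if static M then 0 else 1) + length (params M) + mxl (body M) in
      MDecl (static M) (params M) (ret M) (inline_code api C sc W n (body M)))"

definition inline_class :: "api \<Rightarrow> contract \<Rightarrow> cname \<Rightarrow> world \<Rightarrow> code cls \<Rightarrow> code cls" where
  "inline_class api C sc W k =
     Cls (super k) (ifields k) (sfields k)
       (map (\<lambda>(m, M). (m, inline_method api C sc W M)) (methods k))"

definition inline :: "api \<Rightarrow> cname \<Rightarrow> contract \<Rightarrow> program \<Rightarrow> program" where
  "inline api sc C P = P\<lparr>classes :=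
     (sc, Cls (Some ''Object'') [] (svars C) []) #
     map (\<lambda>(c, k). (c, inline_class api C sc (link api P) k)) (classes P)\<rparr>"


section \<open>Well-formedness\<close>

definition wf_classes :: "(cname \<times> 'b cls) list \<Rightarrow> bool" where
  "wf_classes W \<longleftrightarrow>
     distinct (map fst W) \<and> acyclic (subcls1 W) \<and>
     (\<forall>(c, k) \<in> set W.
        distinct (map fst (ifields k)) \<and> distinct (map fst (sfields k)) \<and>
        distinct (map fst (methods k)) \<and>
        (\<forall>(f, T, v) \<in> set (sfields k). widen W (const_ty v) T) \<and>
        (super k = None \<longleftrightarrow> c = ''Object'') \<and>
        (\<forall>d. super k = Some d \<longrightarrow> d \<in> fst ` set W)) \<and>
     (\<forall>c d m M M'. subcls W c d \<longrightarrow> declares W c m M \<longrightarrow> declares W d m M' \<longrightarrow>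
        static M = static M' \<and> params M = params M' \<and> ret M = ret M')"

definition wf_api :: "api \<Rightarrow> bool" where
  "wf_api api \<longleftrightarrow>
     wf_classes api \<and> ''Object'' \<in> fst ` set api \<and>
     (\<forall>x \<in> insert ''Throwable'' sys_xcpts. x \<in> fst ` set api \<and> subcls api x ''Throwable'')"

definition wf_prog :: "api \<Rightarrow> program \<Rightarrow> bool" where
  "wf_prog api P \<longleftrightarrow>
     wf_classes (link api P) \<and>
     (\<exists>M. declares (classes P) (fst (main P)) (snd (main P)) M \<and> static M \<and> params M = [])"

fun ty_classes :: "ty \<Rightarrow> cname set" where
  "ty_classes (Class c) = {c}"
| "ty_classes (Array T) = ty_classes T"
| "ty_classes T = {}"

fun instr_classes :: "instr \<Rightarrow> cname set" where
  "instr_classes (New c) = {c}"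
| "instr_classes (Getfield f c) = {c}"
| "instr_classes (Putfield f c) = {c}"
| "instr_classes (Getstatic c f) = {c}"
| "instr_classes (Putstatic c f) = {c}"
| "instr_classes (Checkcast c) = {c}"
| "instr_classes (Instanceof c) = {c}"
| "instr_classes (NewArray T) = ty_classes T"
| "instr_classes (Invoke md c m) = {c}"
| "instr_classes _ = {}"

text \<open>The class name \<open>sc\<close> is fresh: it is neither declared nor mentioned in any code.\<close>

definition fresh_class :: "api \<Rightarrow> program \<Rightarrow> cname \<Rightarrow> bool" where
  "fresh_class api P sc \<longleftrightarrow>
     sc \<notin> fst ` set (link api P) \<and>
     (\<forall>(c, k) \<in> set (classes P). \<forall>(m, M) \<in> set (methods k).
        \<forall>i \<in> set (instrs (body M)). sc \<notin> instr_classes i)"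

end

theory Submission
  imports Defs
begin

text \<open>
  The static fields of \<open>sc\<close> simulate the security automaton.  Original code and the API cannot touch
  them, jumps and handlers of the original code lead only to the beginning of blocks, and the invoke
  instruction of a block is covered by the handler of that block alone.  So whenever control is between
  blocks, the fields hold the state of the automaton.  Inside a block, the first class in the list of
  candidates that the target is an instance of is exactly the class to which the call is dispatched,
  since the superclasses of a class form a chain; hence the clauses evaluated are those of the actual
  callee, or none if the callee belongs to the program.  Getting stuck does no harm, so neither typing nor
  termination matters: it suffices that the code of a clause can be left only if the clause fires.  In
  particular, after a post-action that violates the contract the code of that event is never left, and
  no further action is emitted.
\<close>

section \<open>Straight-line code\<close>

text \<open>Inside a block the fields and the automaton do not move together. At the invoke the
  fields are ahead: the BEFORE clause has run, but the pre-action is emitted only by the call.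
  Behind the call they lag: the post-action has been emitted, and the AFTER or EXCEPTIONAL code is
  still to come. So the invariant carries the automaton state \<open>q\<close> beside the heap and
  relates the two differently at each place. A second obstacle is that a block tests the class of
  the target up to twice, in different heaps: before the call, and again behind it or in the
  handler. The answers agree because an allocated object never changes its class. A frame waiting
  for a program method cannot mention the fields at all, since its callee may change them; it only
  remembers that its target selects no API class, so that the code behind the call will do nothing.
  Finally, the inliner computes its lists of candidates in the original world \<open>W\<close>,
  whereas calls and tests are executed in the world \<open>W'\<close> of the inlined program, so
  hierarchy and lookup have to be compared between the two.\<close>

fun fwd :: "instr \<Rightarrow> bool" where
  "fwd (Goto off) \<longleftrightarrow> 0 \<le> off"
| "fwd (IfFalse off) \<longleftrightarrow> 0 \<le> off"
| "fwd _ \<longleftrightarrow> True"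

lemma jump_nonneg: "0 \<le> off \<Longrightarrow> jump pc off = pc + nat off"
  by (simp add: jump_def nat_add_distrib)

inductive_simps exec_simps:
  "exec W (Push c) (h, pc, s, l) (h', pc', s', l')"
  "exec W (Load i) (h, pc, s, l) (h', pc', s', l')"
  "exec W (Store i) (h, pc, s, l) (h', pc', s', l')"
  "exec W (Pop) (h, pc, s, l) (h', pc', s', l')"
  "exec W (Dup) (h, pc, s, l) (h', pc', s', l')"
  "exec W (Swap) (h, pc, s, l) (h', pc', s', l')"
  "exec W (Unop u) (h, pc, s, l) (h', pc', s', l')"
  "exec W (Binop b) (h, pc, s, l) (h', pc', s', l')"
  "exec W (New c) (h, pc, s, l) (h', pc', s', l')"
  "exec W (Getfield f c) (h, pc, s, l) (h', pc', s', l')"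
  "exec W (Putfield f c) (h, pc, s, l) (h', pc', s', l')"
  "exec W (Getstatic c f) (h, pc, s, l) (h', pc', s', l')"
  "exec W (Putstatic c f) (h, pc, s, l) (h', pc', s', l')"
  "exec W (Checkcast c) (h, pc, s, l) (h', pc', s', l')"
  "exec W (Instanceof c) (h, pc, s, l) (h', pc', s', l')"
  "exec W (NewArray T) (h, pc, s, l) (h', pc', s', l')"
  "exec W (ALoad) (h, pc, s, l) (h', pc', s', l')"
  "exec W (AStore) (h, pc, s, l) (h', pc', s', l')"
  "exec W (ALength) (h, pc, s, l) (h', pc', s', l')"
  "exec W (Goto off) (h, pc, s, l) (h', pc', s', l')"
  "exec W (IfFalse off) (h, pc, s, l) (h', pc', s', l')"
  "exec W (Invoke md c m) (h, pc, s, l) (h', pc', s', l')"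
  "exec W (Return) (h, pc, s, l) (h', pc', s', l')"
  "exec W (Throw) (h, pc, s, l) (h', pc', s', l')"
  "exec W (Exit) (h, pc, s, l) (h', pc', s', l')"

lemma jump_block [simp]:
  "jump k (int n + 1) = k + n + 1" "jump k (int n + 2) = k + n + 2"
  by (simp_all add: jump_def)

text \<open>Only jumps use the program counter other than to increment it. As \<open>jump\<close>
  truncates at 0, it commutes with relocation by \<open>a\<close> in general only for non-negative
  offsets; hence \<open>fwd\<close>.\<close>

lemma exec_shift:
  assumes "exec W i (h, a + k, s, l) (h', p', s', l')" and "fwd i"
  shows "\<exists>k'. p' = a + k' \<and> exec W i (h, k, s, l) (h', k', s', l')"
  using assms
  by (cases i) (auto simp: exec_simps jump_nonneg simp del: ex_simps, force, blast)

lemma exec_pc: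
  assumes "exec W i (h, pc, s, l) (h', pc', s', l')"
  shows "(pc' = pc + 1 \<and> (\<forall>off. i \<noteq> Goto off)) \<or> (\<exists>off. (i = Goto off \<or> i = IfFalse off) \<and> pc' = jump pc off)"
  using assms by (cases i) (auto simp: exec_simps)

text \<open>
  \<open>wpo W cs Q h k s l\<close> is the weakest precondition of \<open>cs\<close> for execution from offset \<open>k\<close> on: control
  leaves \<open>cs\<close> only at its end, and then \<open>Q\<close> holds.  Getting stuck is permitted.
\<close>

inductive wpo :: "world \<Rightarrow> instr list \<Rightarrow> (heap \<Rightarrow> val list \<Rightarrow> val list \<Rightarrow> bool)
    \<Rightarrow> heap \<Rightarrow> nat \<Rightarrow> val list \<Rightarrow> val list \<Rightarrow> bool" for W cs Q where
  wpo_exit: "Q h s l \<Longrightarrow> k = length cs \<Longrightarrow> wpo W cs Q h k s l"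
| wpo_step: "k < length cs \<Longrightarrow>
    (\<And>h' k' s' l'. exec W (cs ! k) (h, k, s, l) (h', k', s', l') \<Longrightarrow> wpo W cs Q h' k' s' l') \<Longrightarrow>
    wpo W cs Q h k s l"

text \<open>By \<open>exec_shift\<close> the run of \<open>B\<close> is the same up to relocation.
  Reaching the end of \<open>B\<close> is no longer an exit but the start of what follows, which the
  last assumption covers.\<close>

lemma wpo_embed:
  assumes "wpo W B Q h k s l" and "\<forall>i \<in> set B. fwd i"
    and "\<And>h s l. Q h s l \<Longrightarrow> wpo W (A @ B @ D) R h (length A + length B) s l"
  shows "wpo W (A @ B @ D) R h (length A + k) s l"
  using assms(1)
proof induction
  case (wpo_exit h s l k)
  then show ?case using assms(3) by simp
next
  case (wpo_step k h s l)
  show ?case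
  proof (rule wpo.wpo_step)
    fix h' k' s' l'
    assume "exec W ((A @ B @ D) ! (length A + k)) (h, length A + k, s, l) (h', k', s', l')"
    then have "exec W (B ! k) (h, length A + k, s, l) (h', k', s', l')"
      using wpo_step.hyps by (simp add: nth_append)
    then show "wpo W (A @ B @ D) R h' k' s' l'"
      using exec_shift[of W "B ! k" h "length A" k s l h' k' s' l'] assms(2) wpo_step by auto
  qed (use wpo_step in simp)
qed

lemma wpo_append:
  assumes A: "wpo W A (\<lambda>h s l. wpo W B Q h 0 s l) h 0 s l"
    and fA: "\<forall>i \<in> set A. fwd i" and fB: "\<forall>i \<in> set B. fwd i"
  shows "wpo W (A @ B) Q h 0 s l"
proof -
  have 1: "wpo W (A @ B @ []) Q h (length A + 0) s l" if "wpo W B Q h 0 s l" for h s l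
    using that fB by (rule wpo_embed) (auto intro: wpo_exit)
  have "wpo W ([] @ A @ B) Q h (length ([] :: instr list) + 0) s l"
    using A fA by (rule wpo_embed) (use 1 in simp)
  then show ?thesis by simp
qed

lemma wpo_single:
  assumes "\<And>h' k' s' l'. exec W i (h, 0, s, l) (h', k', s', l') \<Longrightarrow> k' = 1 \<and> Q h' s' l'"
  shows "wpo W [i] Q h 0 s l"
  by (rule wpo_step) (auto dest!: assms intro: wpo_exit)

lemma wpo_Cons:
  assumes "\<And>h' k' s' l'. exec W i (h, 0, s, l) (h', k', s', l') \<Longrightarrow> k' = 1 \<and> wpo W cs Q h' 0 s' l'"
    and "fwd i" and "\<forall>i \<in> set cs. fwd i"
  shows "wpo W (i # cs) Q h 0 s l"
  using wpo_append[of W "[i]" cs] wpo_single assms by simp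

text \<open>Common shape of a guarded command and of a class test. The offset
  \<open>length U + 2\<close> skips \<open>U\<close> and its closing \<open>Goto\<close>, and that
  \<open>Goto\<close> skips \<open>R\<close>. A top of stack that is not a boolean blocks.\<close>

lemma wpo_branch:
  assumes "\<And>b s'. s = Const (Bool b) # s' \<Longrightarrow> if b then wpo W U Q h 0 s' l else wpo W R Q h 0 s' l"
    and U: "\<forall>i \<in> set U. fwd i" and R: "\<forall>i \<in> set R. fwd i"
  shows "wpo W (IfFalse (int (length U) + 2) # U @ Goto (int (length R) + 1) # R) Q h 0 s l"
    (is "wpo W ?cs Q h 0 s l")
proof (rule wpo_step)
  fix h' k' s' l'
  assume "exec W (?cs ! 0) (h, 0, s, l) (h', k', s', l')"
  then have "\<exists>b. s = Const (Bool b) # s' \<and> h' = h \<and> l' = l \<and> k' = (if b then 1 else length U + 2)"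
    unfolding nth_Cons_0 exec_simps by fastforce
  then obtain b where b: "s = Const (Bool b) # s'" "h' = h" "l' = l"
    "k' = (if b then 1 else length U + 2)"
    by blast
  have cs1: "?cs = [IfFalse (int (length U) + 2)] @ U @ (Goto (int (length R) + 1) # R)"
    and cs2: "?cs = (IfFalse (int (length U) + 2) # U @ [Goto (int (length R) + 1)]) @ R @ []"
    by auto
  show "wpo W ?cs Q h' k' s' l'"
  proof (cases b)
    case True
    have "wpo W U Q h 0 s' l" using assms(1)[OF b(1)] True by simp
    then have "wpo W ?cs Q h (length [IfFalse (int (length U) + 2)] + 0) s' l"
      unfolding cs1 using U
    proof (rule wpo_embed)
      fix h s l
      assume Q: "Q h s l"
      have goto: "([IfFalse (int (length U) + 2)] @ U @ Goto (int (length R) + 1) # R) !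
          (length [IfFalse (int (length U) + 2)] + length U) = Goto (int (length R) + 1)"
        by (simp add: nth_append)
      show "wpo W ([IfFalse (int (length U) + 2)] @ U @ Goto (int (length R) + 1) # R) Q h
          (length [IfFalse (int (length U) + 2)] + length U) s l"
      proof (rule wpo_step, simp, unfold goto exec_simps jump_block)
        fix h' k' s' l'
        assume "h' = h \<and> k' = length [IfFalse (int (length U) + 2)] + length U + length R + 1 \<and> s' = s \<and> l' = l"
        then show "wpo W ([IfFalse (int (length U) + 2)] @ U @ Goto (int (length R) + 1) # R) Q h' k' s' l'"
          using Q by (auto intro: wpo_exit)
      qed
    qed
    then show ?thesis using b True by simp
  next
    case False
    have "wpo W R Q h 0 s' l" using assms(1)[OF b(1)] False by simp
    then have "wpo W ?cs Q h (length (IfFalse (int (length U) + 2) # U @ [Goto (int (length R) + 1)]) + 0) s' l"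
      unfolding cs2 using R by (rule wpo_embed) (auto intro: wpo_exit)
    then show ?thesis using b False by simp
  qed
qed simp

section \<open>The code of clauses\<close>

definition sec_state :: "cname \<Rightarrow> heap \<Rightarrow> sstate" where
  "sec_state sc h = (\<lambda>x. statics h (sc, x))"

text \<open>Read from the locals, because the operand stack no longer holds the arguments when the
  code behind the call runs.\<close>

definition args_of :: "nat \<Rightarrow> nat \<Rightarrow> val list \<Rightarrow> val list" where
  "args_of n k l = map (\<lambda>i. l ! (n + 3 + i)) [0..<k]"

lemma length_args_of [simp]: "length (args_of n k l) = k"
  by (simp add: args_of_def)

lemma args_of_Suc: "args_of n (Suc k) l = args_of n k l @ [l ! (n + 3 + k)]"
  by (simp add: args_of_def)

lemma args_of_update [simp]: "j < n + 3 \<Longrightarrow> args_of n k (l[j := v]) = args_of n k l"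
  by (simp add: args_of_def)

text \<open>Excludes the two leaves whose code may run on although \<open>eval_expr\<close> is
  undefined: an \<open>Arg\<close> out of range may still load some local, and \<open>Ret\<close>
  loads local \<open>n + 1\<close> whatever it holds. Every other undefined evaluation blocks the
  code, too.\<close>

fun expr_ok :: "nat \<Rightarrow> bool \<Rightarrow> expr \<Rightarrow> bool" where
  "expr_ok k rt (Arg i) \<longleftrightarrow> i < k"
| "expr_ok k rt Ret \<longleftrightarrow> rt"
| "expr_ok k rt (UnE u e) \<longleftrightarrow> expr_ok k rt e"
| "expr_ok k rt (BinE b e e') \<longleftrightarrow> expr_ok k rt e \<and> expr_ok k rt e'"
| "expr_ok k rt _ \<longleftrightarrow> True"

fun stmt_ok :: "nat \<Rightarrow> bool \<Rightarrow> stmt \<Rightarrow> bool" where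
  "stmt_ok k rt (Assign x e) \<longleftrightarrow> expr_ok k rt e"

definition cmds_ok :: "nat \<Rightarrow> bool \<Rightarrow> gcmd list \<Rightarrow> bool" where
  "cmds_ok k rt cmds \<longleftrightarrow> (\<forall>(g, ss) \<in> set cmds. expr_ok k rt g \<and> (\<forall>st \<in> set ss. stmt_ok k rt st))"

lemma wt_expr_ok: "wt_expr S As R e T \<Longrightarrow> expr_ok (length As) (R \<noteq> None) e"
  by (induction rule: wt_expr.induct) auto

text \<open>The vocabulary of monitor code. To a frame at such an instruction no rule of
  \<open>step\<close> but \<open>Normal\<close> applies: nothing is raised, called or returned, so
  the code cannot be left midway.\<close>

fun simple :: "instr \<Rightarrow> bool" where
  "simple (Push c) \<longleftrightarrow> True"
| "simple (Load i) \<longleftrightarrow> True"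
| "simple (Store i) \<longleftrightarrow> True"
| "simple (Unop u) \<longleftrightarrow> True"
| "simple (Binop b) \<longleftrightarrow> True"
| "simple (Getstatic c f) \<longleftrightarrow> True"
| "simple (Putstatic c f) \<longleftrightarrow> True"
| "simple (Instanceof c) \<longleftrightarrow> True"
| "simple (Goto off) \<longleftrightarrow> 0 \<le> off"
| "simple (IfFalse off) \<longleftrightarrow> 0 \<le> off"
| "simple Exit \<longleftrightarrow> True"
| "simple _ \<longleftrightarrow> False"

lemma simple_fwd: "simple i \<Longrightarrow> fwd i"
  by (cases i) auto

lemma simple_throws: "simple i \<Longrightarrow> \<not> throws W i h s x"
  by (auto elim: throws.cases)

text \<open>Carries \<open>wpo\<close>, which counts from the start of the fragment, over to the
  absolute program counters of a method in which the fragment starts at \<open>A\<close>.\<close>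

lemma wpo_exec:
  assumes "wpo V cs Q h k s l" and "k < length cs" and "\<And>i. i \<in> set cs \<Longrightarrow> simple i"
    and "exec V (cs ! k) (h, A + k, s, l) (h', pc', s', l')"
  shows "\<exists>k'. pc' = A + k' \<and> wpo V cs Q h' k' s' l'"
proof -
  have "fwd (cs ! k)" using assms(2,3) by (simp add: simple_fwd)
  then obtain k' where k': "pc' = A + k'" "exec V (cs ! k) (h, k, s, l) (h', k', s', l')"
    using exec_shift[OF assms(4)] by blast
  from assms(1) have "wpo V cs Q h' k' s' l'"
    by (cases rule: wpo.cases) (use k'(2) assms(2) in auto)
  then show ?thesis using k'(1) by blast
qed

lemma wpo_cases:
  assumes "wpo V cs Q h k s l"
  shows "k < length cs \<or> k = length cs \<and> Q h s l"
  using assms by (cases rule: wpo.cases) auto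

lemma expr_code_simple: "i \<in> set (expr_code sc n e) \<Longrightarrow> simple i"
  by (induction e) auto

lemma stmt_code_simple: "i \<in> set (stmt_code sc n st) \<Longrightarrow> simple i"
  by (cases st) (auto simp: expr_code_simple)

lemma gcmds_code_simple: "i \<in> set (gcmds_code sc n cmds) \<Longrightarrow> simple i"
  by (induction cmds) (auto simp: Let_def expr_code_simple stmt_code_simple)

text \<open>One direction suffices: if the code gets through, then the evaluation is defined and its
  value is on the stack. The postcondition is generalised so that the induction can put the
  remaining code into it.\<close>

lemma wpo_expr:
  assumes "expr_ok k rt e" and "rt \<Longrightarrow> r = Some (l ! (n + 1))"
    and "\<And>v. eval_expr (sec_state sc h) (args_of n k l) r e = Some v \<Longrightarrow> Q h (v # s) l"
  shows "wpo W (expr_code sc n e) Q h 0 s l"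
  using assms
proof (induction e arbitrary: Q s)
  case (UnE u e)
  have "wpo W (expr_code sc n e) (\<lambda>h s l. wpo W [Unop u] Q h 0 s l) h 0 s l"
  proof (rule UnE.IH)
    fix v
    assume v: "eval_expr (sec_state sc h) (args_of n k l) r e = Some v"
    show "wpo W [Unop u] Q h 0 (v # s) l"
      by (rule wpo_single) (use v in \<open>auto simp: exec_simps intro: UnE.prems(3)\<close>)
  qed (use UnE.prems in auto)
  then show ?case
    by (auto intro!: wpo_append simp: simple_fwd expr_code_simple)
next
  case (BinE b e1 e2)
  have "wpo W (expr_code sc n e1) (\<lambda>h s l. wpo W (expr_code sc n e2 @ [Binop b]) Q h 0 s l) h 0 s l"
  proof (rule BinE.IH(1))
    fix v
    assume v: "eval_expr (sec_state sc h) (args_of n k l) r e1 = Some v"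
    have "wpo W (expr_code sc n e2) (\<lambda>h s l. wpo W [Binop b] Q h 0 s l) h 0 (v # s) l"
    proof (rule BinE.IH(2))
      fix w
      assume w: "eval_expr (sec_state sc h) (args_of n k l) r e2 = Some w"
      show "wpo W [Binop b] Q h 0 (w # v # s) l"
        by (rule wpo_single) (use v w in \<open>auto simp: exec_simps intro: BinE.prems(3)\<close>)
    qed (use BinE.prems in auto)
    then show "wpo W (expr_code sc n e2 @ [Binop b]) Q h 0 (v # s) l"
      by (auto intro!: wpo_append simp: simple_fwd expr_code_simple)
  qed (use BinE.prems in auto)
  then show ?case
    by (auto intro!: wpo_append simp: simple_fwd expr_code_simple)
qed (auto simp: exec_simps sec_state_def args_of_def intro!: wpo_single)

lemma wpo_stmts:
  assumes "\<forall>st \<in> set ss. stmt_ok k rt st" and "rt \<Longrightarrow> r = Some (l ! (n + 1))"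
    and "\<And>h'. objs h' = objs h \<Longrightarrow>
      exec_stmts (sec_state sc h) (args_of n k l) r ss = Some (sec_state sc h') \<Longrightarrow> Q h' s l"
  shows "wpo W (concat (map (stmt_code sc n) ss)) Q h 0 s l"
  using assms
proof (induction ss arbitrary: h)
  case Nil
  then show ?case by (auto intro: wpo_exit)
next
  case (Cons st ss)
  obtain x e where st: "st = Assign x e" by (cases st)
  let ?rest = "concat (map (stmt_code sc n) ss)"
  have rest: "\<forall>i \<in> set ?rest. fwd i" by (auto simp: simple_fwd stmt_code_simple)
  have "wpo W (expr_code sc n e) (\<lambda>h s l. wpo W (Putstatic sc x # ?rest) Q h 0 s l) h 0 s l"
  proof (rule wpo_expr)
    show "expr_ok k rt e" using Cons.prems st by simp
    fix v
    assume v: "eval_expr (sec_state sc h) (args_of n k l) r e = Some v"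
    let ?h = "h\<lparr>statics := (statics h)((sc, x) \<mapsto> v)\<rparr>"
    have upd: "sec_state sc ?h = (sec_state sc h)(x \<mapsto> v)" by (auto simp: sec_state_def)
    have "wpo W ?rest Q ?h 0 s l"
    proof (rule Cons.IH)
      fix h'
      assume "objs h' = objs ?h"
        and "exec_stmts (sec_state sc ?h) (args_of n k l) r ss = Some (sec_state sc h')"
      then show "Q h' s l"
        using v by (intro Cons.prems(3)) (simp_all add: st upd)
    qed (use Cons.prems in auto)
    then show "wpo W (Putstatic sc x # ?rest) Q h 0 (v # s) l"
      using rest by (intro wpo_Cons) (auto simp: exec_simps)
  qed (use Cons.prems in auto)
  then show ?case
    using rest st by (auto intro!: wpo_append simp: simple_fwd expr_code_simple)
qed

lemma wpo_gcmds:
  assumes "cmds_ok k rt cmds" and "rt \<Longrightarrow> r = Some (l ! (n + 1))"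
    and "\<And>h'. objs h' = objs h \<Longrightarrow>
      fire (sec_state sc h) (args_of n k l) r cmds = Some (sec_state sc h') \<Longrightarrow> Q h' s l"
  shows "wpo W (gcmds_code sc n cmds) Q h 0 s l"
  using assms
proof (induction cmds)
  case Nil
  \<comment> \<open>\<open>Exit\<close> has no rule in \<open>exec\<close>, so the postcondition is
    never due when all guards have failed.\<close>
  then show ?case by (auto intro!: wpo_single simp: exec_simps)
next
  case (Cons cmd cmds)
  obtain g ss where cmd: "cmd = (g, ss)" by (cases cmd)
  let ?U = "concat (map (stmt_code sc n) ss)" and ?R = "gcmds_code sc n cmds"
  let ?B = "IfFalse (int (length ?U) + 2) # ?U @ Goto (int (length ?R) + 1) # ?R"
  have fU: "\<forall>i \<in> set ?U. fwd i" and fR: "\<forall>i \<in> set ?R. fwd i"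
    by (auto simp: simple_fwd stmt_code_simple gcmds_code_simple)
  have "wpo W (expr_code sc n g) (\<lambda>h s l. wpo W ?B Q h 0 s l) h 0 s l"
  proof (rule wpo_expr)
    show "expr_ok k rt g" using Cons.prems(1) cmd by (simp add: cmds_ok_def)
    fix v
    assume v: "eval_expr (sec_state sc h) (args_of n k l) r g = Some v"
    show "wpo W ?B Q h 0 (v # s) l"
    proof (rule wpo_branch[OF _ fU fR])
      fix b s'
      assume "v # s = Const (Bool b) # s'"
      then have b: "v = Const (Bool b)" "s' = s" by auto
      show "if b then wpo W ?U Q h 0 s' l else wpo W ?R Q h 0 s' l"
      proof (cases b)
        case True
        have "wpo W ?U Q h 0 s l"
        proof (rule wpo_stmts)
          show "\<forall>st \<in> set ss. stmt_ok k rt st"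
            using Cons.prems(1) cmd by (simp add: cmds_ok_def)
          fix h'
          assume "objs h' = objs h"
            and "exec_stmts (sec_state sc h) (args_of n k l) r ss = Some (sec_state sc h')"
          then show "Q h' s l"
            using v b True by (intro Cons.prems(3)) (simp_all add: cmd)
        qed (rule Cons.prems(2))
        then show ?thesis using b True by simp
      next
        case False
        have "wpo W ?R Q h 0 s l"
        proof (rule Cons.IH)
          show "cmds_ok k rt cmds"
            using Cons.prems(1) by (simp add: cmds_ok_def)
          fix h'
          assume "objs h' = objs h"
            and "fire (sec_state sc h) (args_of n k l) r cmds = Some (sec_state sc h')"
          then show "Q h' s l"
            using v b False by (intro Cons.prems(3)) (simp_all add: cmd)
        qed (rule Cons.prems(2))
        then show ?thesis using b False by simp
      qed
    qed
  qed (use Cons.prems in auto)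
  then have "wpo W (expr_code sc n g @ ?B) Q h 0 s l"
    using fU fR by (intro wpo_append) (auto simp: simple_fwd expr_code_simple)
  then show ?case by (simp add: cmd Let_def)
qed

section \<open>The code of events\<close>

definition inst :: "world \<Rightarrow> heap \<Rightarrow> val \<Rightarrow> cname \<Rightarrow> bool" where
  "inst W h v k \<longleftrightarrow> v \<noteq> Const Null \<and> cast_ok h W v k"

lemma inst_cong: "objs h = objs h' \<Longrightarrow> inst W h = inst W h'"
  by (simp add: inst_def cast_ok_def fun_eq_iff)

text \<open>The class that the code of an event takes for the callee. A special call has a single
  candidate just like a static one, but there the test matters: it fails for a null target.\<close>

definition selected :: "world \<Rightarrow> imode \<Rightarrow> cname list \<Rightarrow> nat \<Rightarrow> heap \<Rightarrow> val list \<Rightarrow> cname option" where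
  "selected W md ks n h l = (if md = Static then Some (hd ks) else find (inst W h (l ! n)) ks)"

lemma selected_cong:
  assumes "objs h = objs h'"
  shows "selected W md ks n h l = selected W md ks n h' l"
  unfolding selected_def inst_cong[OF assms] ..

lemma selected_update [simp]: "n < j \<Longrightarrow> selected W md ks n h (l[j := v]) = selected W md ks n h l"
  by (simp add: selected_def)

text \<open>What the code of an event is meant to compute. It is the identity for a callee in the
  program or no callee at all, as such a call emits no action.\<close>

definition reaction :: "api \<Rightarrow> contract \<Rightarrow> event \<Rightarrow> mname \<Rightarrow> cname option \<Rightarrow> val list \<Rightarrow> val option
    \<Rightarrow> sstate \<Rightarrow> sstate option" where
  "reaction api C ev m k vs r \<sigma> =
     (case k of
        Some c \<Rightarrow> if c \<in> fst ` set api then react C ev c m vs r \<sigma> else Some \<sigma>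
      | None \<Rightarrow> Some \<sigma>)"

lemma clause_code_simple: "i \<in> set (clause_code api C sc n ev m k) \<Longrightarrow> simple i"
  by (cases "k \<in> fst ` set api"; cases "clauses C ev k m")
    (simp_all add: clause_code_def gcmds_code_simple)

lemma select_code_simple:
  assumes "\<forall>k \<in> set ks. \<forall>i \<in> set (f k). simple i" and "i \<in> set (select_code f n ks)"
  shows "simple i"
  using assms by (induction ks) (auto simp: Let_def)

lemma event_code_simple: "i \<in> set (event_code api C sc n W md c m ev) \<Longrightarrow> simple i"
  by (auto simp: event_code_def clause_code_simple split: if_splits elim!: select_code_simple[rotated])

lemma wpo_clause:
  assumes "\<And>cmds. clauses C ev c m = Some cmds \<Longrightarrow> c \<in> fst ` set api \<Longrightarrow> cmds_ok k rt cmds"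
    and "rt \<Longrightarrow> r = Some (l ! (n + 1))"
    and "\<And>h'. objs h' = objs h \<Longrightarrow>
      reaction api C ev m (Some c) (args_of n k l) r (sec_state sc h) = Some (sec_state sc h') \<Longrightarrow> Q h' s l"
  shows "wpo W (clause_code api C sc n ev m c) Q h 0 s l"
proof (cases "c \<in> fst ` set api \<and> clauses C ev c m \<noteq> None")
  case True
  then obtain cmds where cmds: "clauses C ev c m = Some cmds" by auto
  have "wpo W (gcmds_code sc n cmds) Q h 0 s l"
    using assms(1)[OF cmds] assms(2)
  proof (rule wpo_gcmds)
    fix h'
    assume "objs h' = objs h"
      and "fire (sec_state sc h) (args_of n k l) r cmds = Some (sec_state sc h')"
    then show "Q h' s l"
      using True cmds by (intro assms(3)) (simp_all add: reaction_def react_def)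
  qed (use True in simp)
  then show ?thesis using True cmds by (simp add: clause_code_def)
next
  case False
  then have "clause_code api C sc n ev m c = []" by (auto simp: clause_code_def)
  moreover have "Q h s l"
    using False by (intro assms(3)) (auto simp: reaction_def react_def)
  ultimately show ?thesis by (simp add: wpo_exit)
qed

text \<open>The tests leave the heap alone, so all of them see the initial \<open>h\<close>, and the
  first success is what \<open>find\<close> returns. \<open>F\<close> abstracts from
  \<open>reaction\<close> with fixed arguments and result.\<close>

lemma wpo_select:
  assumes "\<And>k Q h s. k \<in> set ks \<Longrightarrow>
      (\<And>h'. objs h' = objs h \<Longrightarrow> F (Some k) (sec_state sc h) = Some (sec_state sc h') \<Longrightarrow> Q h' s l) \<Longrightarrow>
      wpo W (f k) Q h 0 s l"
    and "\<forall>k \<in> set ks. \<forall>i \<in> set (f k). simple i"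
    and "\<And>\<sigma>. F None \<sigma> = Some \<sigma>"
    and "\<And>h'. objs h' = objs h \<Longrightarrow>
      F (find (inst W h (l ! n)) ks) (sec_state sc h) = Some (sec_state sc h') \<Longrightarrow> Q h' s l"
  shows "wpo W (select_code f n ks) Q h 0 s l"
  using assms
proof (induction ks)
  case Nil
  then show ?case by (auto intro: wpo_exit)
next
  case (Cons k ks)
  let ?R = "select_code f n ks"
  let ?B = "IfFalse (int (length (f k)) + 2) # f k @ Goto (int (length ?R) + 1) # ?R"
  have fU: "\<forall>i \<in> set (f k). fwd i"
    using Cons.prems(2) by (simp add: simple_fwd)
  have fR: "\<forall>i \<in> set ?R. fwd i"
    using select_code_simple[of ks f] Cons.prems(2) by (simp add: simple_fwd)
  have "wpo W ?B Q h 0 (Const (Bool (inst W h (l ! n) k)) # s) l"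
  proof (rule wpo_branch[OF _ fU fR])
    fix b s'
    assume "Const (Bool (inst W h (l ! n) k)) # s = Const (Bool b) # s'"
    then have b: "inst W h (l ! n) k = b" "s' = s" by auto
    show "if b then wpo W (f k) Q h 0 s' l else wpo W ?R Q h 0 s' l"
    proof (cases b)
      case True
      then show ?thesis using b Cons.prems(4) by (auto intro!: Cons.prems(1))
    next
      case False
      have "wpo W ?R Q h 0 s l"
        using Cons.prems b False by (intro Cons.IH) auto
      then show ?thesis using b False by simp
    qed
  qed
  then have "wpo W (Instanceof k # ?B) Q h 0 (l ! n # s) l"
    using fU fR by (intro wpo_Cons) (auto simp: exec_simps inst_def)
  then have "wpo W (Load n # Instanceof k # ?B) Q h 0 s l"
    using fU fR by (intro wpo_Cons) (auto simp: exec_simps)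
  then show ?case by (simp add: Let_def)
qed

lemma wpo_event:
  assumes "md = Static \<Longrightarrow> \<exists>d. candidates W\<^sub>0 md c m = [d]"
    and "\<And>k' cmds. k' \<in> set (candidates W\<^sub>0 md c m) \<Longrightarrow> k' \<in> fst ` set api \<Longrightarrow>
      clauses C ev k' m = Some cmds \<Longrightarrow> cmds_ok k rt cmds"
    and "rt \<Longrightarrow> r = Some (l ! (n + 1))"
    and "\<And>h'. objs h' = objs h \<Longrightarrow>
      reaction api C ev m (selected W md (candidates W\<^sub>0 md c m) n h l) (args_of n k l) r (sec_state sc h)
        = Some (sec_state sc h') \<Longrightarrow> Q h' s l"
  shows "wpo W (event_code api C sc n W\<^sub>0 md c m ev) Q h 0 s l"
proof (cases "md = Static")
  case True
  then obtain d where d: "candidates W\<^sub>0 md c m = [d]" using assms(1) by auto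
  have "wpo W (clause_code api C sc n ev m d) Q h 0 s l"
    by (rule wpo_clause[where rt = rt and k = k and r = r])
      (use d True assms(2-4) in \<open>simp_all add: selected_def\<close>)
  then show ?thesis using d True by (simp add: event_code_def)
next
  case False
  have "wpo W (select_code (clause_code api C sc n ev m) n (candidates W\<^sub>0 md c m)) Q h 0 s l"
  proof (rule wpo_select[where F = "\<lambda>c. reaction api C ev m c (args_of n k l) r"])
    fix k' Q h and s :: "val list"
    assume "k' \<in> set (candidates W\<^sub>0 md c m)"
      and "\<And>h'. objs h' = objs h \<Longrightarrow> reaction api C ev m (Some k') (args_of n k l) r (sec_state sc h)
        = Some (sec_state sc h') \<Longrightarrow> Q h' s l"
    then show "wpo W (clause_code api C sc n ev m k') Q h 0 s l"
      by (intro wpo_clause[where rt = rt and k = k and r = r]) (use assms(2,3) in simp_all)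
  next
    fix h'
    assume "objs h' = objs h"
      and "reaction api C ev m (find (inst W h (l ! n)) (candidates W\<^sub>0 md c m)) (args_of n k l) r
        (sec_state sc h) = Some (sec_state sc h')"
    then show "Q h' s l"
      using False by (intro assms(4)) (simp_all add: selected_def)
  qed (auto simp: clause_code_simple reaction_def)
  then show ?thesis using False by (simp add: event_code_def)
qed

text \<open>The last argument is on top and is stored first. That the locals from
  \<open>n + 3 + k\<close> on are preserved is what the induction needs: the remaining stores must
  not overwrite that value.\<close>

lemma wpo_stores:
  assumes "\<And>s' l'. s = rev (args_of n k l') @ s' \<Longrightarrow> (\<forall>j \<ge> n + 3 + k. l' ! j = l ! j) \<Longrightarrow> Q h s' l'"
  shows "wpo W (map (\<lambda>i. Store (n + 3 + i)) (rev [0..<k])) Q h 0 s l"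
  using assms
proof (induction k arbitrary: s l)
  case 0
  then show ?case by (auto intro!: wpo_exit simp: args_of_def)
next
  case (Suc k)
  have "wpo W (Store (n + 3 + k) # map (\<lambda>i. Store (n + 3 + i)) (rev [0..<k])) Q h 0 s l"
  proof (rule wpo_Cons)
    fix h' k' s' l'
    assume "exec W (Store (n + 3 + k)) (h, 0, s, l) (h', k', s', l')"
    then obtain v where v: "s = v # s'" "h' = h" "k' = 1" "l' = l[n + 3 + k := v]" "n + 3 + k < length l"
      by (auto simp: exec_simps)
    have "wpo W (map (\<lambda>i. Store (n + 3 + i)) (rev [0..<k])) Q h 0 s' l'"
    proof (rule Suc.IH)
      fix s'' l''
      assume *: "s' = rev (args_of n k l'') @ s''" "\<forall>j \<ge> n + 3 + k. l'' ! j = l' ! j"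
      then have "l'' ! (n + 3 + k) = v" using v by auto
      then show "Q h s'' l''"
        using * v by (intro Suc.prems) (auto simp: args_of_Suc)
    qed
    then show "k' = 1 \<and> wpo W (map (\<lambda>i. Store (n + 3 + i)) (rev [0..<k])) Q h' 0 s' l'"
      using v by simp
  qed auto
  then show ?case by simp
qed

lemma wpo_loads:
  assumes "Q h (rev (args_of n k l) @ s) l"
  shows "wpo W (map (\<lambda>i. Load (n + 3 + i)) [0..<k]) Q h 0 s l"
  using assms
proof (induction k arbitrary: Q)
  case 0
  then show ?case by (auto intro!: wpo_exit simp: args_of_def)
next
  case (Suc k)
  have "wpo W (map (\<lambda>i. Load (n + 3 + i)) [0..<k]) (\<lambda>h s l. wpo W [Load (n + 3 + k)] Q h 0 s l) h 0 s l"
    by (rule Suc.IH, rule wpo_single) (use Suc.prems in \<open>auto simp: exec_simps args_of_Suc\<close>)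
  then show ?case by (auto intro!: wpo_append)
qed

section \<open>Method lookup\<close>

lemma subcls_refl [simp]: "subcls W c c"
  by (simp add: subcls_def)

lemma subcls_trans [trans]: "subcls W c d \<Longrightarrow> subcls W d e \<Longrightarrow> subcls W c e"
  by (simp add: subcls_def)

text \<open>Makes the sort key of \<open>candidates\<close> meaningful, since \<open>card\<close> of
  an infinite set would be 0.\<close>

lemma finite_subcls: "finite {k. subcls V c k}"
proof -
  have "finite (subcls1 V)"
  proof (rule finite_subset)
    show "subcls1 V \<subseteq> (\<lambda>(c, k). (c, the (super k))) ` set V"
      by (force simp: subcls1_def dest: map_of_SomeD)
  qed simp
  then have "finite ((subcls1 V)\<^sup>* `` {c})" by (simp add: finite_rtrancl_Image)
  then show ?thesis by (simp add: subcls_def Image_def)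
qed

lemma candidates_not_Virtual:
  "lookup_method W c m = Some (d, M) \<Longrightarrow> md \<noteq> Virtual \<Longrightarrow> candidates W md c m = [d]"
  by (simp add: candidates_def)

text \<open>The last conjunct makes the class found the least one declaring \<open>m\<close>. It
  rests on single inheritance: a superclass of \<open>c\<close> other than \<open>c\<close> itself
  is a superclass of the direct superclass of \<open>c\<close>.\<close>

lemma lookup_method_Some:
  assumes "lookup_method W c m = Some (d, M)"
  shows "subcls W c d \<and> declares W d m M \<and>
    (\<forall>k M'. subcls W c k \<longrightarrow> declares W k m M' \<longrightarrow> subcls W d k)"
proof -
  have "lookup_method W c m = Some r \<Longrightarrow> case r of (d, M) \<Rightarrow> subcls W c d \<and> declares W d m M \<and>
    (\<forall>k M'. subcls W c k \<longrightarrow> declares W k m M' \<longrightarrow> subcls W d k)" for r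
  \<comment> \<open>Fixed-point induction over successful lookups.\<close>
  proof (induction rule: lookup_method.raw_induct[rotated, consumes 1])
    case (1 lookup W c m r)
    obtain d M where r: "r = (d, M)" by (cases r)
    from 1(2) obtain k where k: "map_of W c = Some k"
      and *: "(case map_of (methods k) m of
         Some M \<Rightarrow> Some (c, M)
       | None \<Rightarrow> Option.bind (super k) (\<lambda>d. lookup W d m)) = Some r"
      by (auto simp: Option.bind_eq_Some_conv)
    show ?case
    proof (cases "map_of (methods k) m")
      case None
      then obtain e where e: "super k = Some e" "lookup W e m = Some r"
        using * by (auto simp: Option.bind_eq_Some_conv)
      have ce: "(c, y) \<in> subcls1 W \<longleftrightarrow> y = e" for y
        using k e by (auto simp: subcls1_def)
      have IH: "subcls W e d" "declares W d m M"
        "\<And>k M'. subcls W e k \<Longrightarrow> declares W k m M' \<Longrightarrow> subcls W d k"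
        using 1(1)[OF e(2)] r by auto
      have "subcls W e k'" if "subcls W c k'" "declares W k' m M'" for k' M'
      proof -
        have "k' \<noteq> c" using that(2) k None by (auto simp: declares_def)
        then show ?thesis
          using that(1) ce unfolding subcls_def by (metis converse_rtranclE)
      qed
      moreover have "subcls W c d"
        using IH(1) ce[of e] unfolding subcls_def by (metis converse_rtrancl_into_rtrancl)
      ultimately show ?thesis using r IH by auto
    next
      case (Some M')
      then show ?thesis using * k r by (auto simp: declares_def)
    qed
  qed
  then show ?thesis using assms by auto
qed

text \<open>The reversed list descends in \<open>f\<close>. As \<open>x\<close> is the strict
  maximum among the elements satisfying \<open>p\<close>, none of the others can precede it, however
  ties are ordered.\<close>

lemma find_rev_sort_key:
  fixes f :: "'a \<Rightarrow> nat"
  assumes "x \<in> set L" and "p x" and "\<And>y. y \<in> set L \<Longrightarrow> p y \<Longrightarrow> y \<noteq> x \<Longrightarrow> f y < f x"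
  shows "find p (rev (sort_key f L)) = Some x"
proof -
  let ?xs = "rev (sort_key f L)"
  have sorted: "sorted_wrt (\<lambda>a b. f b \<le> f a) ?xs"
    using sorted_sort_key[of f L] by (simp add: sorted_wrt_rev sorted_map)
  have "find p ?xs \<noteq> None"
    using assms(1,2) by (simp add: find_None_iff) blast
  then obtain y where y: "find p ?xs = Some y" by auto
  then obtain i where i: "i < length ?xs" "p (?xs ! i)" "y = ?xs ! i" "\<forall>j < i. \<not> p (?xs ! j)"
    by (auto simp: find_Some_iff)
  have yL: "y \<in> set L" using i(1,3) nth_mem[of i ?xs] by simp
  have "x \<in> set ?xs" using assms(1) by simp
  then obtain j where j: "j < length ?xs" "x = ?xs ! j" by (metis in_set_conv_nth)
  have "y = x"
  proof (rule ccontr)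
    assume "y \<noteq> x"
    then have "f y < f x" using assms(3) yL i by simp
    moreover have "i < j"
      using \<open>y \<noteq> x\<close> i j assms(2) by (metis linorder_neqE_nat)
    then have "f x \<le> f y"
      using sorted i j by (simp add: sorted_wrt_iff_nth_less)
    ultimately show False by simp
  qed
  then show ?thesis using y by simp
qed

section \<open>Class tables of linked programs\<close>

lemma map_of_map_snd: "map_of (map (\<lambda>(k, v). (k, f v)) xs) x = map_option f (map_of xs x)"
  by (induction xs) auto

lemma map_of_link:
  "map_of (link api P) c =
    (case map_of api c of
       Some k \<Rightarrow> Some (map_cls (\<lambda>_. None) k)
     | None \<Rightarrow> map_option (map_cls Some) (map_of (classes P) c))"
  by (simp add: link_def map_of_map_snd map_add_def split: option.split)

lemma map_of_methods_map_cls: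
  "map_of (methods (map_cls f k)) m = map_option (map_mdecl f) (map_of (methods k) m)"
proof -
  have "methods (map_cls f k) = map (\<lambda>(m, M). (m, map_mdecl f M)) (methods k)"
    by (cases k) auto
  then show ?thesis by (simp add: map_of_map_snd)
qed

lemma super_map_cls: "super (map_cls f k) = super k"
  by (cases k) simp

section \<open>The inlined program\<close>

locale inlining =
  fixes api :: api and P :: program and C :: contract and sc :: cname
  assumes wf_api: "wf_api api" and wf_prog: "wf_prog api P" and wf_contract: "wf_contract api C"
    and fresh: "fresh_class api P sc"
begin

abbreviation W :: world where "W \<equiv> link api P"
abbreviation W' :: world where "W' \<equiv> link api (inline api sc C P)"

definition decl_rel :: "code option mdecl \<Rightarrow> code option mdecl \<Rightarrow> bool" where
  "decl_rel M M' \<longleftrightarrow> static M' = static M \<and> params M' = params M \<and> ret M' = ret M \<and>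
     rel_option (\<lambda>b b'. \<exists>n. b' = inline_code api C sc W n b) (body M) (body M')"

lemma wf_W: "wf_classes W"
  using wf_prog by (simp add: wf_prog_def)

lemma sc_fresh: "sc \<notin> fst ` set api" "sc \<notin> fst ` set (classes P)" "map_of W sc = None" "sc \<notin> fst ` set W"
proof -
  show W: "sc \<notin> fst ` set W"
    using fresh by (simp add: fresh_class_def)
  then show "map_of W sc = None"
    by (simp add: map_of_eq_None_iff)
  show "sc \<notin> fst ` set api" "sc \<notin> fst ` set (classes P)"
    using W by (simp_all add: link_def image_Un image_image case_prod_unfold)
qed

lemma map_of_W'_sc: "map_of W' sc = Some (map_cls Some (Cls (Some ''Object'') [] (svars C) []))"
  using sc_fresh by (simp add: map_of_link inline_def map_of_eq_None_iff[THEN iffD2])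

lemma super_inline_class: "super (inline_class api C sc W k) = super k"
  by (simp add: inline_class_def)

lemma map_of_methods_inline_class:
  "map_of (methods (inline_class api C sc W k)) m
    = map_option (inline_method api C sc W) (map_of (methods k) m)"
  by (simp add: inline_class_def map_of_map_snd)

text \<open>Basis of the comparison of \<open>W\<close> and \<open>W'\<close>. API classes are the
  same in both, program classes differ only in method bodies, and \<open>sc\<close> exists only in
  \<open>W'\<close>.\<close>

lemma class_rel:
  assumes "c \<noteq> sc"
  shows "rel_option (\<lambda>k k'. super k' = super k \<and>
      (\<forall>m. rel_option decl_rel (map_of (methods k) m) (map_of (methods k') m)))
    (map_of W c) (map_of W' c)"
proof (cases "map_of api c")
  case None
  have "decl_rel (map_mdecl Some M) (map_mdecl Some (inline_method api C sc W M))" for M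
    by (cases M) (auto simp: decl_rel_def inline_method_def Let_def)
  then show ?thesis
    using None assms
    by (cases "map_of (classes P) c")
      (auto simp: map_of_link inline_def map_of_map_snd map_of_methods_map_cls super_inline_class
        map_of_methods_inline_class super_map_cls option.rel_map intro!: option.rel_refl)
next
  case (Some k)
  have "decl_rel (map_mdecl (\<lambda>_. None) M) (map_mdecl (\<lambda>_. None) M)" for M :: "unit mdecl"
    by (cases M) (auto simp: decl_rel_def)
  then show ?thesis
    using Some
    by (auto simp: map_of_link map_of_methods_map_cls super_map_cls option.rel_map intro!: option.rel_refl)
qed

lemma super_not_sc: "map_of W c = Some k \<Longrightarrow> super k = Some d \<Longrightarrow> d \<noteq> sc"
  using wf_W sc_fresh(4) map_of_SomeD[of W c k] unfolding wf_classes_def by fastforce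

lemma subcls1_W': "c \<noteq> sc \<Longrightarrow> (c, d) \<in> subcls1 W' \<longleftrightarrow> (c, d) \<in> subcls1 W"
  using class_rel[of c] by (auto simp: subcls1_def option_rel_Some1 option_rel_Some2)

lemma subcls_W':
  assumes "c \<noteq> sc"
  shows "subcls W' c d \<longleftrightarrow> subcls W c d"
proof
  assume "subcls W' c d"
  then have "(c, d) \<in> (subcls1 W')\<^sup>*" by (simp add: subcls_def)
  \<comment> \<open>Strengthened by \<open>d \<noteq> sc\<close>, without which the next edge could
    not be transferred. A superclass in \<open>W\<close> is declared in \<open>W\<close>, so no path
    starting elsewhere enters \<open>sc\<close>.\<close>
  then have "(c, d) \<in> (subcls1 W)\<^sup>* \<and> d \<noteq> sc"
  proof (induction rule: rtrancl_induct)
    case base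
    then show ?case using assms by simp
  next
    case (step y z)
    then have yz: "(y, z) \<in> subcls1 W" using subcls1_W' by simp
    then have "z \<noteq> sc" by (auto simp: subcls1_def dest: super_not_sc)
    then show ?case using step.IH yz by (auto intro: rtrancl_into_rtrancl)
  qed
  then show "subcls W c d" by (simp add: subcls_def)
next
  assume "subcls W c d"
  then have "(c, d) \<in> (subcls1 W)\<^sup>*" by (simp add: subcls_def)
  then have "(c, d) \<in> (subcls1 W')\<^sup>* \<and> d \<noteq> sc"
  proof (induction rule: rtrancl_induct)
    case base
    then show ?case using assms by simp
  next
    case (step y z)
    then have "(y, z) \<in> subcls1 W'" using subcls1_W' by simp
    moreover have "z \<noteq> sc" using step.hyps(2) by (auto simp: subcls1_def dest: super_not_sc)
    ultimately show ?case using step.IH by (auto intro: rtrancl_into_rtrancl)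
  qed
  then show "subcls W' c d" by (simp add: subcls_def)
qed

lemma declares_W':
  assumes "declares W' c m M'"
  shows "c \<noteq> sc \<and> (\<exists>M. declares W c m M \<and> decl_rel M M')"
proof
  show "c \<noteq> sc" using assms map_of_W'_sc by (auto simp: declares_def)
  then show "\<exists>M. declares W c m M \<and> decl_rel M M'"
    using class_rel[of c] assms
    by (fastforce simp: declares_def option_rel_Some2 dest: spec[of _ m])
qed

lemma declares_W'I:
  assumes "declares W c m M"
  shows "\<exists>M'. declares W' c m M'"
proof -
  have "c \<noteq> sc" using assms sc_fresh by (auto simp: declares_def)
  then show ?thesis
    using class_rel[of c] assms
    by (fastforce simp: declares_def option_rel_Some1 dest: spec[of _ m])
qed

lemma lookup_method_W':
  assumes "lookup_method W' c m = Some (d, M')" and "c \<noteq> sc"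
  shows "\<exists>M. lookup_method W c m = Some (d, M) \<and> decl_rel M M'"
proof -
  have "lookup_method V c m = Some r \<Longrightarrow> V = W' \<Longrightarrow> c \<noteq> sc \<Longrightarrow>
    \<exists>M. lookup_method W c m = Some (fst r, M) \<and> decl_rel M (snd r)" for V r
  proof (induction rule: lookup_method.raw_induct[rotated, consumes 1])
    case (1 lookup V c m r)
    from 1(2) obtain k' where k': "map_of W' c = Some k'"
      and *: "(case map_of (methods k') m of
         Some M \<Rightarrow> Some (c, M)
       | None \<Rightarrow> Option.bind (super k') (\<lambda>d. lookup W' d m)) = Some r"
      using 1(3) by (auto simp: Option.bind_eq_Some_conv)
    obtain k where k: "map_of W c = Some k" "super k' = super k"
      "rel_option decl_rel (map_of (methods k) m) (map_of (methods k') m)"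
      using class_rel[OF 1(4)] k' by (auto simp: option_rel_Some2)
    show ?case
    proof (cases "map_of (methods k') m")
      case None
      then obtain e where e: "super k' = Some e" "lookup W' e m = Some r"
        using * by (auto simp: Option.bind_eq_Some_conv)
      have "e \<noteq> sc" using super_not_sc k e by simp
      then show ?thesis
        using 1(1)[of W' e m r] 1(3) e k None by (subst lookup_method.simps) simp
    next
      case (Some M')
      then show ?thesis
        using * k by (subst lookup_method.simps) (auto simp: option_rel_Some2)
    qed
  qed
  from this[OF assms(1)] show ?thesis using assms(2) by simp
qed

lemma consistent:
  "subcls W c d \<Longrightarrow> declares W c m M \<Longrightarrow> declares W d m M' \<Longrightarrow>
    static M = static M' \<and> params M = params M' \<and> ret M = ret M'"
proof -
  have "\<forall>c d m M M'. subcls W c d \<longrightarrow> declares W c m M \<longrightarrow> declares W d m M' \<longrightarrow>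
      static M = static M' \<and> params M = params M' \<and> ret M = ret M'"
    using wf_W unfolding wf_classes_def by (elim conjE) assumption
  then show "subcls W c d \<Longrightarrow> declares W c m M \<Longrightarrow> declares W d m M' \<Longrightarrow>
      static M = static M' \<and> params M = params M' \<and> ret M = ret M'"
    by blast
qed

lemma declares_api:
  "declares api c m M \<Longrightarrow> declares W c m (map_mdecl (\<lambda>_. None) M)"
  by (auto simp: declares_def map_of_link map_of_methods_map_cls)

lemma body_None:
  assumes "declares W' c m M" and "body M = None"
  shows "\<exists>M\<^sub>0. declares api c m M\<^sub>0 \<and> params M\<^sub>0 = params M \<and> ret M\<^sub>0 = ret M"
  using assms
  by (force simp: declares_def map_of_link map_of_methods_map_cls mdecl.map_sel split: option.splits)

lemma body_Some:
  assumes "declares W' c m M" and "body M = Some b"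
  shows "c \<notin> fst ` set api"
  using assms
  by (auto simp: declares_def map_of_link map_of_methods_map_cls mdecl.map_sel map_of_eq_None_iff
    split: option.splits)

definition prog_code :: "cname \<Rightarrow> mname \<Rightarrow> nat \<Rightarrow> code \<Rightarrow> bool" where
  "prog_code c m n b \<longleftrightarrow> method_body W' c m = Some (inline_code api C sc W n b) \<and>
     (\<forall>i \<in> set (instrs b). sc \<notin> instr_classes i)"

lemma method_body_prog_code:
  assumes "method_body W' c m = Some b'"
  shows "\<exists>n b. b' = inline_code api C sc W n b \<and> prog_code c m n b"
proof -
  obtain k' M' where k': "map_of W' c = Some k'" "map_of (methods k') m = Some M'" "body M' = Some b'"
    using assms by (auto simp: method_body_def Option.bind_eq_Some_conv)
  have "map_of api c = None"
    using body_Some[of c m M' b'] k' by (auto simp: declares_def map_of_eq_None_iff)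
  moreover have "c \<noteq> sc"
    using k' map_of_W'_sc by auto
  ultimately obtain k where k: "map_of (classes P) c = Some k"
    "k' = map_cls Some (inline_class api C sc W k)"
    using k' by (auto simp: map_of_link inline_def map_of_map_snd)
  then obtain M where M: "map_of (methods k) m = Some M"
    "M' = map_mdecl Some (inline_method api C sc W M)"
    using k' by (auto simp: map_of_methods_map_cls map_of_methods_inline_class)
  have "b' = body (inline_method api C sc W M)"
    using M(2) k'(3) by (simp add: mdecl.map_sel)
  then obtain n where n: "b' = inline_code api C sc W n (body M)"
    by (auto simp: inline_method_def Let_def)
  have "\<forall>i \<in> set (instrs (body M)). sc \<notin> instr_classes i"
    using fresh map_of_SomeD[OF k(1)] map_of_SomeD[OF M(1)] unfolding fresh_class_def by fastforce
  then show ?thesis using n assms by (auto simp: prog_code_def)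
qed

lemma set_candidates:
  assumes "lookup_method W c m = Some (d, M)"
  shows "set (candidates W Virtual c m) = {k. subcls W k d \<and> (\<exists>M. declares W k m M)}"
  using assms by (force simp: candidates_def declares_def dest: map_of_SomeD)

text \<open>The contract types the clauses of \<open>k\<close> against the declaration of
  \<open>k\<close> in the API, while the block is laid out for the statically resolved
  \<open>M\<close>. Overriding preserves signatures, so the bounds carry over.\<close>

lemma candidates_cmds_ok:
  assumes "lookup_method W c m = Some (d, M)" and "k \<in> set (candidates W md c m)"
    and "clauses C ev k m = Some cmds"
  shows "cmds_ok (length (params M)) (ev = After \<and> ret M \<noteq> None) cmds"
proof -
  have d: "declares W d m M" using lookup_method_Some[OF assms(1)] by simp
  have kd: "subcls W k d"
    using assms(1,2) set_candidates[OF assms(1)] candidates_not_Virtual[OF assms(1)]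
    by (cases "md = Virtual") auto
  obtain M\<^sub>k where k: "declares api k m M\<^sub>k"
    and wt: "let wt = wt_expr (map_option fst \<circ> map_of (svars C)) (params M\<^sub>k)
                       (if ev = After then ret M\<^sub>k else None)
            in \<forall>(g, ss) \<in> set cmds. wt g Boolean \<and>
                 (\<forall>x e. Assign x e \<in> set ss \<longrightarrow>
                    (\<exists>T i U. map_of (svars C) x = Some (T, i) \<and> wt e U \<and> widen api U T))"
    using wf_contract assms(3) unfolding wf_contract_def by blast
  have eq: "params M\<^sub>k = params M" "ret M\<^sub>k = ret M"
    using consistent[OF kd declares_api[OF k] d] by (simp_all add: mdecl.map_sel)
  have rt: "((if ev = After then ret M\<^sub>k else None) \<noteq> None) = (ev = After \<and> ret M \<noteq> None)"
    using eq by auto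
  show ?thesis
    unfolding cmds_ok_def
  proof (intro ballI, clarify)
    fix g ss
    assume g: "(g, ss) \<in> set cmds"
    have 1: "expr_ok (length (params M)) (ev = After \<and> ret M \<noteq> None) e"
      if "wt_expr S (params M\<^sub>k) (if ev = After then ret M\<^sub>k else None) e T" for S e T
      using wt_expr_ok[OF that] unfolding rt by (simp only: eq)
    have "stmt_ok (length (params M)) (ev = After \<and> ret M \<noteq> None) st" if "st \<in> set ss" for st
      using wt g that 1 by (cases st) (fastforce simp: Let_def)
    moreover have "expr_ok (length (params M)) (ev = After \<and> ret M \<noteq> None) g"
      using wt g 1 by (fastforce simp: Let_def)
    ultimately show "expr_ok (length (params M)) (ev = After \<and> ret M \<noteq> None) g \<and>
       (\<forall>st \<in> set ss. stmt_ok (length (params M)) (ev = After \<and> ret M \<noteq> None) st)" by blast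
  qed
qed

text \<open>By acyclicity a proper superclass has strictly fewer superclasses. So sorting by their
  number puts subclasses on the right side of their superclasses.\<close>

lemma card_subcls:
  assumes "subcls W c d" and "c \<noteq> d"
  shows "card {k. subcls W d k} < card {k. subcls W c k}"
proof (rule psubset_card_mono)
  have "acyclic (subcls1 W)" using wf_W by (simp add: wf_classes_def)
  then have "\<not> subcls W d c"
    using assms unfolding subcls_def by (metis acyclic_def rtrancl_eq_or_trancl trancl_rtrancl_trancl)
  moreover have "{k. subcls W d k} \<subseteq> {k. subcls W c k}"
    using subcls_trans[OF assms(1)] by auto
  ultimately show "{k. subcls W d k} \<subset> {k. subcls W c k}"
    by (metis (mono_tags) mem_Collect_eq psubsetI subcls_refl)
qed (rule finite_subcls)

text \<open>\<open>d'\<close> is the least class above \<open>x\<close> that declares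
  \<open>m\<close>. Any other candidate above \<open>x\<close> is therefore a proper superclass of
  \<open>d'\<close>, has a smaller sort key, and comes later in the list.\<close>

lemma dispatch:
  assumes c: "lookup_method W c m = Some (d, M)" "c \<noteq> sc"
    and x: "lookup_method W' x m = Some (d', M')" "subcls W' x c"
  shows "find (subcls W' x) (candidates W Virtual c m) = Some d'"
proof -
  have cd: "subcls W c d" "declares W d m M"
    using lookup_method_Some[OF c(1)] by auto
  have xd': "subcls W' x d'" "declares W' d' m M'"
    and least: "\<And>k M'. subcls W' x k \<Longrightarrow> declares W' k m M' \<Longrightarrow> subcls W' d' k"
    using lookup_method_Some[OF x(1)] by auto
  have d': "d' \<noteq> sc" "\<exists>M. declares W d' m M"
    using declares_W'[OF xd'(2)] by auto
  have "subcls W' x d"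
    using x(2) cd(1) subcls_W'[OF c(2)] subcls_trans by blast
  then have d'd: "subcls W d' d"
    using least declares_W'I[OF cd(2)] subcls_W'[OF d'(1)] by blast
  let ?L = "filter (\<lambda>k. subcls W k d \<and> (\<exists>M. declares W k m M)) (map fst W)"
  have "find (subcls W' x) (rev (sort_key (\<lambda>k. card {k'. subcls W k k'}) ?L)) = Some d'"
  proof (rule find_rev_sort_key)
    show "d' \<in> set ?L"
      using d' d'd by (force simp: declares_def dest: map_of_SomeD)
    fix y
    assume y: "y \<in> set ?L" "subcls W' x y" "y \<noteq> d'"
    then obtain M\<^sub>y where "declares W y m M\<^sub>y" by auto
    then have "subcls W d' y"
      using least[OF y(2)] declares_W'I[of y m] subcls_W'[OF d'(1), of y] by blast
    then show "card {k'. subcls W y k'} < card {k'. subcls W d' k'}"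
      using y(3) by (intro card_subcls) auto
  qed (rule xd'(1))
  then show ?thesis using c(1) by (simp add: candidates_def)
qed

end

section \<open>Layout of inlined code\<close>

lemma length_inline_instr [simp]: "length (inline_instr blk is pc i) = instr_length blk i"
  by (cases i) auto

lemma new_pc_Suc:
  "j < length is \<Longrightarrow> new_pc blk is (Suc j) = new_pc blk is j + instr_length blk (is ! j)"
  by (simp add: new_pc_def take_Suc_conv_app_nth)

lemma new_pc_beyond: "length is \<le> j \<Longrightarrow> new_pc blk is j = new_pc blk is (length is)"
  by (simp add: new_pc_def)

lemma new_pc_mono:
  assumes "i \<le> j"
  shows "new_pc blk is i \<le> new_pc blk is j"
  using assms
proof (rule lift_Suc_mono_le[of "new_pc blk is", rotated])
  fix k
  show "new_pc blk is k \<le> new_pc blk is (Suc k)"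
    by (cases "k < length is") (simp_all add: new_pc_Suc new_pc_beyond[of _ k] new_pc_beyond[of _ "Suc k"])
qed

lemma length_inline_instrs:
  "j \<le> length is \<Longrightarrow>
    length (concat (map (\<lambda>pc. inline_instr blk is pc (is ! pc)) [0..<j])) = new_pc blk is j"
proof (induction j)
  case 0
  then show ?case by (simp add: new_pc_def)
next
  case (Suc j)
  then show ?case by (simp add: new_pc_Suc)
qed

lemma nth_inline_instrs:
  assumes "j < length is" and "k < instr_length blk (is ! j)"
  shows "new_pc blk is j + k < length (concat (map (\<lambda>pc. inline_instr blk is pc (is ! pc)) [0..<length is]))"
    and "concat (map (\<lambda>pc. inline_instr blk is pc (is ! pc)) [0..<length is]) ! (new_pc blk is j + k)
      = inline_instr blk is j (is ! j) ! k"
proof -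
  have "[0..<length is] = [0..<j] @ j # [Suc j..<length is]"
    using assms(1) upt_add_eq_append[of 0 j "length is - j"] by (simp add: upt_conv_Cons)
  then have "concat (map (\<lambda>pc. inline_instr blk is pc (is ! pc)) [0..<length is])
    = concat (map (\<lambda>pc. inline_instr blk is pc (is ! pc)) [0..<j]) @ inline_instr blk is j (is ! j) @
      concat (map (\<lambda>pc. inline_instr blk is pc (is ! pc)) [Suc j..<length is])"
    by simp
  then show "new_pc blk is j + k < length (concat (map (\<lambda>pc. inline_instr blk is pc (is ! pc)) [0..<length is]))"
    and "concat (map (\<lambda>pc. inline_instr blk is pc (is ! pc)) [0..<length is]) ! (new_pc blk is j + k)
      = inline_instr blk is j (is ! j) ! k"
    using assms length_inline_instrs[of j "is" blk] by (simp_all add: nth_append)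
qed

text \<open>Holds for every offset: the original jump is truncated at 0 before its target is
  translated, and the difference of addresses cancels. A target beyond the end of the original code
  becomes the end of the new code, where there is no instruction.\<close>

lemma jump_new_offset: "jump (new_pc blk is j) (new_offset blk is j off) = new_pc blk is (jump j off)"
  by (simp add: jump_def[of "new_pc blk is j"] new_offset_def)

lemma inline_instr_single:
  "(\<And>md c m. i \<noteq> Invoke md c m) \<Longrightarrow> \<exists>i'. inline_instr b is j i = [i'] \<and> (\<forall>md c m. i' \<noteq> Invoke md c m) \<and>
    instr_classes i' = instr_classes i \<and>
    (\<forall>off'. i' = Goto off' \<or> i' = IfFalse off' \<longrightarrow> (\<exists>off. off' = new_offset b is j off))"
  by (cases i) auto

lemma find_append_Some:
  assumes "x \<in> set xs" and "p x" and "\<And>y. y \<in> set xs \<Longrightarrow> p y \<Longrightarrow> y = x"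
  shows "find p (xs @ ys) = Some x"
  using assms(1,3)
proof (induction xs)
  case (Cons a xs)
  show ?case
  proof (cases "p a")
    case True
    then show ?thesis using Cons.prems(2)[of a] by simp
  next
    case False
    then have "x \<in> set xs" using Cons.prems(1) assms(2) by auto
    then show ?thesis using False Cons by simp
  qed
qed simp

lemma find_SomeD: "find p xs = Some y \<Longrightarrow> y \<in> set xs \<and> p y"
  by (induction xs) (auto split: if_splits)

lemma find_append_None:
  "(\<And>y. y \<in> set xs \<Longrightarrow> \<not> p y) \<Longrightarrow> find p (xs @ ys) = find p ys"
  by (induction xs) auto

lemma in_set_concat_upt: "x \<in> set (concat (map f [0..<n])) \<longleftrightarrow> (\<exists>j<n. x \<in> set (f j))"
  by auto

lemma in_set_case_Invoke:
  "x \<in> set (case i of Invoke md c m \<Rightarrow> f md c m | _ \<Rightarrow> []) \<longleftrightarrow>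
    (\<exists>md c m. i = Invoke md c m \<and> x \<in> set (f md c m))"
  by (cases i) auto

context inlining
begin

abbreviation blk :: "nat \<Rightarrow> imode \<Rightarrow> cname \<Rightarrow> mname \<Rightarrow> instr list" where
  "blk n \<equiv> call_block api C sc n W"

abbreviation pre :: "nat \<Rightarrow> imode \<Rightarrow> cname \<Rightarrow> mname \<Rightarrow> code option mdecl \<Rightarrow> instr list" where
  "pre n md c m M \<equiv> call_prefix api C sc n W md c m M"

abbreviation suf :: "nat \<Rightarrow> imode \<Rightarrow> cname \<Rightarrow> mname \<Rightarrow> code option mdecl \<Rightarrow> instr list" where
  "suf n md c m M \<equiv> call_suffix api C sc n W md c m M"

text \<open>The handler of a block without its final \<open>Throw\<close>.\<close>

definition hdl :: "nat \<Rightarrow> imode \<Rightarrow> cname \<Rightarrow> mname \<Rightarrow> instr list" where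
  "hdl n md c m = [Store (n + 2)] @ event_code api C sc n W md c m Exceptional @ [Load (n + 2)]"

text \<open>The \<open>Goto\<close> offset is 2 more than the length of \<open>hdl\<close>, and not
  1, because the final \<open>Throw\<close> is split off.\<close>

lemma call_block_eq:
  "lookup_method W c m = Some (d, M) \<Longrightarrow> blk n md c m =
    pre n md c m M @ Invoke md c m # suf n md c m M @
    Goto (int (length (hdl n md c m)) + 2) # hdl n md c m @ [Throw]"
  by (simp add: call_block_def call_handler_def hdl_def Let_def)

text \<open>\<open>B\<close> is the address of the block, and \<open>M\<close> the declaration found
  statically in \<open>W\<close>, which determines the layout of the block; the method actually
  called may be another one.\<close>

definition call_site :: "cname \<Rightarrow> mname \<Rightarrow> nat \<Rightarrow> nat \<Rightarrow> imode \<Rightarrow> cname \<Rightarrow> mname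
    \<Rightarrow> code option mdecl \<Rightarrow> bool" where
  "call_site c m n B md c' m' M \<longleftrightarrow>
     (\<exists>b j d. prog_code c m n b \<and> j < length (instrs b) \<and> instrs b ! j = Invoke md c' m' \<and>
        lookup_method W c' m' = Some (d, M) \<and> B = new_pc (blk n) (instrs b) j)"

lemma call_site_lookup: "call_site c m n B md c' m' M \<Longrightarrow> \<exists>d. lookup_method W c' m' = Some (d, M)"
  by (auto simp: call_site_def)

lemma call_site_fresh: "call_site c m n B md c' m' M \<Longrightarrow> c' \<noteq> sc"
  unfolding call_site_def prog_code_def by (metis instr_classes.simps(9) nth_mem singletonI)

lemma instr_at_new_pc:
  assumes "prog_code c m n b" and "j < length (instrs b)" and "k < instr_length (blk n) (instrs b ! j)"
  shows "instr_at W' c m (new_pc (blk n) (instrs b) j + k)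
    = Some (inline_instr (blk n) (instrs b) j (instrs b ! j) ! k)"
  using assms nth_inline_instrs[OF assms(2,3)]
  by (simp add: instr_at_def prog_code_def inline_code_def Let_def)

lemma instr_at_new_pc_beyond:
  assumes "prog_code c m n b" and "length (instrs b) \<le> j"
  shows "instr_at W' c m (new_pc (blk n) (instrs b) j) = None"
  using assms length_inline_instrs[of "length (instrs b)" "instrs b" "blk n"]
  by (simp add: instr_at_def prog_code_def inline_code_def Let_def new_pc_beyond[of _ j])

lemma call_site_block:
  assumes "call_site c m n B md c' m' M" and "k < length (blk n md c' m')"
  shows "instr_at W' c m (B + k) = Some (blk n md c' m' ! k)"
  using assms instr_at_new_pc[of c m n _ _ k] unfolding call_site_def by fastforce

lemma call_site_instrs:
  assumes "call_site c m n B md c' m' M"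
  shows "k < length (pre n md c' m' M) \<Longrightarrow> instr_at W' c m (B + k) = Some (pre n md c' m' M ! k)"
    and "instr_at W' c m (B + length (pre n md c' m' M)) = Some (Invoke md c' m')"
    and "k < length (suf n md c' m' M) \<Longrightarrow>
      instr_at W' c m (B + length (pre n md c' m' M) + 1 + k) = Some (suf n md c' m' M ! k)"
    and "instr_at W' c m (B + length (pre n md c' m' M) + 1 + length (suf n md c' m' M))
      = Some (Goto (int (length (hdl n md c' m')) + 2))"
    and "k < length (hdl n md c' m') \<Longrightarrow>
      instr_at W' c m (B + length (pre n md c' m' M) + 1 + length (suf n md c' m' M) + 1 + k)
      = Some (hdl n md c' m' ! k)"
    and "instr_at W' c m (B + length (pre n md c' m' M) + 1 + length (suf n md c' m' M) + 1
        + length (hdl n md c' m')) = Some Throw"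
proof -
  obtain d where "lookup_method W c' m' = Some (d, M)"
    using assms call_site_lookup by blast
  note eq = call_block_eq[OF this, of n md]
  note at = call_site_block[OF assms, unfolded eq]
  show "k < length (pre n md c' m' M) \<Longrightarrow> instr_at W' c m (B + k) = Some (pre n md c' m' M ! k)"
    using at[of k] by (simp add: nth_append)
  show "instr_at W' c m (B + length (pre n md c' m' M)) = Some (Invoke md c' m')"
    using at[of "length (pre n md c' m' M)"] by (simp add: nth_append)
  show "k < length (suf n md c' m' M) \<Longrightarrow>
      instr_at W' c m (B + length (pre n md c' m' M) + 1 + k) = Some (suf n md c' m' M ! k)"
    using at[of "length (pre n md c' m' M) + 1 + k"] by (simp add: nth_append add.assoc)
  show "instr_at W' c m (B + length (pre n md c' m' M) + 1 + length (suf n md c' m' M))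
      = Some (Goto (int (length (hdl n md c' m')) + 2))"
    using at[of "length (pre n md c' m' M) + 1 + length (suf n md c' m' M)"]
    by (simp add: nth_append add.assoc)
  show "k < length (hdl n md c' m') \<Longrightarrow>
      instr_at W' c m (B + length (pre n md c' m' M) + 1 + length (suf n md c' m' M) + 1 + k)
      = Some (hdl n md c' m' ! k)"
    using at[of "length (pre n md c' m' M) + 1 + length (suf n md c' m' M) + 1 + k"]
    by (simp add: nth_append add.assoc)
  show "instr_at W' c m (B + length (pre n md c' m' M) + 1 + length (suf n md c' m' M) + 1
        + length (hdl n md c' m')) = Some Throw"
    using at[of "length (pre n md c' m' M) + 1 + length (suf n md c' m' M) + 1 + length (hdl n md c' m')"]
    by (simp add: nth_append add.assoc)
qed

text \<open>The 3 counts the \<open>Invoke\<close>, the \<open>Goto\<close> behind the suffix and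
  the final \<open>Throw\<close>. The address is the target of that \<open>Goto\<close> and the
  boundary behind the block.\<close>

lemma call_site_end:
  assumes "call_site c m n B md c' m' M"
  shows "\<exists>b j. prog_code c m n b \<and>
    B + length (pre n md c' m' M) + length (suf n md c' m' M) + length (hdl n md c' m') + 3
      = new_pc (blk n) (instrs b) j"
proof -
  obtain b j d where *: "prog_code c m n b" "j < length (instrs b)" "instrs b ! j = Invoke md c' m'"
    "lookup_method W c' m' = Some (d, M)" "B = new_pc (blk n) (instrs b) j"
    using assms by (auto simp: call_site_def)
  then have "B + length (pre n md c' m' M) + length (suf n md c' m' M) + length (hdl n md c' m') + 3
    = new_pc (blk n) (instrs b) (Suc j)"
    by (simp add: new_pc_Suc call_block_eq)
  then show ?thesis using *(1) by blast
qed

section \<open>Exception tables of inlined code\<close>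

abbreviation block_handlers :: "nat \<Rightarrow> code \<Rightarrow> handler list" where
  "block_handlers n b \<equiv> concat (map (\<lambda>pc. case instrs b ! pc of
       Invoke md c m \<Rightarrow> call_table api C sc n W md c m (new_pc (blk n) (instrs b) pc)
     | _ \<Rightarrow> []) [0..<length (instrs b)])"

lemma handlers_inline_code:
  "handlers (inline_code api C sc W n b) = block_handlers n b @
    map (\<lambda>(b', e, t, c). (new_pc (blk n) (instrs b) b', new_pc (blk n) (instrs b) e,
      new_pc (blk n) (instrs b) t, c)) (handlers b)"
  by (simp add: inline_code_def Let_def)

lemma in_call_table:
  "(b\<^sub>0, e, t, x) \<in> set (call_table api C sc n W md c m B) \<longleftrightarrow>
    (\<exists>d M. lookup_method W c m = Some (d, M) \<and>
      b\<^sub>0 = B + length (pre n md c m M) \<and> e = b\<^sub>0 + 1 \<and>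
      t = b\<^sub>0 + 1 + length (suf n md c m M) + 1 \<and> x = ''Throwable'')"
  by (cases "lookup_method W c m") (auto simp: call_table_def Let_def)

lemma block_handlers_iff:
  "(b\<^sub>0, e, t, x) \<in> set (block_handlers n b) \<longleftrightarrow>
    (\<exists>j md c m d M. j < length (instrs b) \<and> instrs b ! j = Invoke md c m \<and>
      lookup_method W c m = Some (d, M) \<and>
      b\<^sub>0 = new_pc (blk n) (instrs b) j + length (pre n md c m M) \<and> e = b\<^sub>0 + 1 \<and>
      t = b\<^sub>0 + 1 + length (suf n md c m M) + 1 \<and> x = ''Throwable'')"
  unfolding in_set_concat_upt in_set_case_Invoke in_call_table by blast

text \<open>The invoke of a block lies strictly before the start of the next block, so invokes at
  equal addresses belong to the same block.\<close>

lemma block_handler_unique: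
  assumes "j < length (instrs b)" and "instrs b ! j = Invoke md c m" and "lookup_method W c m = Some (d, M)"
    and "k < length (instrs b)" and "instrs b ! k = Invoke md' c' m'" and "lookup_method W c' m' = Some (d', M')"
    and "new_pc (blk n) (instrs b) j + length (pre n md c m M)
      = new_pc (blk n) (instrs b) k + length (pre n md' c' m' M')"
  shows "j = k"
proof -
  have *: "\<not> i < i'"
    if "i < length (instrs b)" "instrs b ! i = Invoke md c m" "lookup_method W c m = Some (d, M)"
      "new_pc (blk n) (instrs b) i + length (pre n md c m M) = new_pc (blk n) (instrs b) i' + x"
    for i i' md c m d M x
  proof
    assume "i < i'"
    then have "new_pc (blk n) (instrs b) (Suc i) \<le> new_pc (blk n) (instrs b) i'"
      by (intro new_pc_mono) simp
    then show False using that by (simp add: new_pc_Suc call_block_eq)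
  qed
  show ?thesis using *[OF assms(1,2,3,7)] *[OF assms(4,5,6) assms(7)[symmetric]] by simp
qed

text \<open>The handlers of blocks precede the original ones, and by uniqueness only that of this
  block covers the address. Its class \<open>Throwable\<close> makes it match.\<close>

lemma handler_at_call:
  assumes "call_site c m n B md c' m' M" and "objs h a = Some ob" and "subcls W' (class_of ob) ''Throwable''"
  shows "handler_at W' h a c m (B + length (pre n md c' m' M))
    = Some (B + length (pre n md c' m' M) + 1 + length (suf n md c' m' M) + 1)"
proof -
  obtain b j d where *: "prog_code c m n b" "j < length (instrs b)" "instrs b ! j = Invoke md c' m'"
    "lookup_method W c' m' = Some (d, M)" "B = new_pc (blk n) (instrs b) j"
    using assms(1) by (auto simp: call_site_def)
  let ?i = "B + length (pre n md c' m' M)"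
  let ?t = "B + length (pre n md c' m' M) + 1 + length (suf n md c' m' M) + 1"
  let ?p = "\<lambda>(b, e, t, c). b \<le> ?i \<and> ?i < e \<and> subcls W' (class_of ob) c"
  have "find ?p (block_handlers n b @ hs) = Some (?i, ?i + 1, ?t, ''Throwable'')" for hs
  proof (rule find_append_Some)
    show "(?i, ?i + 1, ?t, ''Throwable'') \<in> set (block_handlers n b)"
      unfolding block_handlers_iff using * by blast
    show "?p (?i, ?i + 1, ?t, ''Throwable'')" using assms(3) by simp
    fix y
    assume y: "y \<in> set (block_handlers n b)" "?p y"
    obtain b\<^sub>0 e t x where y': "y = (b\<^sub>0, e, t, x)" by (cases y)
    obtain j' md' c'' m'' d' M' where j': "j' < length (instrs b)" "instrs b ! j' = Invoke md' c'' m''"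
      "lookup_method W c'' m'' = Some (d', M')"
      "b\<^sub>0 = new_pc (blk n) (instrs b) j' + length (pre n md' c'' m'' M')" "e = b\<^sub>0 + 1"
      "t = b\<^sub>0 + 1 + length (suf n md' c'' m'' M') + 1" "x = ''Throwable''"
      using y(1) unfolding y' block_handlers_iff by blast
    have i: "b\<^sub>0 = ?i" using y(2) y' j'(5) by simp
    then have "j = j'"
      using block_handler_unique[OF *(2,3,4) j'(1,2,3), of n] *(5) j'(4) by simp
    then have "md' = md" "c'' = c'" "m'' = m'" "M' = M"
      using *(3,4) j'(2,3) by auto
    then show "y = (?i, ?i + 1, ?t, ''Throwable'')"
      unfolding y' using i j'(5-7) by simp
  qed
  then show ?thesis
    using *(1) assms(2)
    by (simp add: handler_at_def prog_code_def find_handler_def handlers_inline_code)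
qed

text \<open>The range of a block handler is a single address holding an \<open>Invoke\<close>.
  Elsewhere an original handler must have matched, and the targets of these are values of
  \<open>new_pc\<close>.\<close>

lemma handler_at_other:
  assumes "prog_code c m n b" and "handler_at W' h a c m pc = Some t"
    and "\<And>md c' m'. instr_at W' c m pc \<noteq> Some (Invoke md c' m')"
  shows "\<exists>j. t = new_pc (blk n) (instrs b) j"
proof -
  obtain ob where ob: "find_handler W' (class_of ob) pc (handlers (inline_code api C sc W n b)) = Some t"
    using assms(1,2) by (auto simp: handler_at_def prog_code_def split: option.splits)
  let ?p = "\<lambda>(b, e, t, c). b \<le> pc \<and> pc < e \<and> subcls W' (class_of ob) c"
  have none: "\<not> ?p y" if y: "y \<in> set (block_handlers n b)" for y
  proof
    assume p: "?p y"
    obtain b\<^sub>0 e t x where y': "y = (b\<^sub>0, e, t, x)" by (cases y)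
    obtain j md c' m' d M where j: "j < length (instrs b)" "instrs b ! j = Invoke md c' m'"
      "lookup_method W c' m' = Some (d, M)"
      "b\<^sub>0 = new_pc (blk n) (instrs b) j + length (pre n md c' m' M)" "e = b\<^sub>0 + 1"
      using y unfolding y' block_handlers_iff by blast
    then have "pc = b\<^sub>0" using p y' by simp
    moreover have "call_site c m n (new_pc (blk n) (instrs b) j) md c' m' M"
      using j assms(1) by (auto simp: call_site_def)
    ultimately show False
      using assms(3) call_site_instrs(2) j(4) by metis
  qed
  have eq: "find ?p (handlers (inline_code api C sc W n b)) =
    find ?p (map (\<lambda>(b', e, t, c). (new_pc (blk n) (instrs b) b', new_pc (blk n) (instrs b) e,
      new_pc (blk n) (instrs b) t, c)) (handlers b))"
    unfolding handlers_inline_code using none by (rule find_append_None)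
  obtain y where y: "find ?p (handlers (inline_code api C sc W n b)) = Some y"
    "t = (case y of (b, e, t, c) \<Rightarrow> t)"
    using ob unfolding find_handler_def map_option_eq_Some by blast
  show ?thesis
    using find_SomeD[OF y(1)[unfolded eq]] y(2) by auto
qed

section \<open>The code of calls\<close>

abbreviation state :: "heap \<Rightarrow> sstate" where "state \<equiv> sec_state sc"

abbreviation target :: "nat \<Rightarrow> imode \<Rightarrow> cname \<Rightarrow> mname \<Rightarrow> heap \<Rightarrow> val list \<Rightarrow> cname option" where
  "target n md c m \<equiv> selected W' md (candidates W md c m) n"

abbreviation update :: "event \<Rightarrow> mname \<Rightarrow> cname option \<Rightarrow> val list \<Rightarrow> val option \<Rightarrow> sstate \<Rightarrow> sstate option"
where "update \<equiv> reaction api C"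

text \<open>The fields are one event ahead of \<open>q\<close>. The operands of the call are
  described by the locals which the BEFORE clause has read, so the call cannot receive other values
  than those checked.\<close>

definition at_invoke :: "nat \<Rightarrow> imode \<Rightarrow> cname \<Rightarrow> mname \<Rightarrow> code option mdecl \<Rightarrow> sstate option
    \<Rightarrow> heap \<Rightarrow> val list \<Rightarrow> val list \<Rightarrow> bool" where
  "at_invoke n md c m M q h s l \<longleftrightarrow>
     (\<exists>\<sigma> s'. q = Some \<sigma> \<and>
        update Before m (target n md c m h l) (args_of n (length (params M)) l) None \<sigma> = Some (state h) \<and>
        s = rev (args_of n (length (params M)) l) @ (if md = Static then s' else l ! n # s'))"

text \<open>Here the fields lag: \<open>q\<close> already includes the post-action and may be
  \<open>None\<close>. The return value is still on top of the stack.\<close>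

definition after_call :: "nat \<Rightarrow> imode \<Rightarrow> cname \<Rightarrow> mname \<Rightarrow> code option mdecl \<Rightarrow> sstate option
    \<Rightarrow> heap \<Rightarrow> val list \<Rightarrow> val list \<Rightarrow> bool" where
  "after_call n md c m M q h s l \<longleftrightarrow>
     q = update After m (target n md c m h l) (args_of n (length (params M)) l)
       (if ret M = None then None else Some (hd s)) (state h)"

definition after_exc :: "nat \<Rightarrow> imode \<Rightarrow> cname \<Rightarrow> mname \<Rightarrow> code option mdecl \<Rightarrow> sstate option
    \<Rightarrow> heap \<Rightarrow> val list \<Rightarrow> bool" where
  "after_exc n md c m M q h l \<longleftrightarrow>
     q = update Exceptional m (target n md c m h l) (args_of n (length (params M)) l) None (state h)"

definition synced :: "sstate option \<Rightarrow> heap \<Rightarrow> bool" where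
  "synced q h \<longleftrightarrow> q = Some (state h)"

lemma pre_simple: "i \<in> set (pre n md c m M) \<Longrightarrow> simple i"
  by (auto simp: call_prefix_def Let_def event_code_simple split: if_splits)

lemma suf_simple: "i \<in> set (suf n md c m M) \<Longrightarrow> simple i"
  by (auto simp: call_suffix_def event_code_simple split: if_splits)

lemma hdl_simple: "i \<in> set (hdl n md c m) \<Longrightarrow> simple i"
  by (auto simp: hdl_def event_code_simple)

lemma wpo_call_event:
  assumes "lookup_method W c m = Some (d, M)"
    and "ev = After \<and> ret M \<noteq> None \<Longrightarrow> r = Some (l ! (n + 1))"
    and "\<And>h'. objs h' = objs h \<Longrightarrow>
      update ev m (target n md c m h l) (args_of n (length (params M)) l) r (state h) = Some (state h') \<Longrightarrow>
      Q h' s l"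
  shows "wpo W' (event_code api C sc n W md c m ev) Q h 0 s l"
proof (rule wpo_event[where rt = "ev = After \<and> ret M \<noteq> None" and k = "length (params M)" and r = r])
  show "md = Static \<Longrightarrow> \<exists>d. candidates W md c m = [d]"
    using candidates_not_Virtual[OF assms(1)] by auto
qed (use assms candidates_cmds_ok[OF assms(1)] in blast)+

text \<open>The loads rebuild the operands from the very locals that the tests and guards have read.
  This yields \<open>at_invoke\<close> whatever the stack held before.\<close>

lemma wpo_prefix:
  assumes "lookup_method W c m = Some (d, M)"
  shows "wpo W' (pre n md c m M) (at_invoke n md c m M (Some (state h))) h 0 s l"
proof -
  let ?k = "length (params M)" and ?Q = "at_invoke n md c m M (Some (state h))"
  let ?ev = "event_code api C sc n W md c m Before"
  let ?st = "if md = Static then [] else [Store n]" and ?ld = "if md = Static then [] else [Load n]"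
  let ?sts = "map (\<lambda>i. Store (n + 3 + i)) (rev [0..<?k])"
  let ?lds = "map (\<lambda>i. Load (n + 3 + i)) [0..<?k]"
  have ev: "\<forall>i \<in> set ?ev. fwd i" by (auto intro: simple_fwd event_code_simple)
  have L: "wpo W' (?ld @ ?lds) Q h 0 s l"
    if "Q h (rev (args_of n ?k l) @ (if md = Static then s else l ! n # s)) l" for Q h s l
  proof (cases "md = Static")
    case True
    then show ?thesis using that by (auto intro: wpo_loads)
  next
    case False
    then have "wpo W' (Load n # ?lds) Q h 0 s l"
      using that by (intro wpo_Cons) (auto simp: exec_simps intro: wpo_loads)
    then show ?thesis using False by simp
  qed
  have E: "wpo W' (?ev @ ?ld @ ?lds) ?Q h 0 s l" for s l
  proof (rule wpo_append)
    show "wpo W' ?ev (\<lambda>h s l. wpo W' (?ld @ ?lds) ?Q h 0 s l) h 0 s l"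
    proof (rule wpo_call_event[OF assms, where r = None])
      fix h'
      assume h': "objs h' = objs h"
        "update Before m (target n md c m h l) (args_of n ?k l) None (state h) = Some (state h')"
      \<comment> \<open>The clause writes static fields only, so the tests would select the same
        class again.\<close>
      then have "target n md c m h' l = target n md c m h l" by (intro selected_cong)
      then show "wpo W' (?ld @ ?lds) ?Q h' 0 s l"
        using h'(2) by (intro L) (auto simp: at_invoke_def)
    qed simp
  qed (use ev in auto)
  have S: "wpo W' (?st @ ?ev @ ?ld @ ?lds) ?Q h 0 s l" for s l
  proof (cases "md = Static")
    case True
    then show ?thesis using E by simp
  next
    case False
    have "wpo W' (Store n # ?ev @ ?ld @ ?lds) ?Q h 0 s l"
      by (rule wpo_Cons) (use E ev in \<open>auto simp: exec_simps\<close>)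
    then show ?thesis using False by simp
  qed
  have "wpo W' (?sts @ ?st @ ?ev @ ?ld @ ?lds) ?Q h 0 s l"
    by (intro wpo_append wpo_stores S) (use ev in auto)
  then show ?thesis by (simp add: call_prefix_def Let_def)
qed

text \<open>For \<open>q = None\<close> the postcondition is unsatisfiable, and the lemma states
  that the suffix is never left.\<close>

lemma wpo_suffix:
  assumes "lookup_method W c m = Some (d, M)" and "after_call n md c m M q h s l"
  shows "wpo W' (suf n md c m M) (\<lambda>h s l. synced q h) h 0 s l"
proof (cases "ret M")
  case None
  have "wpo W' (event_code api C sc n W md c m After) (\<lambda>h s l. synced q h) h 0 s l"
    using assms(1)
    by (rule wpo_call_event[where r = None]) (use assms(2) None in \<open>auto simp: synced_def after_call_def\<close>)
  then show ?thesis using None by (simp add: call_suffix_def)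
next
  case (Some T)
  have ev: "\<forall>i \<in> set (event_code api C sc n W md c m After). fwd i"
    by (auto intro: simple_fwd event_code_simple)
  have "wpo W' (Store (n + 1) # event_code api C sc n W md c m After @ [Load (n + 1)])
    (\<lambda>h s l. synced q h) h 0 s l"
  proof (rule wpo_Cons)
    fix h' k' s' l'
    assume "exec W' (Store (n + 1)) (h, 0, s, l) (h', k', s', l')"
    then obtain v where v: "s = v # s'" "h' = h" "k' = 1" "l' = l[n + 1 := v]" "n + 1 < length l"
      by (auto simp: exec_simps)
    have "wpo W' (event_code api C sc n W md c m After)
      (\<lambda>h s l. wpo W' [Load (n + 1)] (\<lambda>h s l. synced q h) h 0 s l) h 0 s' l'"
    proof (rule wpo_call_event[OF assms(1), where r = "Some v"])
      fix h'
      assume "update After m (target n md c m h l') (args_of n (length (params M)) l') (Some v) (state h)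
        = Some (state h')"
      then have "synced q h'"
        using assms(2) Some v by (simp add: synced_def after_call_def)
      then show "wpo W' [Load (n + 1)] (\<lambda>h s l. synced q h) h' 0 s' l'"
        by (intro wpo_single) (auto simp: exec_simps)
    qed (use v in simp)
    then show "k' = 1 \<and> wpo W' (event_code api C sc n W md c m After @ [Load (n + 1)])
      (\<lambda>h s l. synced q h) h' 0 s' l'"
      using v ev by (auto intro!: wpo_append)
  qed (use ev in auto)
  then show ?thesis using Some by (simp add: call_suffix_def)
qed

lemma wpo_handler:
  assumes "lookup_method W c m = Some (d, M)" and "after_exc n md c m M q h l"
  shows "wpo W' (hdl n md c m) (\<lambda>h s l. synced q h) h 0 s l"
proof -
  have ev: "\<forall>i \<in> set (event_code api C sc n W md c m Exceptional). fwd i"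
    by (auto intro: simple_fwd event_code_simple)
  have "wpo W' (Store (n + 2) # event_code api C sc n W md c m Exceptional @ [Load (n + 2)])
    (\<lambda>h s l. synced q h) h 0 s l"
  proof (rule wpo_Cons)
    fix h' k' s' l'
    assume "exec W' (Store (n + 2)) (h, 0, s, l) (h', k', s', l')"
    then obtain v where v: "s = v # s'" "h' = h" "k' = 1" "l' = l[n + 2 := v]" "n + 2 < length l"
      by (auto simp: exec_simps)
    have "wpo W' (event_code api C sc n W md c m Exceptional)
      (\<lambda>h s l. wpo W' [Load (n + 2)] (\<lambda>h s l. synced q h) h 0 s l) h 0 s' l'"
    proof (rule wpo_call_event[OF assms(1), where r = None])
      fix h'
      assume "update Exceptional m (target n md c m h l') (args_of n (length (params M)) l') None (state h)
        = Some (state h')"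
      then have "synced q h'"
        using assms(2) v by (simp add: synced_def after_exc_def)
      then show "wpo W' [Load (n + 2)] (\<lambda>h s l. synced q h) h' 0 s' l'"
        by (intro wpo_single) (auto simp: exec_simps)
    qed simp
    then show "k' = 1 \<and> wpo W' (event_code api C sc n W md c m Exceptional @ [Load (n + 2)])
      (\<lambda>h s l. synced q h) h' 0 s' l'"
      using v ev by (auto intro!: wpo_append)
  qed (use ev in auto)
  then show ?thesis by (simp add: hdl_def)
qed

end

section \<open>Type-safe evolution of the heap\<close>

text \<open>Common to machine instructions, allocation of exceptions and API calls (through
  \<open>hext\<close>), and enough to repeat a class test with the same answer.\<close>

definition keeps_classes :: "heap \<Rightarrow> heap \<Rightarrow> bool" where
  "keeps_classes h h' \<longleftrightarrow>
     (\<forall>a ob. objs h a = Some ob \<longrightarrow> (\<exists>ob'. objs h' a = Some ob' \<and> class_of ob' = class_of ob))"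

lemma keeps_classes_new: "objs h a = None \<Longrightarrow> keeps_classes h (h\<lparr>objs := (objs h)(a \<mapsto> ob)\<rparr>)"
  by (auto simp: keeps_classes_def)

lemma hext_keeps_classes: "hext h h' \<Longrightarrow> keeps_classes h h'"
  unfolding keeps_classes_def
proof (intro allI impI)
  fix a ob
  assume "hext h h'" "objs h a = Some ob"
  then show "\<exists>ob'. objs h' a = Some ob' \<and> class_of ob' = class_of ob"
    by (cases ob) (fastforce simp: hext_def)+
qed

lemma exec_keeps_classes: "exec W i (h, pc, s, l) (h', pc', s', l') \<Longrightarrow> keeps_classes h h'"
  by (cases i) (auto simp: exec_simps keeps_classes_def)

lemma exec_sec_state:
  "exec W i (h, pc, s, l) (h', pc', s', l') \<Longrightarrow> sc \<notin> instr_classes i \<Longrightarrow> sec_state sc h' = sec_state sc h"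
  by (cases i) (auto simp: exec_simps sec_state_def)

text \<open>\<open>keeps_classes\<close> says nothing about free addresses: a dangling target could
  become an instance of some class by a later allocation.\<close>

definition target_ok :: "imode \<Rightarrow> nat \<Rightarrow> heap \<Rightarrow> val list \<Rightarrow> bool" where
  "target_ok md n h l \<longleftrightarrow> md = Static \<or> l ! n = Const Null \<or> (\<exists>a. l ! n = Addr a \<and> objs h a \<noteq> None)"

lemma target_ok_keeps_classes: "keeps_classes h h' \<Longrightarrow> target_ok md n h l \<Longrightarrow> target_ok md n h' l"
  by (fastforce simp: target_ok_def keeps_classes_def)

lemma selected_keeps_classes:
  assumes "keeps_classes h h'" and "target_ok md n h l"
  shows "selected W md ks n h' l = selected W md ks n h l"
proof (cases "md = Static")
  case False
  have "inst W h' (l ! n) k = inst W h (l ! n) k" for k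
    using assms False by (fastforce simp: inst_def cast_ok_def keeps_classes_def target_ok_def)
  then have "inst W h' (l ! n) = inst W h (l ! n)" by (rule ext)
  then show ?thesis by (simp add: selected_def)
qed (simp add: selected_def)

lemma reaction_inactive: "(\<And>c. k = Some c \<Longrightarrow> c \<notin> fst ` set api) \<Longrightarrow> reaction api C ev m k vs r \<sigma> = Some \<sigma>"
  by (simp add: reaction_def split: option.split)

section \<open>Shapes of conforming values\<close>

lemma obj_ty_not: "obj_ty ob \<noteq> Boolean" "obj_ty ob \<noteq> Integer" "obj_ty ob \<noteq> NT"
  by (cases ob; simp)+

lemma typeof_val_shape: "typeof h v = Some S \<Longrightarrow> val_shape v S"
proof (cases v)
  case (Const x)
  then show "typeof h v = Some S \<Longrightarrow> val_shape v S" by (cases x) auto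
next
  case (Addr a)
  then show "typeof h v = Some S \<Longrightarrow> val_shape v S" by (cases S) (auto simp: obj_ty_not)
qed

lemma conf_val_shape:
  assumes "conf W h v T"
  shows "val_shape v T"
proof -
  obtain S where S: "typeof h v = Some S" "widen W S T" using assms by (auto simp: conf_def)
  have v: "val_shape v S" using S(1) by (rule typeof_val_shape)
  from S(2) show ?thesis
  proof (cases rule: widen.cases)
    case 1
    then show ?thesis using v by simp
  qed (use v in auto)
qed

section \<open>Traces of prefixes and limits\<close>

lemma srt_from_snoc: "\<exists>ys. srt_from W p V (E @ [K]) = srt_from W p V E @ ys"
proof (induction W p V E rule: srt_from.induct)
  case (2 W V K' E)
  then show ?case by (auto split: option.splits)
next
  case (3 W c m T V K' E)
  then show ?case by auto
qed simp

text \<open>In the infinite case each prefix of the limit is a proper prefix of some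
  \<open>t n\<close>. Properness matters because the last action of \<open>t n\<close> may be a
  violating post-action.\<close>

lemma seq_limit_cases:
  fixes t :: "nat \<Rightarrow> 'a list"
  assumes "\<And>n. \<exists>ys. t (Suc n) = t n @ ys"
  obtains n where "seq_limit t = FinSeq (t n)"
  | u where "seq_limit t = InfSeq u" "\<And>N. \<exists>n ys. ys \<noteq> [] \<and> t n = map u [0..<N] @ ys"
proof (cases "\<exists>n. \<forall>k \<ge> n. t k = t n")
  case True
  then show thesis using that(1) by (auto simp: seq_limit_def)
next
  case False
  have mono: "\<exists>ys. t k = t n @ ys" if "n \<le> k" for n k
    using that
  proof (induction k rule: dec_induct)
    case (step k)
    then show ?case using assms[of k] by auto
  qed simp
  have long: "\<exists>n. N < length (t n)" for N
  proof (induction N)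
    case 0
    obtain k where "t k \<noteq> t 0" using False by blast
    then show ?case using mono[of 0 k] by (intro exI[of _ k]) auto
  next
    case (Suc N)
    then obtain n where n: "N < length (t n)" by blast
    obtain k where k: "k \<ge> n" "t k \<noteq> t n" using False by blast
    then obtain ys where "t k = t n @ ys" "ys \<noteq> []" using mono[of n k] by auto
    then have "Suc N < length (t k)" using n by (cases ys) auto
    then show ?case by blast
  qed
  define u where "u = (\<lambda>i. t (LEAST n. i < length (t n)) ! i)"
  have "\<exists>n ys. ys \<noteq> [] \<and> t n = map u [0..<N] @ ys" for N
  proof -
    obtain n where n: "N < length (t n)" using long by blast
    have "u i = t n ! i" if "i < N" for i
    proof -
      let ?L = "LEAST n. i < length (t n)"
      have "i < length (t n)" using that n by simp
      then have "?L \<le> n" "i < length (t ?L)" by (rule Least_le, rule LeastI)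
      then show ?thesis using mono[of ?L n] by (auto simp: u_def nth_append)
    qed
    then have "map u [0..<N] = take N (t n)"
      using n by (intro nth_equalityI) auto
    then have "t n = map u [0..<N] @ drop N (t n)" by simp
    moreover have "drop N (t n) \<noteq> []" using n by simp
    ultimately show ?thesis by blast
  qed
  then show thesis
    using False by (intro that(2)[of u]) (auto simp: seq_limit_def u_def)
qed

context inlining
begin

section \<open>Exceptions are throwable\<close>

lemma subcls_api: "subcls api c d \<Longrightarrow> subcls W' c d"
proof -
  have "subcls1 api \<subseteq> subcls1 W'"
    by (auto simp: subcls1_def map_of_link super_map_cls)
  then show "subcls api c d \<Longrightarrow> subcls W' c d"
    unfolding subcls_def using rtrancl_mono by blast
qed

lemma throwable_subcls:
  assumes "is_throwable W' h a"
  shows "\<exists>ob. objs h a = Some ob \<and> subcls W' (class_of ob) ''Throwable''"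
proof -
  obtain ob where ob: "objs h a = Some ob" "widen W' (obj_ty ob) (Class ''Throwable'')"
    using assms by (auto simp: is_throwable_def conf_def)
  from ob(2) have "subcls W' (class_of ob) ''Throwable''"
    by (cases rule: widen.cases; cases ob) auto
  then show ?thesis using ob(1) by blast
qed

lemma throws_throwable:
  assumes "throws W' i h s x"
  shows "is_throwable W' (h\<lparr>objs := (objs h)(a \<mapsto> blank W' x)\<rparr>) a"
proof -
  have "x \<in> sys_xcpts"
    using assms by (cases rule: throws.cases) (simp_all add: sys_xcpts_def)
  then have "subcls W' x ''Throwable''"
    using wf_api by (intro subcls_api) (simp add: wf_api_def)
  then show ?thesis
    by (auto simp: is_throwable_def conf_def blank_def intro: widen.intros)
qed

lemma call_site_prog_code: "call_site c m n B md c' m' M \<Longrightarrow> \<exists>b. prog_code c m n b"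
  by (auto simp: call_site_def)

section \<open>The invariant\<close>

text \<open>
  The parameter \<open>q\<close> is the state of the security automaton.  It is \<open>None\<close> only after a violation by a
  post-action; then the code of the corresponding event, which \<open>top_ok\<close> locates, is never left.
\<close>

inductive top_ok :: "sstate option \<Rightarrow> heap \<Rightarrow> cname \<Rightarrow> mname \<Rightarrow> nat \<Rightarrow> val list \<Rightarrow> val list \<Rightarrow> bool" where
  boundary: "prog_code c m n b \<Longrightarrow> synced q h \<Longrightarrow> top_ok q h c m (new_pc (blk n) (instrs b) j) s l"
| prefix: "call_site c m n B md c' m' M \<Longrightarrow> wpo W' (pre n md c' m' M) (at_invoke n md c' m' M q) h k s l \<Longrightarrow>
    top_ok q h c m (B + k) s l"
| suffix: "call_site c m n B md c' m' M \<Longrightarrow> wpo W' (suf n md c' m' M) (\<lambda>h s l. synced q h) h k s l \<Longrightarrow>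
    top_ok q h c m (B + length (pre n md c' m' M) + 1 + k) s l"
| handler: "call_site c m n B md c' m' M \<Longrightarrow> wpo W' (hdl n md c' m') (\<lambda>h s l. synced q h) h k s l \<Longrightarrow>
    top_ok q h c m (B + length (pre n md c' m' M) + 1 + length (suf n md c' m' M) + 1 + k) s l"

text \<open>A suspended frame waits for a method of the program, whose post-events need no reaction.\<close>

fun suspended :: "heap \<Rightarrow> frame \<Rightarrow> bool" where
  "suspended h (Frame c m pc s l) \<longleftrightarrow>
     (\<exists>n B md c' m' M. call_site c m n B md c' m' M \<and> pc = B + length (pre n md c' m' M) \<and>
        target_ok md n h l \<and> (\<forall>k. target n md c' m' h l = Some k \<longrightarrow> k \<notin> fst ` set api))"
| "suspended h (Exc a) \<longleftrightarrow> False"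

text \<open>An exception at an invoke still owes its EXCEPTIONAL code, hence
  \<open>after_exc\<close>; anywhere else the fields are in sync. An empty stack and a lone
  exception make no further step, so nothing is required of \<open>q\<close>.\<close>

inductive safe :: "sstate option \<Rightarrow> jconf \<Rightarrow> bool" where
  safe_end: "safe q (h, [])"
| safe_top: "top_ok q h c m pc s l \<Longrightarrow> \<forall>F \<in> set R. suspended h F \<Longrightarrow> safe q (h, Frame c m pc s l # R)"
| safe_uncaught: "safe q (h, [Exc a])"
| safe_exc_call: "call_site c m n B md c' m' M \<Longrightarrow> is_throwable W' h a \<Longrightarrow> after_exc n md c' m' M q h l \<Longrightarrow>
    \<forall>F \<in> set R. suspended h F \<Longrightarrow>
    safe q (h, Exc a # Frame c m (B + length (pre n md c' m' M)) s l # R)"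
| safe_exc: "prog_code c m n b \<Longrightarrow> (\<And>md c' m'. instr_at W' c m pc \<noteq> Some (Invoke md c' m')) \<Longrightarrow>
    is_throwable W' h a \<Longrightarrow> synced q h \<Longrightarrow> \<forall>F \<in> set R. suspended h F \<Longrightarrow>
    safe q (h, Exc a # Frame c m pc s l # R)"

lemma suspended_keeps_classes: "keeps_classes h h' \<Longrightarrow> suspended h F \<Longrightarrow> suspended h' F"
proof (cases F)
  case (Frame c m pc s l)
  assume h: "keeps_classes h h'" and "suspended h F"
  then obtain n B md c' m' M where site: "call_site c m n B md c' m' M" "pc = B + length (pre n md c' m' M)"
    "target_ok md n h l" "\<forall>k. target n md c' m' h l = Some k \<longrightarrow> k \<notin> fst ` set api"
    using Frame by auto
  then have "target_ok md n h' l" "\<forall>k. target n md c' m' h' l = Some k \<longrightarrow> k \<notin> fst ` set api"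
    using target_ok_keeps_classes[OF h] selected_keeps_classes[OF h] by simp_all
  then show "suspended h' F" unfolding Frame suspended.simps using site(1,2) by blast
qed auto

text \<open>For a callee in the program the AFTER reaction is the identity, so being in sync on
  return is already \<open>after_call\<close>, and control stands at offset 0 of the suffix.\<close>

lemma suspended_resume:
  assumes "suspended h (Frame c m pc s l)" and "synced q h"
  shows "top_ok q h c m (pc + 1) s' l"
proof -
  obtain n B md c' m' M where site: "call_site c m n B md c' m' M" "pc = B + length (pre n md c' m' M)"
    "\<And>k. target n md c' m' h l = Some k \<Longrightarrow> k \<notin> fst ` set api"
    using assms(1) by auto
  obtain d where d: "lookup_method W c' m' = Some (d, M)" using call_site_lookup[OF site(1)] by blast
  have "after_call n md c' m' M q h s' l"
    using assms(2) site(3) by (simp add: after_call_def synced_def reaction_inactive)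
  from top_ok.suffix[OF site(1) wpo_suffix[OF d this]] show ?thesis using site(2) by simp
qed

lemma safe_unwind:
  assumes "\<forall>F \<in> set R. suspended h F" and "synced q h" and "is_throwable W' h a"
  shows "safe q (h, Exc a # R)"
proof (cases R)
  case Nil
  then show ?thesis by (simp add: safe_uncaught)
next
  case (Cons F R')
  then obtain c m pc s l where F: "F = Frame c m pc s l" using assms(1) by (cases F) auto
  then obtain n B md c' m' M where site: "call_site c m n B md c' m' M" "pc = B + length (pre n md c' m' M)"
    "\<And>k. target n md c' m' h l = Some k \<Longrightarrow> k \<notin> fst ` set api"
    using assms(1) Cons by auto
  have "after_exc n md c' m' M q h l"
    using assms(2) site(3) by (simp add: after_exc_def synced_def reaction_inactive)
  then show ?thesis
    using safe_exc_call[OF site(1) assms(3)] assms(1) Cons F site(2) by simp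
qed

text \<open>A \<open>plain\<close> instruction is original code, monitor code or the end of a block;
  if it is not \<open>simple\<close>, and so may raise, throw or return, the fields are in sync. A
  \<open>stuck\<close> call cannot be resolved; the inliner leaves it bare and the machine cannot
  execute it.\<close>

lemma top_ok_cases:
  assumes "top_ok q h c m pc s l" and i: "instr_at W' c m pc = Some i"
  obtains
    (plain) n b where "prog_code c m n b" "\<And>md c' m'. i \<noteq> Invoke md c' m'" "synced q h \<or> simple i"
      "\<And>h' pc' s' l'. exec W' i (h, pc, s, l) (h', pc', s', l') \<Longrightarrow> top_ok q h' c m pc' s' l'"
  | (stuck) md c' m' where "i = Invoke md c' m'" "\<And>h s. invoke W' h md c' m' s = None"
  | (call) n B md c' m' M where "call_site c m n B md c' m' M" "pc = B + length (pre n md c' m' M)"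
      "i = Invoke md c' m'" "at_invoke n md c' m' M q h s l"
proof -
  have pref: thesis
    if site: "call_site c m n B md c' m' M" and w: "wpo W' (pre n md c' m' M) (at_invoke n md c' m' M q) h k s l"
      and pc: "pc = B + k"
    for n B md c' m' M k
    using wpo_cases[OF w]
  proof
    assume k: "k < length (pre n md c' m' M)"
    then have ii: "i = pre n md c' m' M ! k" using call_site_instrs(1)[OF site k] i pc by simp
    then have simple: "simple i" using pre_simple[OF nth_mem[OF k]] by simp
    obtain b where b: "prog_code c m n b" using call_site_prog_code[OF site] by blast
    show thesis
    proof (rule plain[OF b])
      show "top_ok q h' c m pc' s' l'" if "exec W' i (h, pc, s, l) (h', pc', s', l')" for h' pc' s' l'
        using wpo_exec[OF w k, of B h' pc' s' l'] that pre_simple ii pc top_ok.prefix[OF site] by auto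
    qed (use simple in auto)
  next
    assume "k = length (pre n md c' m' M) \<and> at_invoke n md c' m' M q h s l"
    then show thesis
      using call[OF site] call_site_instrs(2)[OF site] i pc by simp
  qed
  show thesis
    using assms(1)
  proof (cases rule: top_ok.cases)
    case (boundary n b j)
    have j: "j < length (instrs b)"
      using i instr_at_new_pc_beyond[OF boundary(2)] boundary(1) by (cases "j < length (instrs b)") auto
    show thesis
    proof (cases "\<exists>md c' m'. instrs b ! j = Invoke md c' m'")
      case True
      then obtain md c' m' where inv: "instrs b ! j = Invoke md c' m'" by blast
      then have "sc \<notin> instr_classes (Invoke md c' m')"
        using boundary(2) j unfolding prog_code_def by (metis nth_mem)
      then have c': "c' \<noteq> sc" by simp
      show thesis
      proof (cases "lookup_method W c' m'")
        case None
        have "0 < instr_length (blk n) (instrs b ! j)"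
          using inv None by (simp add: call_block_def)
        then have "i = Invoke md c' m'"
          using instr_at_new_pc[OF boundary(2) j, of 0] i boundary(1) inv None by (simp add: call_block_def)
        moreover have "lookup_method W' c' m' = None"
        proof (rule ccontr)
          assume "lookup_method W' c' m' \<noteq> None"
          then obtain d M where "lookup_method W' c' m' = Some (d, M)" by auto
          from lookup_method_W'[OF this c'] show False using None by simp
        qed
        ultimately show thesis using stuck by (simp add: invoke_def)
      next
        case (Some dM)
        obtain d M where dM: "lookup_method W c' m' = Some (d, M)" using Some by (cases dM) auto
        have site: "call_site c m n (new_pc (blk n) (instrs b) j) md c' m' M"
          using boundary(2) j inv dM by (auto simp: call_site_def)
        \<comment> \<open>A boundary in front of a call is offset 0 of its prefix; if the prefix is
          empty, this is the invoke itself.\<close>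
        have "wpo W' (pre n md c' m' M) (at_invoke n md c' m' M q) h 0 s l"
          using wpo_prefix[OF dM] boundary(3) by (simp add: synced_def)
        then show thesis using pref[OF site] boundary(1) by simp
      qed
    next
      case False
      then obtain i' where i': "inline_instr (blk n) (instrs b) j (instrs b ! j) = [i']"
        "\<forall>md c m. i' \<noteq> Invoke md c m" "instr_classes i' = instr_classes (instrs b ! j)"
        "\<forall>off'. i' = Goto off' \<or> i' = IfFalse off' \<longrightarrow> (\<exists>off. off' = new_offset (blk n) (instrs b) j off)"
        using inline_instr_single[of "instrs b ! j" "blk n" "instrs b" j] by auto
      have len: "instr_length (blk n) (instrs b ! j) = 1"
        using length_inline_instr[of "blk n" "instrs b" j "instrs b ! j"] i'(1) by simp
      then have ii: "i = i'"
        using instr_at_new_pc[OF boundary(2) j, of 0] i boundary(1) i'(1) by simp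
      have sc: "sc \<notin> instr_classes i"
        using ii i'(3) boundary(2) j unfolding prog_code_def by simp
      show thesis
      proof (rule plain[OF boundary(2)])
        fix h' pc' s' l'
        assume ex: "exec W' i (h, pc, s, l) (h', pc', s', l')"
        have "synced q h'" using boundary(3) exec_sec_state[OF ex sc] by (simp add: synced_def)
        moreover have "\<exists>j'. pc' = new_pc (blk n) (instrs b) j'"
          using exec_pc[OF ex]
        proof
          assume "pc' = pc + 1 \<and> (\<forall>off. i \<noteq> Goto off)"
          then have "pc' = new_pc (blk n) (instrs b) (Suc j)"
            using new_pc_Suc[OF j, of "blk n"] len boundary(1) by simp
          then show ?thesis by blast
        next
          assume "\<exists>off. (i = Goto off \<or> i = IfFalse off) \<and> pc' = jump pc off"
          then obtain off where "pc' = jump pc (new_offset (blk n) (instrs b) j off)"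
            using i'(4) ii by blast
          then show ?thesis using boundary(1) by (auto simp: jump_new_offset)
        qed
        ultimately show "top_ok q h' c m pc' s' l'"
          using top_ok.boundary[OF boundary(2)] by auto
      qed (use i'(2) ii boundary(3) in auto)
    qed
  next
    case (prefix n B md c' m' M k)
    then show thesis using pref by blast
  next
    case (suffix n B md c' m' M k)
    obtain b where b: "prog_code c m n b" using call_site_prog_code[OF suffix(2)] by blast
    from wpo_cases[OF suffix(3)] show thesis
    proof
      assume k: "k < length (suf n md c' m' M)"
      then have ii: "i = suf n md c' m' M ! k" using call_site_instrs(3)[OF suffix(2) k] i suffix(1) by simp
      then have simple: "simple i" using suf_simple[OF nth_mem[OF k]] by simp
      show thesis
      proof (rule plain[OF b])
        show "top_ok q h' c m pc' s' l'" if "exec W' i (h, pc, s, l) (h', pc', s', l')" for h' pc' s' l'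
          using wpo_exec[OF suffix(3) k, of "B + length (pre n md c' m' M) + 1" h' pc' s' l']
            that suf_simple ii suffix(1) top_ok.suffix[OF suffix(2)] by auto
      qed (use simple in auto)
    next
      assume k: "k = length (suf n md c' m' M) \<and> synced q h"
      then have ii: "i = Goto (int (length (hdl n md c' m')) + 2)"
        using call_site_instrs(4)[OF suffix(2)] i suffix(1) by simp
      obtain b' j where e: "prog_code c m n b'"
        "B + length (pre n md c' m' M) + length (suf n md c' m' M) + length (hdl n md c' m') + 3
          = new_pc (blk n) (instrs b') j"
        using call_site_end[OF suffix(2)] by blast
      show thesis
      proof (rule plain[OF b])
        show "top_ok q h' c m pc' s' l'" if "exec W' i (h, pc, s, l) (h', pc', s', l')" for h' pc' s' l'
        proof -
          have "h' = h" "pc' = new_pc (blk n) (instrs b') j"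
            using that ii e(2) suffix(1) k by (auto simp: exec_simps)
          then show ?thesis using top_ok.boundary[OF e(1)] k by simp
        qed
      qed (use ii k in auto)
    qed
  next
    case (handler n B md c' m' M k)
    obtain b where b: "prog_code c m n b" using call_site_prog_code[OF handler(2)] by blast
    from wpo_cases[OF handler(3)] show thesis
    proof
      assume k: "k < length (hdl n md c' m')"
      then have ii: "i = hdl n md c' m' ! k" using call_site_instrs(5)[OF handler(2) k] i handler(1) by simp
      then have simple: "simple i" using hdl_simple[OF nth_mem[OF k]] by simp
      show thesis
      proof (rule plain[OF b])
        show "top_ok q h' c m pc' s' l'" if "exec W' i (h, pc, s, l) (h', pc', s', l')" for h' pc' s' l'
          using wpo_exec[OF handler(3) k, of
              "B + length (pre n md c' m' M) + 1 + length (suf n md c' m' M) + 1" h' pc' s' l']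
            that hdl_simple ii handler(1) top_ok.handler[OF handler(2)] by auto
      qed (use simple in auto)
    next
      assume k: "k = length (hdl n md c' m') \<and> synced q h"
      then have ii: "i = Throw"
        using call_site_instrs(6)[OF handler(2)] i handler(1) by simp
      show thesis
        by (rule plain[OF b]) (use ii k in \<open>auto simp: exec_simps\<close>)
    qed
  qed
qed

text \<open>Links the machine's choice of callee with the monitor's. By \<open>at_invoke\<close>
  both look at the same target; virtual calls are settled by \<open>dispatch\<close>, the others by
  their single candidate.\<close>

lemma at_invoke_callee:
  assumes site: "call_site c m n B md c' m' M" and at: "at_invoke n md c' m' M q h s l"
    and inv: "invoke W' h md c' m' s = Some r"
  shows "target_ok md n h l"
    and "r = NullTarget \<Longrightarrow> target n md c' m' h l = None"
    and "r = Callee d' M' this vs s' \<Longrightarrow> target n md c' m' h l = Some d' \<and>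
      vs = args_of n (length (params M)) l \<and> declares W' d' m' M' \<and> params M' = params M \<and> ret M' = ret M \<and>
      list_all2 (conf W' h) vs (params M)"
proof -
  obtain d where d: "lookup_method W c' m' = Some (d, M)" using call_site_lookup[OF site] by blast
  have c': "c' \<noteq> sc" using call_site_fresh[OF site] .
  obtain d\<^sub>0 M\<^sub>0 where dM0: "lookup_method W' c' m' = Some (d\<^sub>0, M\<^sub>0)"
    using inv by (auto simp: invoke_def split: option.splits)
  then have d0: "d\<^sub>0 = d" and M0: "decl_rel M M\<^sub>0"
    using lookup_method_W'[OF dM0 c'] d by auto
  then have par: "params M\<^sub>0 = params M" "ret M\<^sub>0 = ret M" by (auto simp: decl_rel_def)
  let ?k = "length (params M)" and ?vs = "args_of n (length (params M)) l"
  obtain s\<^sub>0 where s: "s = rev ?vs @ (if md = Static then s\<^sub>0 else l ! n # s\<^sub>0)"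
    using at by (auto simp: at_invoke_def)
  have take: "rev (take ?k s) = ?vs" and drop: "drop ?k s = (if md = Static then s\<^sub>0 else l ! n # s\<^sub>0)"
    unfolding s by simp_all
  note inv' = inv[unfolded invoke_def dM0 option.case prod.case par take drop Let_def]
  have conf: "list_all2 (conf W' h) ?vs (params M)"
    using inv' by (auto split: if_splits)
  have "target_ok md n h l \<and> (r = NullTarget \<longrightarrow> target n md c' m' h l = None) \<and>
    (\<forall>d' M' this vs s'. r = Callee d' M' this vs s' \<longrightarrow> target n md c' m' h l = Some d' \<and>
      vs = ?vs \<and> declares W' d' m' M' \<and> params M' = params M \<and> ret M' = ret M)"
  proof (cases "md = Static")
    case True
    have "declares W' d m' M\<^sub>0" using lookup_method_Some[OF dM0] d0 by simp
    then show ?thesis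
      using inv' True candidates_not_Virtual[OF d, of md] d0 par
      by (auto simp: target_ok_def selected_def split: if_splits)
  next
    case False
    show ?thesis
    proof (cases "l ! n")
      case (Const x)
      \<comment> \<open>The lookup is undefined for any other literal as target.\<close>
      then have "x = Null" "r = NullTarget" using inv' False by (auto split: if_splits const.splits)
      moreover have "find (inst W' h (Const Null)) ks = None" for ks
        by (simp add: find_None_iff inst_def)
      ultimately show ?thesis using Const False by (simp add: target_ok_def selected_def)
    next
      case (Addr a)
      obtain ob where ob: "objs h a = Some ob" "subcls W' (class_of ob) c'"
        and r: "map_option (\<lambda>(d', M'). Callee d' M' [Addr a] ?vs s\<^sub>0)
          (if md = Special then Some (d\<^sub>0, M\<^sub>0) else lookup_method W' (class_of ob) m') = Some r"
        using inv' False Addr by (auto split: if_splits option.splits)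
      have inst: "inst W' h (l ! n) = subcls W' (class_of ob)"
        using Addr ob(1) by (auto simp: inst_def cast_ok_def)
      obtain d' M' where d': "(if md = Special then Some (d\<^sub>0, M\<^sub>0) else lookup_method W' (class_of ob) m')
          = Some (d', M')" "r = Callee d' M' [Addr a] ?vs s\<^sub>0"
        using r by auto
      have "target n md c' m' h l = Some d' \<and> declares W' d' m' M' \<and> params M' = params M \<and> ret M' = ret M"
      proof (cases "md = Special")
        case True
        then have eq: "d' = d" "M' = M\<^sub>0" using d'(1) d0 by auto
        \<comment> \<open>A special call requires an object of a subclass of \<open>c'\<close>,
          hence of \<open>d\<close>, so the only test succeeds.\<close>
        have "subcls W' (class_of ob) d"
          using ob(2) lookup_method_Some[OF dM0] d0 subcls_trans by blast
        then have "target n md c' m' h l = Some d"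
          using candidates_not_Virtual[OF d, of md] True False inst by (simp add: selected_def)
        then show ?thesis using eq lookup_method_Some[OF dM0] d0 par by simp
      next
        case False
        then have lk: "lookup_method W' (class_of ob) m' = Some (d', M')" using d'(1) by simp
        have md: "md = Virtual" using False \<open>md \<noteq> Static\<close> by (cases md) auto
        have f: "find (subcls W' (class_of ob)) (candidates W Virtual c' m') = Some d'"
          by (rule dispatch[OF d c' lk ob(2)])
        then have cand: "subcls W d' d"
          using find_SomeD[OF f] set_candidates[OF d] by simp
        have decl: "declares W' d' m' M'" using lookup_method_Some[OF lk] by simp
        obtain M\<^sub>1 where M1: "declares W d' m' M\<^sub>1" "decl_rel M\<^sub>1 M'" using declares_W'[OF decl] by blast
        have "params M\<^sub>1 = params M" "ret M\<^sub>1 = ret M"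
          using consistent[OF cand M1(1)] lookup_method_Some[OF d] by auto
        then show ?thesis using f decl M1(2) md inst by (simp add: decl_rel_def selected_def)
      qed
      then show ?thesis using d'(2) Addr ob(1) by (simp add: target_ok_def)
    qed
  qed
  then show "target_ok md n h l"
    and "r = NullTarget \<Longrightarrow> target n md c' m' h l = None"
    and "r = Callee d' M' this vs s' \<Longrightarrow> target n md c' m' h l = Some d' \<and>
      vs = args_of n (length (params M)) l \<and> declares W' d' m' M' \<and> params M' = params M \<and> ret M' = ret M \<and>
      list_all2 (conf W' h) vs (params M)"
    using conf by auto
qed

section \<open>Preservation of the invariant\<close>

lemma suspended_all_keeps_classes:
  "keeps_classes h h' \<Longrightarrow> \<forall>F \<in> set R. suspended h F \<Longrightarrow> \<forall>F \<in> set R. suspended h' F"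
  using suspended_keeps_classes by blast

lemma state_objs [simp]: "state (h\<lparr>objs := x\<rparr>) = state h"
  by (simp add: sec_state_def)

text \<open>A configuration that calls no API method emits no pre-action and is followed by no
  post-action, so \<open>q\<close> stays the same.\<close>

lemma safe_step:
  assumes "step W' sc K K'" and "safe q K" and no_api: "api_call W' K = None"
  shows "safe q K'"
  using assms(1)
proof (cases rule: step.cases)
  case (Normal c m pc i h s l h' pc' s' l' R)
  have top: "top_ok q h c m pc s l" and R: "\<forall>F \<in> set R. suspended h F"
    using assms(2) Normal(1) by (auto elim: safe.cases)
  have R': "\<forall>F \<in> set R. suspended h' F"
    using exec_keeps_classes[OF Normal(4)] R by (rule suspended_all_keeps_classes)
  have "top_ok q h' c m pc' s' l'"
    using top Normal(3)
  proof (cases rule: top_ok_cases)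
    case (plain n b)
    then show ?thesis using Normal(4) by blast
  next
    case (stuck md c' m')
    then show ?thesis using Normal(4) by (simp add: exec_simps)
  next
    case (call n B md c' m' M)
    then show ?thesis using Normal(4) by (simp add: exec_simps)
  qed
  then show ?thesis using R' Normal(2) by (simp add: safe_top)
next
  case (Raise c m pc i h s x a l R)
  let ?h = "h\<lparr>objs := (objs h)(a \<mapsto> blank W' x)\<rparr>"
  have top: "top_ok q h c m pc s l" and R: "\<forall>F \<in> set R. suspended h F"
    using assms(2) Raise(1) by (auto elim: safe.cases)
  have hp: "keeps_classes h ?h" using Raise(5) by (rule keeps_classes_new)
  have R': "\<forall>F \<in> set R. suspended ?h F"
    using hp R by (rule suspended_all_keeps_classes)
  have a: "is_throwable W' ?h a" using Raise(4) by (rule throws_throwable)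
  have null: "invoke W' h md c' m' s = Some NullTarget" if "i = Invoke md c' m'" for md c' m'
    using Raise(4) that by (auto elim: throws.cases)
  show ?thesis
    using top Raise(3)
  proof (cases rule: top_ok_cases)
    case (plain n b)
    \<comment> \<open>Monitor code does not raise, so the second alternative of \<open>plain\<close>
      is out; allocating the exception leaves the fields alone.\<close>
    have "synced q ?h"
      using plain(3) simple_throws[of i] Raise(4) by (auto simp: synced_def)
    then show ?thesis
      unfolding Raise(2) using plain(1,2) a R' Raise(3) by (intro safe_exc) auto
  next
    case (stuck md c' m')
    then show ?thesis using null by simp
  next
    case (call n B md c' m' M)
    \<comment> \<open>A null target raises at the invoke itself and enters the block's handler
      although no API method was called. No class is selected, so neither the BEFORE nor the
      EXCEPTIONAL code has an effect.\<close>
    note inv = null[OF call(3)]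
    have t: "target n md c' m' h l = None" "target n md c' m' ?h l = None"
      using at_invoke_callee(1,2)[OF call(1,4) inv] selected_keeps_classes[OF hp] by auto
    then have "after_exc n md c' m' M q ?h l"
      using call(4) by (auto simp: at_invoke_def after_exc_def reaction_def)
    then show ?thesis
      unfolding Raise(2) call(2) using call(1) a R' by (intro safe_exc_call)
  qed
next
  case (Throw c m pc h a s l R)
  have top: "top_ok q h c m pc (Addr a # s) l" and R: "\<forall>F \<in> set R. suspended h F"
    using assms(2) Throw(1) by (auto elim: safe.cases)
  show ?thesis
    using top Throw(3)
  proof (cases rule: top_ok_cases)
    case (plain n b)
    then show ?thesis
      unfolding Throw(2) using Throw(3,4) R by (intro safe_exc[of c m n b]) auto
  qed auto
next
  case (Call c m pc md c' m' h s d M this vs s' b l R)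
  have top: "top_ok q h c m pc s l" and R: "\<forall>F \<in> set R. suspended h F"
    using assms(2) Call(1) by (auto elim: safe.cases)
  show ?thesis
    using top Call(3)
  proof (cases rule: top_ok_cases)
    case (stuck md\<^sub>0 c\<^sub>0 m\<^sub>0)
    then show ?thesis using Call(4) by simp
  next
    case (call n B md\<^sub>0 c\<^sub>0 m\<^sub>0 M\<^sub>0)
    then have at: "at_invoke n md c' m' M\<^sub>0 q h s l" and site: "call_site c m n B md c' m' M\<^sub>0" by simp_all
    note callee = at_invoke_callee[OF site at Call(4)]
    have t: "target n md c' m' h l = Some d" and decl: "declares W' d m' M"
      using callee(3) by auto
    have d: "d \<notin> fst ` set api" using body_Some[OF decl Call(5)] .
    \<comment> \<open>The callee belongs to the program, so the BEFORE code changed nothing and the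
      fields are not ahead.\<close>
    have "synced q h"
      using at t d by (auto simp: at_invoke_def synced_def reaction_def)
    moreover have "method_body W' d m' = Some b"
      using decl Call(5) by (auto simp: method_body_def declares_def)
    then obtain n' b' where "prog_code d m' n' b'" using method_body_prog_code by blast
    ultimately have "top_ok q h d m' 0 s\<^sub>1 l\<^sub>1" for s\<^sub>1 l\<^sub>1
      using boundary[of d m' n' b' q h 0] by (simp add: new_pc_def)
    moreover have "suspended h (Frame c m pc s' l)"
    proof -
      have "pc = B + length (pre n md c' m' M\<^sub>0)" using call(2,3) by simp
      moreover have "\<forall>k. target n md c' m' h l = Some k \<longrightarrow> k \<notin> fst ` set api" using t d by simp
      ultimately show ?thesis unfolding suspended.simps using site callee(1) by blast
    qed
    ultimately show ?thesis unfolding Call(2) using R by (intro safe_top) auto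
  qed auto
next
  case (Return c m pc T h r s l c' m' pc' s' l' R)
  have top: "top_ok q h c m pc (push_ret r s) l"
    and F: "suspended h (Frame c' m' pc' s' l')" and R: "\<forall>F \<in> set R. suspended h F"
    using assms(2) Return(1) by (auto elim: safe.cases)
  show ?thesis
    using top Return(3)
  proof (cases rule: top_ok_cases)
    case (plain n b)
    then show ?thesis
      unfolding Return(2) using suspended_resume[OF F] R by (intro safe_top) auto
  qed auto
next
  case (Return_main c m pc T h r s l)
  then show ?thesis by (simp add: safe_end)
next
  case (Api_return c m pc md c' m' h s d M this vs s' h' r l R)
  then show ?thesis using no_api by (simp add: api_call_def)
next
  case (Api_throw c m pc md c' m' h s d M this vs s' h' a l R)
  then show ?thesis using no_api by (simp add: api_call_def)
next
  case (Catch h a c m pc t s l R)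
  from assms(2)[unfolded Catch(1)] show ?thesis
  proof (cases rule: safe.cases)
    case (safe_exc_call n B md c' m' M)
    obtain d where d: "lookup_method W c' m' = Some (d, M)"
      using call_site_lookup[OF safe_exc_call(2)] by blast
    obtain ob where ob: "objs h a = Some ob" "subcls W' (class_of ob) ''Throwable''"
      using throwable_subcls[OF safe_exc_call(3)] by blast
    have "t = B + length (pre n md c' m' M) + 1 + length (suf n md c' m' M) + 1"
      using handler_at_call[OF safe_exc_call(2) ob] Catch(3) safe_exc_call(1) by simp
    then have "top_ok q h c m t [Addr a] l"
      using handler[OF safe_exc_call(2) wpo_handler[OF d safe_exc_call(4)], of "[Addr a]"] by simp
    then show ?thesis unfolding Catch(2) using safe_exc_call(5) by (intro safe_top)
  next
    case (safe_exc n b)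
    obtain j where "t = new_pc (blk n) (instrs b) j"
      using handler_at_other[OF safe_exc(1) Catch(3) safe_exc(2)] by blast
    then show ?thesis
      unfolding Catch(2) using boundary[OF safe_exc(1,4)] safe_exc(5) by (intro safe_top) auto
  qed
next
  case (Unwind h a c m pc s l R)
  from assms(2)[unfolded Unwind(1)] show ?thesis
  proof (cases rule: safe.cases)
    case (safe_exc_call n B md c' m' M)
    obtain ob where ob: "objs h a = Some ob" "subcls W' (class_of ob) ''Throwable''"
      using throwable_subcls[OF safe_exc_call(3)] by blast
    \<comment> \<open>Contradiction: the handler of the block catches every throwable, so no
      exception leaves an invoke without passing through it.\<close>
    then show ?thesis
      using handler_at_call[OF safe_exc_call(2) ob] Unwind(3) safe_exc_call(1) by simp
  next
    case (safe_exc n b)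
    then show ?thesis unfolding Unwind(2) by (intro safe_unwind)
  qed
qed

text \<open>The pre-action cannot fail, because the BEFORE code has already computed its successor
  state. The post-action may, and then \<open>safe None\<close> holds behind the call.\<close>

lemma safe_api_call:
  assumes "safe q K" and "api_call W' K = Some (d, m', T, vs)"
  obtains \<sigma> \<sigma>' where "q = Some \<sigma>" "delta C (Some \<sigma>) (Pre d m' vs) = Some \<sigma>'" "alphabet api (Pre d m' vs)"
    "\<And>K'. step W' sc K K' \<Longrightarrow> safe (delta C (Some \<sigma>') (post_action d m' T vs K')) K' \<and>
      alphabet api (post_action d m' T vs K') \<and> is_post (post_action d m' T vs K')"
proof -
  obtain h c m pc s l R md c' M this s' where
    K: "K = (h, Frame c m pc s l # R)" and i: "instr_at W' c m pc = Some (Invoke md c' m')"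
    and inv: "invoke W' h md c' m' s = Some (Callee d M this vs s')" and M: "body M = None" "T = ret M"
    using assms(2)
    by (auto simp: api_call_def split: prod.splits list.splits frame.splits option.splits instr.splits
        callee.splits if_splits)
  have top: "top_ok q h c m pc s l" and R: "\<forall>F \<in> set R. suspended h F"
    using assms(1) K by (auto elim: safe.cases)
  obtain n B M\<^sub>0 where site: "call_site c m n B md c' m' M\<^sub>0" and pc: "pc = B + length (pre n md c' m' M\<^sub>0)"
    and at: "at_invoke n md c' m' M\<^sub>0 q h s l"
    using top i
  proof (cases rule: top_ok_cases)
    case (stuck md\<^sub>0 c\<^sub>0 m\<^sub>0)
    then show ?thesis using inv by simp
  qed (use that in auto)
  obtain d\<^sub>0 where d0: "lookup_method W c' m' = Some (d\<^sub>0, M\<^sub>0)" using call_site_lookup[OF site] by blast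
  note callee = at_invoke_callee[OF site at inv]
  have tok: "target_ok md n h l" and t: "target n md c' m' h l = Some d"
    and vs: "vs = args_of n (length (params M\<^sub>0)) l"
    and decl: "declares W' d m' M" and sig: "params M = params M\<^sub>0" "ret M = ret M\<^sub>0"
    and conf: "list_all2 (conf W' h) vs (params M\<^sub>0)"
    using callee(1,3) by auto
  obtain M\<^sub>1 where M1: "declares api d m' M\<^sub>1" "params M\<^sub>1 = params M" "ret M\<^sub>1 = ret M"
    using body_None[OF decl M(1)] by blast
  have d: "d \<in> fst ` set api" using M1(1) by (force simp: declares_def dest: map_of_SomeD)
  have shape: "list_all2 val_shape vs (params M\<^sub>1)"
    using conf M1(2) sig(1) by (auto elim: list_all2_mono simp: conf_val_shape)
  obtain \<sigma> where q: "q = Some \<sigma>" and pre: "react C Before d m' vs None \<sigma> = Some (state h)"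
    using at t d vs by (auto simp: at_invoke_def reaction_def)
  \<comment> \<open>The fields survive by \<open>api_heap\<close>, and the later tests, made in the
    heap the API leaves behind, by persistence of classes.\<close>
  have heap: "keeps_classes h h'" "state h' = state h" "target n md c' m' h' l = Some d"
    "\<forall>F \<in> set R. suspended h' F" if "api_heap W' sc h h'" for h'
  proof -
    show hp: "keeps_classes h h'" using that by (simp add: api_heap_def hext_keeps_classes)
    show "state h' = state h" using that by (simp add: api_heap_def sec_state_def)
    show "target n md c' m' h' l = Some d" using selected_keeps_classes[OF hp tok] t by simp
    show "\<forall>F \<in> set R. suspended h' F" using hp R by (rule suspended_all_keeps_classes)
  qed
  show thesis
  proof (rule that[OF q])
    show "delta C (Some \<sigma>) (Pre d m' vs) = Some (state h)" using pre by simp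
    show "alphabet api (Pre d m' vs)" using M1(1) shape by auto
    fix K'
    assume "step W' sc K K'"
    then show "safe (delta C (Some (state h)) (post_action d m' T vs K')) K' \<and>
      alphabet api (post_action d m' T vs K') \<and> is_post (post_action d m' T vs K')"
    proof (cases rule: step.cases)
      case (Normal c m pc i h s l h' pc' s' l' R)
      then show ?thesis using K i by (simp add: exec_simps)
    next
      case (Raise c m pc i h s x a l R)
      then show ?thesis using K i inv by (auto elim: throws.cases)
    next
      case (Api_return _ _ _ md\<^sub>0 c\<^sub>0 m\<^sub>0 _ _ d\<^sub>1 M\<^sub>2 this\<^sub>0 vs\<^sub>0 s\<^sub>0 h' r _ _)
      then have K': "K' = (h', Frame c m (pc + 1) (push_ret r s') l # R)"
        and h': "api_heap W' sc h h'" and r: "conf_ret W' h' r (ret M)"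
        using K i inv by auto
      \<comment> \<open>The trace reads the return value off the stack, guided by the declared
        return type. By \<open>conf_ret\<close> a value is present iff one is declared, so this
        recovers \<open>r\<close>.\<close>
      define r' where "r' = (case T of None \<Rightarrow> None | Some _ \<Rightarrow> Some (hd (push_ret r s')))"
      have r': "r' = r"
        using r M(2) by (cases r; cases "ret M") (auto simp: conf_ret_def r'_def push_ret_def)
      have "after_call n md c' m' M\<^sub>0 (react C After d m' vs r (state h)) h' (push_ret r s') l"
        using heap(2,3)[OF h'] d vs r' M(2) sig(2)
        by (auto simp: after_call_def reaction_def r'_def split: option.splits)
      from suffix[OF site wpo_suffix[OF d0 this]]
      have "top_ok (react C After d m' vs r (state h)) h' c m (pc + 1) (push_ret r s') l"
        using pc by simp
      then have "safe (react C After d m' vs r (state h)) K'"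
        unfolding K' using heap(4)[OF h'] by (intro safe_top)
      moreover have "rel_option val_shape r (ret M\<^sub>1)"
        using r M1(3) by (auto simp: conf_ret_def elim: option.rel_mono_strong simp: conf_val_shape)
      ultimately show ?thesis
        using K' M1(1) shape r'[unfolded r'_def] by auto
    next
      case (Api_throw _ _ _ md\<^sub>0 c\<^sub>0 m\<^sub>0 _ _ d\<^sub>1 M\<^sub>2 this\<^sub>0 vs\<^sub>0 s\<^sub>0 h' a _ _)
      then have K': "K' = (h', Exc a # Frame c m pc s' l # R)"
        and h': "api_heap W' sc h h'" and a: "is_throwable W' h' a"
        using K i inv by auto
      have "after_exc n md c' m' M\<^sub>0 (react C Exceptional d m' vs None (state h)) h' l"
        using heap(2,3)[OF h'] d vs by (auto simp: after_exc_def reaction_def)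
      then have "safe (react C Exceptional d m' vs None (state h)) K'"
        unfolding K' pc using site a heap(4)[OF h'] by (intro safe_exc_call)
      then show ?thesis using K' M1(1) shape by auto
    qed (use K i inv M in auto)
  qed
qed

lemma initial_safe:
  assumes "initial api (inline api sc C P) K"
  shows "safe (q_init C) K"
proof -
  obtain c m b where b: "method_body W' c m = Some b"
    and K: "K = (init_heap W', [Frame c m 0 [] (replicate (mxl b) (Const Null))])"
    using assms by (auto simp: initial_def)
  obtain n b' where b': "prog_code c m n b'" using method_body_prog_code[OF b] by blast
  have "synced (q_init C) (init_heap W')"
    by (auto simp: synced_def q_init_def init_heap_def sec_state_def map_of_W'_sc)
  from boundary[OF b' this, of 0] have "top_ok (q_init C) (init_heap W') c m 0 s l" for s l
    by (simp add: new_pc_def)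
  then show ?thesis unfolding K by (intro safe_top) auto
qed

section \<open>Traces of the inlined program\<close>

text \<open>Either accepted, or rejected only at the last action, which is a post-action. The
  alphabet is recorded because \<open>post_total\<close> is restricted to it.\<close>

definition good :: "sstate option \<Rightarrow> action list \<Rightarrow> bool" where
  "good q as \<longleftrightarrow> (\<forall>a \<in> set as. alphabet api a) \<and>
     (foldl (delta C) q as \<noteq> None \<or>
      (\<exists>w a. as = w @ [a] \<and> foldl (delta C) q w \<noteq> None \<and> is_post a))"

lemma good_Cons:
  assumes "alphabet api a" and "good (delta C q a) as"
  shows "good q (a # as)"
proof (cases "foldl (delta C) (delta C q a) as = None")
  case False
  then show ?thesis using assms by (simp add: good_def)
next
  case True
  then obtain w b where w: "as = w @ [b]" "foldl (delta C) (delta C q a) w \<noteq> None" "is_post b"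
    using assms(2) by (auto simp: good_def)
  then have "a # as = (a # w) @ [b] \<and> foldl (delta C) q (a # w) \<noteq> None \<and> is_post b" by simp
  then show ?thesis using assms unfolding good_def by (metis set_ConsD)
qed

text \<open>In the error state the trace is empty, since by \<open>safe_api_call\<close> a safe
  configuration calls the API only in a proper automaton state.\<close>

lemma srt_from_good:
  assumes "safe q (hd E)" and "E \<noteq> []" and "\<forall>i. Suc i < length E \<longrightarrow> step W' sc (E ! i) (E ! Suc i)"
  shows "if q = None then srt_from W' None V E = [] else good q (srt_from W' None V E)"
  using assms
proof (induction E arbitrary: q V rule: length_induct)
  case (1 E)
  obtain K E' where E: "E = K # E'" using 1(3) by (cases E) auto
  have steps: "\<forall>i. Suc i < length E' \<longrightarrow> step W' sc (E' ! i) (E' ! Suc i)"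
    using 1(4) E by fastforce
  have first: "step W' sc K (hd E')" if "E' \<noteq> []"
    using 1(4) E that by (cases E') force+
  have IH: "if q = None then srt_from W' None V E' = [] else good q (srt_from W' None V E')"
    if "safe q (hd E')" "E' \<noteq> []" for q V
    using 1(1) E that steps by (metis length_Cons lessI)
  have K: "safe q K" using 1(2) E by simp
  show ?case
  proof (cases "api_call W' K")
    case None
    show ?thesis
    proof (cases "E' = []")
      case True
      then show ?thesis using E None by (simp add: good_def)
    next
      case False
      then show ?thesis
        using IH[OF safe_step[OF first[OF False] K None] False] E None by simp
    qed
  next
    case (Some x)
    then obtain d m T vs where x: "api_call W' K = Some (d, m, T, vs)" by (cases x) auto
    obtain \<sigma> \<sigma>' where q: "q = Some \<sigma>" "delta C (Some \<sigma>) (Pre d m vs) = Some \<sigma>'" "alphabet api (Pre d m vs)"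
      and post: "\<And>K'. step W' sc K K' \<Longrightarrow> safe (delta C (Some \<sigma>') (post_action d m T vs K')) K' \<and>
        alphabet api (post_action d m T vs K') \<and> is_post (post_action d m T vs K')"
      using safe_api_call[OF K x] by blast
    have pre: "good q (Pre d m vs # as)" if "good (Some \<sigma>') as" for as
      using good_Cons[OF q(3), of q as] q(1,2) that by simp
    show ?thesis
    proof (cases E')
      case Nil
      then show ?thesis using E x q(1) pre[of "[]"] by (simp add: good_def)
    next
      case (Cons K' E'')
      let ?a = "post_action d m T vs K'" and ?as = "srt_from W' None V E'"
      have K': "safe (delta C (Some \<sigma>') ?a) K'" "alphabet api ?a" "is_post ?a"
        using post[of K'] first Cons by auto
      have "good (Some \<sigma>') (?a # ?as)"
      proof (cases "delta C (Some \<sigma>') ?a = None")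
        case True
        then have "?as = []" using IH[of None V] K'(1) Cons by simp
        then have "?a # ?as = [] @ [?a] \<and> foldl (delta C) (Some \<sigma>') [] \<noteq> None \<and> is_post ?a"
          using K'(3) by simp
        moreover have "\<forall>b \<in> set (?a # ?as). alphabet api b" using \<open>?as = []\<close> K'(2) by simp
        ultimately show ?thesis unfolding good_def by blast
      next
        case False
        have "safe (delta C (Some \<sigma>') ?a) (hd E')" "E' \<noteq> []" using K'(1) Cons by simp_all
        from IH[OF this, of V] have "good (delta C (Some \<sigma>') ?a) ?as"
          by (simp only: False if_False)
        then show ?thesis using K'(2) by (intro good_Cons)
      qed
      then show ?thesis using E Cons x q(1) pre by simp
    qed
  qed
qed

lemma execution_good:
  assumes "execution api sc (inline api sc C P) (FinSeq E)"
  shows "good (q_init C) (srt_from W' None [] E)"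
  using srt_from_good[of "q_init C" E "[]"] assms initial_safe[of "hd E"] by (simp add: q_init_def)

lemma accepts_prefix: "accepts C (w @ w') \<Longrightarrow> accepts C w"
proof -
  have "foldl (delta C) None w' = None" by (induction w') auto
  then show "accepts C (w @ w') \<Longrightarrow> accepts C w" by (cases "foldl (delta C) (q_init C) w") (auto simp: accepts_def)
qed

lemma SRT_good:
  assumes "execution api sc (inline api sc C P) E"
  shows "SRT W' E \<in> contract_traces C \<or>
    (\<exists>w a. SRT W' E = FinSeq (w @ [a]) \<and> FinSeq w \<in> contract_traces C \<and> is_post a \<and>
      (\<forall>x \<in> set (w @ [a]). alphabet api x))"
proof -
  have fin: "FinSeq as \<in> contract_traces C \<or>
    (\<exists>w a. FinSeq as = FinSeq (w @ [a]) \<and> FinSeq w \<in> contract_traces C \<and> is_post a \<and>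
      (\<forall>x \<in> set (w @ [a]). alphabet api x))" if "good (q_init C) as" for as
    using that by (auto simp: good_def accepts_def)
  show ?thesis
  proof (cases E)
    case (FinSeq E')
    then show ?thesis using fin[OF execution_good] assms by simp
  next
    case (InfSeq E')
    let ?t = "\<lambda>n. srt_from W' None [] (map E' [0..<n])"
    have good: "good (q_init C) (?t n)" for n
    proof (cases n)
      case 0
      then show ?thesis by (simp add: good_def q_init_def)
    next
      case (Suc k)
      have "hd (map E' [0..<Suc k]) = E' 0" by (simp add: hd_map upt_conv_Cons del: upt_Suc)
      then show ?thesis
        unfolding Suc using assms InfSeq by (intro execution_good) (simp del: upt_Suc add: nth_append)
    qed
    have mono: "\<exists>ys. ?t (Suc n) = ?t n @ ys" for n
      using srt_from_snoc[of W' None "[]" "map E' [0..<n]" "E' n"] by simp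
    have SRT: "SRT W' E = seq_limit ?t" using InfSeq by simp
    show ?thesis
    proof (rule seq_limit_cases[of ?t, OF mono])
      fix n
      assume "seq_limit ?t = FinSeq (?t n)"
      then show ?thesis using fin[OF good[of n]] SRT by simp
    next
      fix u
      assume u: "seq_limit ?t = InfSeq u" "\<And>N. \<exists>n ys. ys \<noteq> [] \<and> ?t n = map u [0..<N] @ ys"
      have "accepts C (map u [0..<N])" for N
      proof -
        obtain n ys where n: "ys \<noteq> []" "?t n = map u [0..<N] @ ys" using u(2) by blast
        from good[of n] consider "accepts C (?t n)" | w a where "?t n = w @ [a]" "accepts C w"
          by (auto simp: good_def accepts_def)
        then show ?thesis
        proof cases
          case 1
          then show ?thesis using n(2) accepts_prefix by simp
        next
          case 2
          \<comment> \<open>As \<open>ys\<close> is not empty, removing the last, possibly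
            violating, action leaves \<open>map u [0..<N]\<close> intact.\<close>
          then have "w = map u [0..<N] @ butlast ys"
            using n by (metis butlast_append butlast_snoc)
          then show ?thesis using 2(2) accepts_prefix by simp
        qed
      qed
      then show ?thesis using SRT u(1) by simp
    qed
  qed
qed

end

theorem theorem2:
  fixes api :: api and P :: program and C :: contract and sc :: cname
  assumes "wf_api api" and "wf_prog api P" and "wf_contract api C"
    and "fresh_class api P sc"
  shows "(post_total api C \<longrightarrow> adheres api sc (inline api sc C P) C) \<and>
    (\<forall>E. execution api sc (inline api sc C P) E \<longrightarrow>
       SRT (link api (inline api sc C P)) E \<in> contract_traces C \<or>
       (\<exists>w a. SRT (link api (inline api sc C P)) E = FinSeq (w @ [a]) \<and>
          FinSeq w \<in> contract_traces C \<and> is_post a))"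
proof -
  interpret inlining api P C sc
    using assms by unfold_locales
  \<comment> \<open>\<open>post_total\<close> turns the second alternative of
    \<open>SRT_good\<close> into the first: the accepted \<open>w\<close> stays accepted when
    extended by the post-action.\<close>
  have "SRT W' E \<in> contract_traces C"
    if "post_total api C" "execution api sc (inline api sc C P) E" for E
    using SRT_good[OF that(2)] that(1) unfolding post_total_def by auto
  then show ?thesis
    using SRT_good unfolding adheres_def by blast
qed

end
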